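(* Let $N$ be a positive integer and let $\phi:\mathbb{Q}^N\to\mathbb{Q}^N$ be an endomorphism. Then $$h_A(\phi)=m(p_\phi(X)),$$ where $p_\phi(X)$ is the characteristic polynomial of $\phi$ over $\mathbb{Z}$.
   Context: $\mathbb{Q}^N$ is regarded as a discrete Abelian group; an endomorphism of it is a group endomorphism (automatically $\mathbb{Q}$-linear), represented by a rational $N\times N$ matrix $M_\phi$ with respect to the canonical base. Algebraic entropy: let $G$ be a locally compact Abelian (LCA) group with Haar measure $\mu$, $\phi:G\to G$ a continuous endomorphism, and let $\mathcal{C}(G)$ be the family of compact neighborhoods of $0$ in $G$. For $C\in\mathcal{C}(G)$ and $n\geq 1$ put $T_n(\phi,C)=C+\phi C+\ldots+\phi^{n-1}C$, $H_A(\phi,C)=\limsup_{n\to\infty}\frac{\log\mu(T_n(\phi,C))}{n}$ (independent of the choice of $\mu$), and $h_A(\phi)=\sup\{H_A(\phi,C):C\in\mathcal{C}(G)\}$. For $G=\mathbb{Q}^N$ discrete, $\mathcal{C}(G)$ consists of the finite subsets containing $0$, and $\mu$ can be taken to be the cardinality. Characteristic polynomial over $\mathbb{Z}$: if $f(X)\in\mathbb{Q}[X]$ is the monic characteristic polynomial of $M_\phi$ and $s$ is the minimum positive integer such that $sf(X)\in\mathbb{Z}[X]$, then $p_\phi(X)=sf(X)$. (Logarithmic) Mahler measure: for a non-constant polynomial $f(X)=s\prod_{i=1}^N(X-\lambda_i)\in\mathbb{C}[X]$ with $s\neq 0$ (roots counted with multiplicity), $m(f(X))=\log|s|+\sum_{|\lambda_i|>1}\log|\lambda_i|$.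 *)

theory Defs
  imports
    "HOL-Analysis.Abstract_Topology"
    "HOL-Analysis.Measure_Space"
    "HOL-Library.Liminf_Limsup"
    "HOL-Library.Extended_Real"
    "HOL-Algebra.Coset"
    "HOL-Computational_Algebra.Fundamental_Theorem_Algebra"
    "Jordan_Normal_Form.Char_Poly"
begin

text \<open>
  A locally compact Abelian group is given by a group record \<open>G\<close> (written multiplicatively, as
  usual in HOL-Algebra), a topology \<open>T\<close> with topspace \<open>carrier G\<close>, and a Haar measure \<open>M\<close> on it.
  The entropy does not depend on the choice of \<open>M\<close>; for a discrete group one can take the counting
  measure.
\<close>

definition compact_nbhds_one :: "('a, 'b) monoid_scheme \<Rightarrow> 'a topology \<Rightarrow> 'a set set" where
  "compact_nbhds_one G T =
    {C. compactin T C \<and> (\<exists>U. openin T U \<and> \<one>\<^bsub>G\<^esub> \<in> U \<and> U \<subseteq> C)}"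

primrec trajectory ::
  "('a, 'b) monoid_scheme \<Rightarrow> ('a \<Rightarrow> 'a) \<Rightarrow> 'a set \<Rightarrow> nat \<Rightarrow> 'a set" where
  "trajectory G \<phi> C 0 = {\<one>\<^bsub>G\<^esub>}"
| "trajectory G \<phi> C (Suc n) = trajectory G \<phi> C n <#>\<^bsub>G\<^esub> (\<phi> ^^ n) ` C"

definition alg_entropy_wrt ::
  "('a, 'b) monoid_scheme \<Rightarrow> 'a measure \<Rightarrow> ('a \<Rightarrow> 'a) \<Rightarrow> 'a set \<Rightarrow> ereal" where
  "alg_entropy_wrt G M \<phi> C =
    limsup (\<lambda>n. ereal (ln (measure M (trajectory G \<phi> C n)) / real n))"

definition alg_entropy ::
  "('a, 'b) monoid_scheme \<Rightarrow> 'a topology \<Rightarrow> 'a measure \<Rightarrow> ('a \<Rightarrow> 'a) \<Rightarrow> ereal" where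
  "alg_entropy G T M \<phi> = (SUP C\<in>compact_nbhds_one G T. alg_entropy_wrt G M \<phi> C)"

definition discrete_alg_entropy :: "('a, 'b) monoid_scheme \<Rightarrow> ('a \<Rightarrow> 'a) \<Rightarrow> ereal" where
  "discrete_alg_entropy G =
    alg_entropy G (discrete_topology (carrier G)) (count_space (carrier G))"

lemma compact_nbhds_one_discrete:
  assumes "\<one>\<^bsub>G\<^esub> \<in> carrier G"
  shows "compact_nbhds_one G (discrete_topology (carrier G)) =
    {C. finite C \<and> C \<subseteq> carrier G \<and> \<one>\<^bsub>G\<^esub> \<in> C}"
  using assms by (auto simp: compact_nbhds_one_def compactin_discrete_topology)

definition endo_mat :: "nat \<Rightarrow> (rat Matrix.vec \<Rightarrow> rat Matrix.vec) \<Rightarrow> rat mat" where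
  "endo_mat N \<phi> = mat N N (\<lambda>(i, j). vec_index (\<phi> (unit_vec N j)) i)"

definition integral_scaling :: "rat poly \<Rightarrow> nat" where
  "integral_scaling f = (LEAST s. 0 < s \<and> (\<forall>i. Polynomial.coeff (Polynomial.smult (of_nat s) f) i \<in> \<int>))"

text \<open>The result has integer coefficients, but is kept in the type of rational polynomials.\<close>

definition char_poly_over_int :: "nat \<Rightarrow> (rat Matrix.vec \<Rightarrow> rat Matrix.vec) \<Rightarrow> rat poly" where
  "char_poly_over_int N \<phi> =
    (let f = char_poly (endo_mat N \<phi>) in Polynomial.smult (of_nat (integral_scaling f)) f)"

definition log_mahler_measure :: "complex poly \<Rightarrow> real" where
  "log_mahler_measure f =
    ln (cmod (lead_coeff f)) + (\<Sum>z\<in>#filter_mset (\<lambda>z. 1 < cmod z) (proots f). ln (cmod z))"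

end

theory Submission
  imports "Berlekamp_Zassenhaus.Factor_Bound" Defs
begin

text \<open>
  The entropy of \<open>\<phi>\<close> and the logarithmic Mahler measure \<open>m\<close> of its characteristic polynomial over the
  integers both double when \<open>\<phi>\<close> is replaced by \<open>\<phi> \<circ> \<phi>\<close>. Hence it is enough to prove that they differ by at
  most a constant that depends only on the dimension \<open>N\<close> (\<open>growth_bounds\<close>): applying this to the
  iterates \<open>\<phi>\<^sup>2\<close>, \<open>\<phi>\<^sup>4\<close>, \<open>\<phi>\<^sup>8\<close>, ... divides the constant by \<open>2\<close> again and again (\<open>growth_bounds_improved\<close>). For
  the entropy the doubling is a regrouping of the trajectory (\<open>trajectory_double\<close>). For \<open>m\<close> the roots
  are squared, and the leading coefficient is squared because
  \<open>f\<^sub>2(X\<^sup>2) = (-1)\<^sup>N f(X) f(-X)\<close> for the characteristic polynomials \<open>f\<close>, \<open>f\<^sub>2\<close> of \<open>M\<close>, \<open>M\<^sup>2\<close>, and a product of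
  primitive polynomials is primitive (\<open>mahler_square\<close>).
  
  For the estimate up to a constant, the rational vectors are written as \<open>\<rat>[X]\<^sup>N\<close> modulo the image of
  \<open>X - M\<close>. A trajectory then consists of the classes of all \<open>N\<close>-tuples of integer polynomials of degree less than
  \<open>n\<close> with coefficients of bounded size. The relation module has a triangular basis with monic diagonal entries
  whose product is the characteristic polynomial (\<open>hermite_basis_exists\<close>, \<open>char_poly_eq_prod\<close>). Therefore the
  counting problem splits into problems about one primitive integer polynomial \<open>p\<close> at a time:
  how many classes modulo \<open>p\<close> do the integer polynomials of degree less than \<open>n\<close> and bounded height fill?
  
  Suppose that one coefficient \<open>p\<^sub>j\<close> dominates all others with respect to weights \<open>\<rho>\<^sup>l\<close>. Then
  multiplication by \<open>p\<close>, read off at the positions shifted by \<open>j\<close>, is a diagonally dominant linear map. This map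
  separates integer points, so that a class has few members and there are many classes
  (\<open>card_residues_ge\<close>); it is also invertible over the reals, so that rounding a real quotient moves every
  polynomial into a small set of remainders (\<open>box_reduction\<close>). Both ways the growth rate is
  \<open>\<bar>p\<^sub>j\<bar>\<close>, up to factors that depend only on \<open>N\<close> and \<open>\<rho>\<close>.
  If no root lies in a wide enough annulus around the circle of radius \<open>\<rho>\<close>, then there is such a
  dominant coefficient and it is comparable with the Mahler measure (\<open>dominant_coefficient_exists\<close>). By
  the pigeonhole principle one of \<open>N + 1\<close> fixed disjoint annuli is free of the \<open>N\<close> roots (\<open>root_gap_exists\<close>), so
  \<open>\<rho>\<close> is bounded in terms of \<open>N\<close>.
\<close>

section \<open>Integer polynomials with a dominant coefficient: counting residues\<close>

text \<open>
  The weights \<open>\<rho>\<^sup>l\<close> make up for roots on the unit circle: after the substitution \<open>X \<mapsto> \<rho> X\<close> the condition says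
  that \<open>p\<close> is, in the sum norm of its coefficients, close to a single monomial, which needs only that no root is near the
  circle of radius \<open>\<rho>\<close>.
\<close>

definition dominant :: "real poly \<Rightarrow> nat \<Rightarrow> real \<Rightarrow> bool" where
  "dominant p j \<rho> \<longleftrightarrow> coeff p j \<noteq> 0 \<and>
    (\<Sum>l\<in>{..degree p} - {j}. \<bar>coeff p l\<bar> * \<rho> ^ l) \<le> \<bar>coeff p j\<bar> * \<rho> ^ j / 2"

text \<open>
  This is diagonal dominance of \<open>d \<mapsto> p d\<close>, in a form that localises the large output coefficient. The
  index \<open>i\<close> maximises the weighted coefficient of \<open>d\<close>, so that in the coefficient \<open>i + j\<close> of the product the
  summand \<open>p\<^sub>j d\<^sub>i\<close> is at least twice as large as the sum of all others.
\<close>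

lemma dominant_separates:
  fixes p d :: "real poly"
  assumes "dominant p j \<rho>" "0 < \<rho>" "d \<noteq> 0"
  obtains i where "coeff d i \<noteq> 0" "\<And>k. \<bar>coeff d k\<bar> * \<rho> ^ k \<le> \<bar>coeff d i\<bar> * \<rho> ^ i"
    "\<bar>coeff d i\<bar> * \<bar>coeff p j\<bar> / 2 \<le> \<bar>coeff (p * d) (i + j)\<bar>"
proof -
  define w where "w = (\<lambda>k. \<bar>coeff d k\<bar> * \<rho> ^ k)"
  have "Max (w ` {..degree d}) \<in> w ` {..degree d}"
    by (rule Max_in) auto
  then obtain i where i: "i \<le> degree d" "w i = Max (w ` {..degree d})" by (metis (no_types, lifting) atMost_iff imageE)
  have wpos: "w k \<ge> 0" for k using assms(2) by (simp add: w_def)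
  have mx: "w k \<le> w i" for k
  proof (cases "k \<le> degree d")
    case True
    then show ?thesis using i by auto
  next
    case False
    then have "w k = 0" by (simp add: w_def coeff_eq_0)
    then show ?thesis using wpos by simp
  qed
  have "w (degree d) > 0" using assms(2,3) by (simp add: w_def)
  then have "w i > 0" using mx[of "degree d"] by linarith
  then have nz: "coeff d i \<noteq> 0" by (auto simp: w_def)
  have tm: "\<bar>coeff p l * coeff d (i + j - l)\<bar> * \<rho> ^ j \<le> \<bar>coeff d i\<bar> * (\<bar>coeff p l\<bar> * \<rho> ^ l)" if "l \<le> i + j" for l
  proof -
    have "\<bar>coeff d (i + j - l)\<bar> * \<rho> ^ (i + j - l) \<le> \<bar>coeff d i\<bar> * \<rho> ^ i"
      using mx by (simp add: w_def)
    then have "\<bar>coeff d (i + j - l)\<bar> * \<rho> ^ (i + j - l) * \<rho> ^ l \<le> \<bar>coeff d i\<bar> * \<rho> ^ i * \<rho> ^ l"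
      using assms(2) by (intro mult_right_mono) auto
    moreover have "\<bar>coeff d (i + j - l)\<bar> * \<rho> ^ (i + j - l) * \<rho> ^ l = (\<bar>coeff d (i + j - l)\<bar> * \<rho> ^ j) * \<rho> ^ i"
      using that by (simp add: mult.assoc flip: power_add) (simp add: add.commute)
    ultimately have "(\<bar>coeff d (i + j - l)\<bar> * \<rho> ^ j) * \<rho> ^ i \<le> \<bar>coeff d i\<bar> * \<rho> ^ i * \<rho> ^ l"
      by (simp only:)
    then have "(\<bar>coeff d (i + j - l)\<bar> * \<rho> ^ j) * \<rho> ^ i \<le> (\<bar>coeff d i\<bar> * \<rho> ^ l) * \<rho> ^ i"
      by (simp only: mult_ac)
    then have "\<bar>coeff d (i + j - l)\<bar> * \<rho> ^ j \<le> \<bar>coeff d i\<bar> * \<rho> ^ l"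
      using assms(2) by simp
    then have "\<bar>coeff p l\<bar> * (\<bar>coeff d (i + j - l)\<bar> * \<rho> ^ j) \<le> \<bar>coeff p l\<bar> * (\<bar>coeff d i\<bar> * \<rho> ^ l)"
      by (intro mult_left_mono) auto
    then show ?thesis by (simp add: abs_mult algebra_simps)
  qed
  define R where "R = (\<Sum>l\<in>{..i + j} - {j}. coeff p l * coeff d (i + j - l))"
  have "\<bar>R\<bar> * \<rho> ^ j \<le> (\<Sum>l\<in>{..i + j} - {j}. \<bar>coeff p l * coeff d (i + j - l)\<bar>) * \<rho> ^ j"
    unfolding R_def using assms(2) by (intro mult_right_mono sum_abs) auto
  also have "\<dots> \<le> (\<Sum>l\<in>{..i + j} - {j}. \<bar>coeff d i\<bar> * (\<bar>coeff p l\<bar> * \<rho> ^ l))"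
    unfolding sum_distrib_right by (intro sum_mono tm) auto
  also have "\<dots> = \<bar>coeff d i\<bar> * (\<Sum>l\<in>{..i + j} - {j}. \<bar>coeff p l\<bar> * \<rho> ^ l)"
    by (simp add: sum_distrib_left)
  also have "\<dots> \<le> \<bar>coeff d i\<bar> * (\<bar>coeff p j\<bar> * \<rho> ^ j / 2)"
  proof (intro mult_left_mono)
    have "(\<Sum>l\<in>{..i + j} - {j}. \<bar>coeff p l\<bar> * \<rho> ^ l) = (\<Sum>l\<in>({..i + j} - {j}) \<inter> {..degree p}. \<bar>coeff p l\<bar> * \<rho> ^ l)"
      by (intro sum.mono_neutral_right) (auto intro!: coeff_eq_0)
    also have "\<dots> \<le> (\<Sum>l\<in>{..degree p} - {j}. \<bar>coeff p l\<bar> * \<rho> ^ l)"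
      using assms(2) by (intro sum_mono2) auto
    also have "\<dots> \<le> \<bar>coeff p j\<bar> * \<rho> ^ j / 2" using assms(1) by (simp add: dominant_def)
    finally show "(\<Sum>l\<in>{..i + j} - {j}. \<bar>coeff p l\<bar> * \<rho> ^ l) \<le> \<bar>coeff p j\<bar> * \<rho> ^ j / 2" .
  qed auto
  finally have "\<bar>R\<bar> * \<rho> ^ j \<le> (\<bar>coeff d i\<bar> * \<bar>coeff p j\<bar> / 2) * \<rho> ^ j"
    by simp
  then have R: "\<bar>R\<bar> \<le> \<bar>coeff d i\<bar> * \<bar>coeff p j\<bar> / 2"
    using assms(2) by simp
  have "coeff (p * d) (i + j) = coeff p j * coeff d i + R"
    unfolding coeff_mult R_def by (subst sum.remove[of _ j]) auto
  then have "\<bar>coeff d i\<bar> * \<bar>coeff p j\<bar> / 2 \<le> \<bar>coeff (p * d) (i + j)\<bar>"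
    using R abs_triangle_ineq2[of "coeff p j * coeff d i" "- R"] by (simp add: abs_mult field_simps)
  then show ?thesis using that nz mx by (simp add: w_def)
qed

definition box :: "nat \<Rightarrow> nat \<Rightarrow> int poly set" where
  "box n K = {g. \<forall>k. \<bar>coeff g k\<bar> \<le> int K \<and> (n \<le> k \<longrightarrow> coeff g k = 0)}"

text \<open>
  In the applications the functions \<open>c\<close> are coefficients of polynomials, possibly rounded to multiples of a fixed number.
\<close>

lemma card_le_prod_cells:
  fixes c :: "'a \<Rightarrow> nat \<Rightarrow> int"
  assumes "\<And>g k. g \<in> S \<Longrightarrow> k < n \<Longrightarrow> c g k \<in> Z k" "\<And>k. k < n \<Longrightarrow> finite (Z k)"
    and "\<And>g g'. g \<in> S \<Longrightarrow> g' \<in> S \<Longrightarrow> (\<And>k. k < n \<Longrightarrow> c g k = c g' k) \<Longrightarrow> g = g'"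
  shows "finite S" "card S \<le> (\<Prod>k<n. card (Z k))"
proof -
  let ?r = "\<lambda>g. restrict (c g) {..<n}"
  have inj: "inj_on ?r S"
  proof (rule inj_onI)
    fix g g' assume gg: "g \<in> S" "g' \<in> S" and eq: "?r g = ?r g'"
    have "c g k = c g' k" if "k < n" for k
      using fun_cong[OF eq, of k] that by simp
    then show "g = g'" using assms(3)[OF gg] by blast
  qed
  have sub: "?r ` S \<subseteq> PiE {..<n} Z" by (intro image_subsetI restrict_PiE_iff[THEN iffD2] ballI assms(1)) auto
  have fin: "finite (PiE {..<n} Z)" using assms(2) by (intro finite_PiE) auto
  show "finite S" using inj sub fin by (meson finite_imageD finite_subset)
  show "card S \<le> (\<Prod>k<n. card (Z k))"
    using card_inj_on_le[OF inj sub fin] by (simp add: card_PiE)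
qed

lemma boxD: "g \<in> box n K \<Longrightarrow> \<bar>coeff g k\<bar> \<le> int K" "g \<in> box n K \<Longrightarrow> n \<le> k \<Longrightarrow> coeff g k = 0"
  by (auto simp: box_def)

lemma boxI: "(\<And>k. \<bar>coeff g k\<bar> \<le> int K) \<Longrightarrow> (\<And>k. n \<le> k \<Longrightarrow> coeff g k = 0) \<Longrightarrow> g \<in> box n K"
  by (auto simp: box_def)

lemma finite_box: "finite (box n K)"
proof (rule card_le_prod_cells(1)[where n = n and c = coeff and Z = "\<lambda>_. {- int K..int K}"])
  fix g g' :: "int poly" assume "g \<in> box n K" "g' \<in> box n K" "\<And>k. k < n \<Longrightarrow> coeff g k = coeff g' k"
  then have "coeff g k = coeff g' k" for k
    by (cases "k < n") (auto simp: boxD)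
  then show "g = g'" by (rule poly_eqI)
next
  fix g k assume "g \<in> box n K"
  then show "coeff g k \<in> {- int K..int K}" using boxD(1)[of g n K k] unfolding atLeastAtMost_iff by linarith
qed auto

lemma coeff_sum_monom_lessThan:
  "coeff (\<Sum>k<n. monom (f k) k) i = (if i < n then f i else 0 :: 'a :: comm_monoid_add)"
  by (simp add: coeff_sum)

lemma card_box_ge: "(2 * K + 1) ^ n \<le> card (box n K)"
proof -
  let ?F = "PiE {..<n} (\<lambda>_. {- int K..int K})"
  let ?m = "\<lambda>f. \<Sum>k<n. monom (f k) k"
  have inj: "inj_on ?m ?F"
  proof (rule inj_onI)
    fix f f' :: "nat \<Rightarrow> int" assume "f \<in> ?F" "f' \<in> ?F" "?m f = ?m f'"
    moreover have "f i = f' i" if "i < n" for i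
      using arg_cong[OF \<open>?m f = ?m f'\<close>, of "\<lambda>p. coeff p i"] that by (simp add: coeff_sum_monom_lessThan)
    ultimately show "f = f'" by (intro PiE_ext[of f _ _ f']) auto
  qed
  have sub: "?m ` ?F \<subseteq> box n K"
    by (intro image_subsetI boxI) (auto simp: coeff_sum_monom_lessThan PiE_iff abs_le_iff minus_le_iff[of _ "int K"])
  have "card ?F = (2 * K + 1) ^ n" by (simp add: card_PiE nat_add_distrib nat_mult_distrib) 
  then show ?thesis using card_inj_on_le[OF inj sub finite_box] by simp
qed

text \<open>
  A form of Gauss's lemma.
\<close>

lemma primitive_dvd_of_rat_dvd:
  fixes p a :: "int poly"
  assumes "content p = 1" "(of_int_poly p :: rat poly) dvd of_int_poly a"
  shows "p dvd a"
proof -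
  obtain q :: "rat poly" where q: "of_int_poly a = of_int_poly p * q" using assms(2) by (auto elim: dvdE)
  obtain t b where tb: "rat_to_int_poly q = (t, b)" by fastforce
  have t: "t > 0" "q = Polynomial.smult (inverse (rat_of_int t)) (of_int_poly b)"
    using rat_to_int_poly[OF tb] by auto
  then have "of_int_poly b = Polynomial.smult (rat_of_int t) q" by simp
  then have "of_int_poly (Polynomial.smult t a) = (of_int_poly (p * b) :: rat poly)"
    using q by (simp add: of_int_poly_hom.hom_mult of_int_hom.map_poly_hom_smult)
  then have eq: "Polynomial.smult t a = p * b" by (simp only: of_int_poly_hom.eq_iff)
  have "t * content a = content (Polynomial.smult t a)" using t(1) by (simp add: content_smult)
  also have "\<dots> = content b" using assms(1) by (simp only: eq content_mult mult_1)
  finally have "content b = t * content a" by simp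
  then have "[:t:] dvd b" by (simp add: const_poly_dvd_iff_dvd_content)
  then obtain c where "b = Polynomial.smult t c" by (auto elim: dvdE)
  then have "Polynomial.smult t a = Polynomial.smult t (p * c)" using eq by simp
  then have "a = p * c" using t(1) by (metis less_irrefl smult_cancel)
  then show ?thesis by simp
qed

text \<open>
  Two members of \<open>S\<close> differ by a multiple \<open>p d\<close> with \<open>d\<close> integral, and by \<open>dominant_separates\<close> they then differ by at least
  \<open>\<bar>p\<^sub>j\<bar> / 2\<close> in one of the \<open>n - degree p\<close> coefficients at the positions shifted by \<open>j\<close>. So cells of that size for
  these coefficients alone distinguish the members of \<open>S\<close>.
\<close>

lemma card_box_fibre_le:
  fixes p :: "int poly"
  assumes dom: "dominant (of_int_poly p) j \<rho>" "0 < \<rho>" and KP: "\<bar>coeff p j\<bar> \<le> int K"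
    and S: "S \<subseteq> box n K" "\<And>g g'. g \<in> S \<Longrightarrow> g' \<in> S \<Longrightarrow> p dvd g - g'"
  shows "real (card S) \<le> (6 * real K / real_of_int \<bar>coeff p j\<bar>) ^ (n - degree p)"
proof -
  define P where "P = \<bar>coeff p j\<bar>"
  have P: "P > 0" using dom(1) by (auto simp: dominant_def P_def)
  \<comment> \<open>doubled coefficients keep the cells of size \<open>P / 2\<close> integral\<close>
  define lo hi where "lo = (- 2 * int K) div P" and "hi = (2 * int K) div P"
  have le: "card S \<le> (\<Prod>k<n - degree p. card {lo..hi})"
  proof (rule card_le_prod_cells(2)[where c = "\<lambda>g i. (2 * coeff g (i + j)) div P"])
    fix g i assume "g \<in> S"
    then have "\<bar>coeff g (i + j)\<bar> \<le> int K" using S(1) boxD(1) by blast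
    then show "(2 * coeff g (i + j)) div P \<in> {lo..hi}"
      unfolding lo_def hi_def atLeastAtMost_iff using P by (intro conjI zdiv_mono1) linarith+
  next
    fix g g' assume g: "g \<in> S" "g' \<in> S"
      and cell: "\<And>i. i < n - degree p \<Longrightarrow> (2 * coeff g (i + j)) div P = (2 * coeff g' (i + j)) div P"
    show "g = g'"
    proof (rule ccontr)
      assume "g \<noteq> g'"
      obtain d where d: "g - g' = p * d" using S(2)[OF g] by (auto elim: dvdE)
      then have d0: "d \<noteq> 0" "p \<noteq> 0" using \<open>g \<noteq> g'\<close> by auto
      then obtain i where i: "coeff d i \<noteq> 0"
        "\<bar>coeff (of_int_poly d) i\<bar> * \<bar>coeff (of_int_poly p) j\<bar> / 2 \<le> \<bar>coeff (of_int_poly p * of_int_poly d) (i + j) :: real\<bar>"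
        using dominant_separates[OF dom, of "of_int_poly d"] by (metis of_int_poly_hom.hom_0_iff of_int_hom.coeff_map_poly_hom of_int_0_eq_iff)
      have "coeff (p * d) k = 0" if "k \<ge> n" for k
        using g S(1) boxD(2) that unfolding d[symmetric] by (metis coeff_diff diff_self subsetD)
      then have "degree (p * d) < n"
        using d0 by (metis leading_coeff_0_iff mult_eq_0_iff not_le)
      moreover have "i \<le> degree d" using i(1) by (rule le_degree)
      ultimately have in1: "i < n - degree p" using d0 by (simp add: degree_mult_eq)
      have "1 * real_of_int P / 2 \<le> \<bar>coeff (of_int_poly d) i\<bar> * \<bar>coeff (of_int_poly p) j\<bar> / 2"
        using i(1) P by (intro divide_right_mono mult_mono) (auto simp: P_def)
      also have "\<dots> \<le> \<bar>real_of_int (coeff (p * d) (i + j))\<bar>"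
        using i(2) by (simp flip: of_int_poly_hom.hom_mult)
      finally have "real_of_int P \<le> real_of_int (2 * \<bar>coeff (p * d) (i + j)\<bar>)" by simp
      then have "P \<le> 2 * \<bar>coeff (p * d) (i + j)\<bar>" by (simp only: of_int_le_iff)
      then have big: "P \<le> \<bar>2 * coeff g (i + j) - 2 * coeff g' (i + j)\<bar>"
        unfolding d[symmetric] coeff_diff right_diff_distrib[symmetric] abs_mult by simp
      define u v where "u = 2 * coeff g (i + j)" and "v = 2 * coeff g' (i + j)"
      have "u div P = v div P" using cell[OF in1] by (simp add: u_def v_def)
      moreover have "u = P * (u div P) + u mod P" "v = P * (v div P) + v mod P" by simp_all
      ultimately have "u - v = u mod P - v mod P" by (metis add_diff_cancel_left)
      moreover have "0 \<le> u mod P" "u mod P < P" "0 \<le> v mod P" "v mod P < P" using P by auto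
      ultimately have "\<bar>u - v\<bar> < P" by linarith
      then show False using big by (simp add: u_def v_def)
    qed
  qed auto
  have "real_of_int hi \<le> 2 * K / P" "- 2 * K / P - 1 \<le> real_of_int lo"
    using real_of_int_div4[of "2 * int K" P] real_of_int_div3[of "- 2 * int K" P]
    by (auto simp: hi_def lo_def)
  moreover have "1 \<le> real K / P" using P KP by (simp add: P_def)
  ultimately have cell_count: "real (card {lo..hi}) \<le> 6 * real K / real_of_int P"
    by (simp add: of_nat_nat) 
  have "real (card S) \<le> real (card {lo..hi}) ^ (n - degree p)"
    using le by (simp flip: of_nat_power)
  also have "\<dots> \<le> (6 * real K / real_of_int P) ^ (n - degree p)"
    using cell_count by (intro power_mono) auto
  finally show ?thesis by (simp add: P_def)
qed

text \<open>
  Pigeonhole: the box has at least \<open>(2 K)\<^sup>n\<close> elements and each class contains at most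
  \<open>(6 K / \<bar>p\<^sub>j\<bar>)\<close> to the power \<open>n - degree p\<close> of them, so that the size \<open>K\<close> of the box cancels.
\<close>

lemma card_residues_ge:
  fixes p :: "int poly"
  assumes dom: "dominant (of_int_poly p) j \<rho>" "0 < \<rho>" and KP: "\<bar>coeff p j\<bar> \<le> int K"
    and prim: "content p = 1"
  shows "(real_of_int \<bar>coeff p j\<bar> / 3) ^ (n - degree p) \<le>
    card ((\<lambda>g. of_int_poly g mod of_int_poly p :: rat poly) ` box n K)"
proof -
  define P where "P = \<bar>coeff p j\<bar>"
  have P: "P > 0" using dom(1) by (auto simp: dominant_def P_def)
  have K: "K > 0" using P KP by (simp add: P_def)
  let ?r = "\<lambda>g. of_int_poly g mod of_int_poly p :: rat poly"
  define q where "q = (6 * real K / real_of_int P) ^ (n - degree p)"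
  have q: "q > 0" using P K by (simp add: q_def)
  have fib: "real (card {g \<in> box n K. ?r g = y}) \<le> q" for y
    unfolding q_def P_def
  proof (rule card_box_fibre_le[OF dom KP])
    fix g g' assume g: "g \<in> {g \<in> box n K. ?r g = y}" "g' \<in> {g \<in> box n K. ?r g = y}"
    then have "(of_int_poly p :: rat poly) dvd of_int_poly g - of_int_poly g'"
      by (simp flip: mod_eq_dvd_iff)
    then show "p dvd g - g'"
      by (intro primitive_dvd_of_rat_dvd[OF prim]) (simp add: of_int_poly_hom.hom_minus)
  qed auto
  have "box n K = (\<Union>y\<in>?r ` box n K. {g \<in> box n K. ?r g = y})" by auto
  then have "card (box n K) \<le> (\<Sum>y\<in>?r ` box n K. card {g \<in> box n K. ?r g = y})"
    using card_UN_le[of "?r ` box n K" "\<lambda>y. {g \<in> box n K. ?r g = y}"] finite_box by simp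
  then have "real (card (box n K)) \<le> (\<Sum>y\<in>?r ` box n K. real (card {g \<in> box n K. ?r g = y}))"
    by (simp flip: of_nat_sum)
  also have "\<dots> \<le> (\<Sum>y\<in>?r ` box n K. q)" by (intro sum_mono fib)
  also have "\<dots> = card (?r ` box n K) * q" by simp
  finally have *: "real (card (box n K)) \<le> card (?r ` box n K) * q" .
  have "(P / 3) ^ (n - degree p) * q = (2 * real K) ^ (n - degree p)"
    unfolding q_def power_mult_distrib[symmetric] using P by simp
  also have "\<dots> \<le> (2 * real K) ^ n" using K by (intro power_increasing) auto
  also have "\<dots> \<le> real ((2 * K + 1) ^ n)"
    unfolding semiring_1_class.of_nat_power by (intro power_mono) auto
  also have "\<dots> \<le> real (card (box n K))" using card_box_ge by (simp only: of_nat_le_iff)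
  also note *
  finally show ?thesis using q by (simp add: P_def)
qed

definition coeff_l1 :: "int poly \<Rightarrow> nat" where
  "coeff_l1 p = nat (\<Sum>l\<le>degree p. \<bar>coeff p l\<bar>)"

lemma coeff_mult_le_coeff_l1:
  assumes "\<And>k. \<bar>coeff q k\<bar> \<le> (A :: int)"
  shows "\<bar>coeff (p * q) k\<bar> \<le> int (coeff_l1 p) * A"
proof -
  have A: "0 \<le> A" using assms[of 0] by linarith
  have "\<bar>coeff (p * q) k\<bar> \<le> (\<Sum>l\<le>k. \<bar>coeff p l * coeff q (k - l)\<bar>)"
    unfolding coeff_mult by (rule sum_abs)
  also have "\<dots> \<le> (\<Sum>l\<le>k. \<bar>coeff p l\<bar> * A)"
    by (intro sum_mono) (simp add: abs_mult assms mult_left_mono)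
  also have "\<dots> = (\<Sum>l\<in>{..k} \<inter> {..degree p}. \<bar>coeff p l\<bar> * A)"
    by (intro sum.mono_neutral_right) (auto intro!: coeff_eq_0)
  also have "\<dots> \<le> (\<Sum>l\<le>degree p. \<bar>coeff p l\<bar> * A)"
    using A by (intro sum_mono2) auto
  also have "\<dots> = int (coeff_l1 p) * A"
    by (simp add: coeff_l1_def sum_distrib_right sum_nonneg)
  finally show ?thesis .
qed

lemma coeff_mult_real_le_coeff_l1:
  assumes "\<And>k. \<bar>coeff q k\<bar> \<le> (A :: real)"
  shows "\<bar>coeff (of_int_poly p * q) k\<bar> \<le> real (coeff_l1 p) * A"
proof -
  have A: "0 \<le> A" using assms[of 0] by linarith
  have "\<bar>coeff (of_int_poly p * q) k\<bar> \<le> (\<Sum>l\<le>k. \<bar>real_of_int (coeff p l) * coeff q (k - l)\<bar>)"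
    unfolding coeff_mult by (rule order_trans[OF sum_abs]) simp
  also have "\<dots> \<le> (\<Sum>l\<le>k. \<bar>real_of_int (coeff p l)\<bar> * A)"
    by (intro sum_mono) (simp add: abs_mult assms mult_left_mono)
  also have "\<dots> = (\<Sum>l\<in>{..k} \<inter> {..degree p}. \<bar>real_of_int (coeff p l)\<bar> * A)"
    by (intro sum.mono_neutral_right) (auto intro!: coeff_eq_0)
  also have "\<dots> \<le> (\<Sum>l\<le>degree p. \<bar>real_of_int (coeff p l)\<bar> * A)"
    using A by (intro sum_mono2) auto
  also have "\<dots> = real (coeff_l1 p) * A"
    by (simp add: coeff_l1_def sum_distrib_right sum_nonneg)
  finally show ?thesis .
qed

lemma degree_lt_length:
  assumes "\<And>k. n \<le> k \<Longrightarrow> coeff q k = 0" "q \<noteq> 0"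
  shows "degree q < n"
  using assms by (metis leading_coeff_0_iff not_le)

text \<open>
  The system for the coefficients of \<open>x\<close> is square, and \<open>dominant_separates\<close> shows that its
  homogeneous version has only the zero solution.
\<close>

lemma dominant_solvable:
  fixes p :: "real poly" and y :: "nat \<Rightarrow> real"
  assumes dom: "dominant p j \<rho>" "0 < \<rho>"
  obtains x where "\<And>k. m \<le> k \<Longrightarrow> coeff x k = 0" "\<And>i. i < m \<Longrightarrow> coeff (p * x) (i + j) = y i"
proof -
  define A where "A = mat m m (\<lambda>(i, k). if k \<le> i + j then coeff p (i + j - k) else 0)"
  define px where "px = (\<lambda>v :: real Matrix.vec. \<Sum>k<m. monom (vec_index v k) k)"
  have A: "A \<in> carrier_mat m m" by (simp add: A_def)
  have px0: "coeff (px v) k = (if k < m then vec_index v k else 0)" for v k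
    by (simp add: px_def coeff_sum_monom_lessThan)
  have prod: "coeff (p * px v) (i + j) = vec_index (A *\<^sub>v v) i" if "i < m" "v \<in> carrier_vec m" for i v
  proof -
    have "coeff (p * px v) (i + j) = (\<Sum>k\<le>i + j. coeff (px v) k * coeff p (i + j - k))"
      by (subst mult.commute) (simp add: coeff_mult)
    also have "\<dots> = (\<Sum>k\<in>{..i + j} \<inter> {..<m}. vec_index v k * coeff p (i + j - k))"
      by (intro sum.mono_neutral_cong_right) (auto simp: px0)
    also have "\<dots> = (\<Sum>k<m. (if k \<le> i + j then coeff p (i + j - k) else 0) * vec_index v k)"
      by (intro sum.mono_neutral_cong_left) auto
    also have "\<dots> = vec_index (A *\<^sub>v v) i"
      using that by (simp add: A_def scalar_prod_def atLeast0LessThan)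
    finally show ?thesis .
  qed
  have "det A \<noteq> 0"
  proof
    assume "det A = 0"
    then obtain v where v: "v \<in> carrier_vec m" "v \<noteq> 0\<^sub>v m" "A *\<^sub>v v = 0\<^sub>v m"
      using det_0_iff_vec_prod_zero_field[OF A] by blast
    have "px v \<noteq> 0"
    proof
      assume "px v = 0"
      then have "vec_index v k = 0" if "k < m" for k using px0[of v k] that by simp
      then show False using v(1,2) by (auto intro!: eq_vecI)
    qed
    then obtain i where i: "coeff (px v) i \<noteq> 0"
      "\<bar>coeff (px v) i\<bar> * \<bar>coeff p j\<bar> / 2 \<le> \<bar>coeff (p * px v) (i + j)\<bar>"
      using dominant_separates[OF dom] by metis
    then have "i < m" using px0 by metis
    then have "coeff (p * px v) (i + j) = 0" using prod v by simp
    then show False using i dom(1) by (simp add: dominant_def mult_le_0_iff)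
  qed
  then obtain B where B: "inverts_mat A B" "B \<in> carrier_mat m m"
    using A det_non_zero_imp_unit[OF A] by (auto simp: Units_def ring_mat_def inverts_mat_def)
  define v where "v = B *\<^sub>v vec m y"
  have v: "v \<in> carrier_vec m" using B by (simp add: v_def)
  have "A *\<^sub>v v = (A * B) *\<^sub>v vec m y"
    using A B by (simp add: v_def assoc_mult_mat_vec)
  also have "\<dots> = vec m y" using A B by (simp add: inverts_mat_def)
  finally have "coeff (p * px v) (i + j) = y i" if "i < m" for i
    using prod[OF that v] that by simp
  then show ?thesis using that[of "px v"] px0 by simp
qed

section \<open>Reduction modulo a polynomial with a dominant coefficient\<close>

text \<open>
  The remainders that rounding produces: small in the \<open>n - degree p\<close> positions that a multiple of \<open>p\<close>
  can control, and bounded by \<open>L\<close> at the remaining \<open>degree p\<close> positions at the two ends.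
\<close>

definition reduced :: "int poly \<Rightarrow> nat \<Rightarrow> nat \<Rightarrow> nat \<Rightarrow> int poly set" where
  "reduced p j n L = {r. (\<forall>k. n \<le> k \<longrightarrow> coeff r k = 0) \<and> (\<forall>k. \<bar>coeff r k\<bar> \<le> int L) \<and>
     (\<forall>i < n - degree p. \<bar>coeff r (i + j)\<bar> \<le> int (coeff_l1 p))}"

lemma coeff_l1_pos: "p \<noteq> 0 \<Longrightarrow> 0 < coeff_l1 p"
proof -
  assume "p \<noteq> 0"
  then have "0 < \<bar>coeff p (degree p)\<bar>" by simp
  also have "\<dots> \<le> (\<Sum>l\<le>degree p. \<bar>coeff p l\<bar>)" by (intro member_le_sum) auto
  finally show ?thesis by (simp add: coeff_l1_def)
qed

lemma card_reduced_le:
  assumes "j \<le> degree p" "1 \<le> L" "p \<noteq> 0"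
  shows "finite (reduced p j n L)"
    "card (reduced p j n L) \<le> (3 * coeff_l1 p) ^ n * (3 * L) ^ degree p"
proof -
  define m where "m = n - degree p"
  define Z where "Z = (\<lambda>k. if k \<in> {j..<j + m} then {- int (coeff_l1 p)..int (coeff_l1 p)} else {- int L..int L})"
  have cells: "coeff r k \<in> Z k" if "r \<in> reduced p j n L" "k < n" for r k
  proof (cases "k \<in> {j..<j + m}")
    case True
    then have "k - j < n - degree p" "k - j + j = k" by (auto simp: m_def)
    then have "\<bar>coeff r k\<bar> \<le> int (coeff_l1 p)" using that(1) unfolding reduced_def by (metis (mono_tags, lifting) mem_Collect_eq)
    then have "- int (coeff_l1 p) \<le> coeff r k \<and> coeff r k \<le> int (coeff_l1 p)" by linarith
    then show ?thesis using True by (simp add: Z_def)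
  next
    case False
    have "\<bar>coeff r k\<bar> \<le> int L" using that by (simp add: reduced_def)
    then have "- int L \<le> coeff r k \<and> coeff r k \<le> int L" by linarith
    then show ?thesis using False by (auto simp: Z_def)
  qed
  have ext: "g = g'" if g: "g \<in> reduced p j n L" "g' \<in> reduced p j n L" and eq: "\<And>k. k < n \<Longrightarrow> coeff g k = coeff g' k" for g g'
  proof (rule poly_eqI)
    fix k show "coeff g k = coeff g' k"
      using g eq by (cases "k < n") (auto simp: reduced_def)
  qed
  have finZ: "finite (Z k)" if "k < n" for k by (simp add: Z_def)
  show "finite (reduced p j n L)"
    by (rule card_le_prod_cells(1)[OF cells finZ ext])
  have cardZ: "card (Z k) \<le> (if k \<in> {j..<j + m} then 3 * coeff_l1 p else 3 * L)" for k
    using coeff_l1_pos[OF assms(3)] assms(2) by (auto simp: Z_def)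
  have "card (reduced p j n L) \<le> (\<Prod>k<n. card (Z k))"
    by (rule card_le_prod_cells(2)[OF cells finZ ext])
  also have "\<dots> \<le> (\<Prod>k<n. if k \<in> {j..<j + m} then 3 * coeff_l1 p else 3 * L)"
    by (intro prod_mono conjI cardZ) auto
  also have "\<dots> = (3 * coeff_l1 p) ^ card ({..<n} \<inter> {j..<j + m}) * (3 * L) ^ card ({..<n} \<inter> - {j..<j + m})"
    by (subst prod.If_cases) (simp_all only: Collect_mem_eq prod_constant finite_lessThan)
  also have "\<dots> \<le> (3 * coeff_l1 p) ^ n * (3 * L) ^ degree p"
  proof (intro mult_mono power_increasing)
    show "card ({..<n} \<inter> {j..<j + m}) \<le> n"
      using card_mono[of "{..<n}" "{..<n} \<inter> {j..<j + m}"] by simp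
    have "{..<n} \<inter> - {j..<j + m} = {..<n} - {j..<j + m}" by auto
    moreover have "card ({..<n} - {j..<j + m}) \<le> degree p"
    proof (cases "m = 0")
      case True
      then show ?thesis by (simp add: m_def)
    next
      case False
      then have "{j..<j + m} \<subseteq> {..<n}" using assms(1) by (auto simp: m_def)
      then show ?thesis by (subst card_Diff_subset) (auto simp: m_def)
    qed
    ultimately show "card ({..<n} \<inter> - {j..<j + m}) \<le> degree p" by simp
  qed (use coeff_l1_pos[OF assms(3)] assms(2) in auto)
  finally show "card (reduced p j n L) \<le> (3 * coeff_l1 p) ^ n * (3 * L) ^ degree p" .
qed

text \<open>
  Division with a remainder on both sides of the position \<open>j\<close>: \<open>x\<close> solves \<open>p x = g\<close> exactly in the controlled
  positions, \<open>h\<close> is \<open>x\<close> with rounded coefficients, and the rounding error costs no more than the sum norm of \<open>p\<close>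
  in these positions. The weighted estimate bounds \<open>x\<close> only up to the factor \<open>\<rho>\<^sup>n\<close>; this is
  harmless because it affects just the \<open>degree p\<close> end positions and the size of \<open>h\<close>.
\<close>

lemma box_reduction:
  fixes p :: "int poly" and \<rho> :: nat
  assumes dom: "dominant (of_int_poly p) j (real \<rho>)" and \<rho>: "1 \<le> \<rho>" and A: "1 \<le> A"
    and g: "g \<in> box n A"
  obtains r h where "g = r + p * h" "h \<in> box n (3 * A * \<rho> ^ n)"
    "r \<in> reduced p j n (4 * coeff_l1 p * A * \<rho> ^ n)"
proof -
  define m where "m = n - degree p"
  have \<rho>0: "0 < real \<rho>" using \<rho> by simp
  have pj: "coeff p j \<noteq> 0" using dom by (auto simp: dominant_def)
  then have p0: "p \<noteq> 0" by auto
  obtain x where x: "\<And>k. m \<le> k \<Longrightarrow> coeff x k = 0"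
    "\<And>i. i < m \<Longrightarrow> coeff (of_int_poly p * x) (i + j) = real_of_int (coeff g (i + j))"
    using dominant_solvable[OF dom \<rho>0, of m "\<lambda>i. real_of_int (coeff g (i + j))"] by metis
  have x_bd: "\<bar>coeff x k\<bar> \<le> 2 * real A * real \<rho> ^ n" for k
  proof (cases "x = 0")
    case False
    then obtain i where i: "coeff x i \<noteq> 0" "\<And>k. \<bar>coeff x k\<bar> * real \<rho> ^ k \<le> \<bar>coeff x i\<bar> * real \<rho> ^ i"
      "\<bar>coeff x i\<bar> * \<bar>coeff (of_int_poly p) j\<bar> / 2 \<le> \<bar>coeff (of_int_poly p * x) (i + j)\<bar>"
      using dominant_separates[OF dom \<rho>0] by metis
    have im: "i < m" using x(1) i(1) by (meson not_le)
    have "\<bar>real_of_int (coeff g (i + j))\<bar> \<le> real A"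
      using boxD(1)[OF g, of "i + j"] by (metis of_int_abs of_int_le_iff of_int_of_nat_eq)
    then have "\<bar>coeff x i\<bar> * \<bar>real_of_int (coeff p j)\<bar> \<le> 2 * real A"
      using i(3) x(2)[OF im] by simp
    moreover have "\<bar>coeff x i\<bar> * 1 \<le> \<bar>coeff x i\<bar> * \<bar>real_of_int (coeff p j)\<bar>"
      using pj by (intro mult_left_mono) auto
    ultimately have xi: "\<bar>coeff x i\<bar> \<le> 2 * real A" by simp
    have "\<bar>coeff x k\<bar> * 1 \<le> \<bar>coeff x k\<bar> * real \<rho> ^ k"
      using \<rho> by (intro mult_left_mono) (auto simp: one_le_power)
    also have "\<dots> \<le> \<bar>coeff x i\<bar> * real \<rho> ^ i" by (rule i(2))
    also have "\<dots> \<le> 2 * real A * real \<rho> ^ n"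
      using xi \<rho> im by (intro mult_mono power_increasing) (auto simp: m_def)
    finally show ?thesis by simp
  qed simp
  define h where "h = (\<Sum>k<m. monom (round (coeff x k)) k)"
  have hk: "coeff h k = round (coeff x k)" for k
    using x(1) by (simp add: h_def coeff_sum_monom_lessThan)
  have \<rho>n: "1 \<le> \<rho> ^ n" using \<rho> by simp
  have A\<rho>: "1 \<le> A * \<rho> ^ n" using A \<rho>n by (metis mult_le_mono mult_1)
  have h_bd: "\<bar>coeff h k\<bar> \<le> int (3 * A * \<rho> ^ n)" for k
  proof -
    have "\<bar>real_of_int (coeff h k) - coeff x k\<bar> \<le> 1 / 2"
      unfolding hk by (rule of_int_round_abs_le)
    then have "\<bar>real_of_int (coeff h k)\<bar> \<le> 2 * real A * real \<rho> ^ n + 1" using x_bd[of k] by linarith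
    also have "\<dots> \<le> real_of_int (int (3 * A * \<rho> ^ n))"
    proof -
      have "real 1 \<le> real (A * \<rho> ^ n)" using A\<rho> by (simp only: of_nat_le_iff)
      then show ?thesis by simp
    qed
    finally show ?thesis by (metis of_int_abs of_int_le_iff)
  qed
  have h_box: "h \<in> box n (3 * A * \<rho> ^ n)"
    using h_bd by (intro boxI) (auto simp: h_def m_def coeff_sum_monom_lessThan)
  define r where "r = g - p * h"
  have ph0: "coeff (p * h) k = 0" if "n \<le> k" for k
  proof (cases "h = 0")
    case False
    then have "degree h < m" by (intro degree_lt_length) (auto simp: h_def coeff_sum_monom_lessThan)
    then have "degree (p * h) < n" using degree_mult_le[of p h] by (simp add: m_def)
    then show ?thesis using that by (intro coeff_eq_0) simp
  qed simp
  have "r \<in> reduced p j n (4 * coeff_l1 p * A * \<rho> ^ n)"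
    unfolding reduced_def
  proof (intro CollectI conjI allI impI)
    fix k assume "n \<le> k"
    then show "coeff r k = 0" using ph0 boxD(2)[OF g] by (simp add: r_def)
  next
    fix k
    have "\<bar>coeff (p * h) k\<bar> \<le> int (coeff_l1 p) * int (3 * A * \<rho> ^ n)"
      by (rule coeff_mult_le_coeff_l1[OF h_bd])
    then have "\<bar>coeff r k\<bar> \<le> int A + int (coeff_l1 p) * int (3 * A * \<rho> ^ n)"
      using boxD(1)[OF g, of k] by (simp add: r_def)
    moreover have "A * 1 \<le> A * (coeff_l1 p * \<rho> ^ n)"
      using coeff_l1_pos[OF p0] \<rho>n by (intro mult_left_mono) (simp_all add: Suc_le_eq)
    then have "int A \<le> int (coeff_l1 p * (A * \<rho> ^ n))" by (subst of_nat_le_iff) (simp add: ac_simps)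
    ultimately show "\<bar>coeff r k\<bar> \<le> int (4 * coeff_l1 p * A * \<rho> ^ n)"
      by (simp add: algebra_simps)
  next
    fix i assume i: "i < n - degree p"
    define e where "e = x - of_int_poly h"
    have "\<bar>coeff e k\<bar> \<le> 1" for k
      using of_int_round_abs_le[of "coeff x k"] unfolding e_def coeff_diff of_int_hom.coeff_map_poly_hom hk by linarith
    then have "\<bar>coeff (of_int_poly p * e) (i + j)\<bar> \<le> real (coeff_l1 p) * 1"
      by (rule coeff_mult_real_le_coeff_l1)
    moreover have "coeff (of_int_poly p * e) (i + j) = real_of_int (coeff g (i + j)) - real_of_int (coeff (p * h) (i + j))"
      unfolding e_def right_diff_distrib coeff_diff using x(2) i by (simp add: m_def flip: of_int_poly_hom.hom_mult)
    ultimately have "real_of_int \<bar>coeff r (i + j)\<bar> \<le> real_of_int (int (coeff_l1 p))"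
      by (simp add: r_def)
    then show "\<bar>coeff r (i + j)\<bar> \<le> int (coeff_l1 p)" by (simp only: of_int_le_iff)
  qed
  then show ?thesis using that[of r h] h_box by (simp add: r_def)
qed

section \<open>Rational vectors as classes of polynomial tuples\<close>

text \<open>
  Multiplication by the polynomial matrix \<open>X - M\<close>.
\<close>

definition char_map :: "nat \<Rightarrow> rat mat \<Rightarrow> (nat \<Rightarrow> rat poly) \<Rightarrow> nat \<Rightarrow> rat poly" where
  "char_map N M q i = [:0, 1:] * q i - (\<Sum>l<N. [:M $$ (i, l):] * q l)"

text \<open>
  Entries at indices from \<open>N\<close> on are irrelevant and left unconstrained.
\<close>

definition relations :: "nat \<Rightarrow> rat mat \<Rightarrow> (nat \<Rightarrow> rat poly) set" where
  "relations N M = {g. \<exists>q. \<forall>i<N. g i = char_map N M q i}"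

lemma relationsI: "(\<And>i. i < N \<Longrightarrow> g i = char_map N M q i) \<Longrightarrow> g \<in> relations N M"
  by (auto simp: relations_def)

lemma relations_cong:
  "g \<in> relations N M \<Longrightarrow> (\<And>i. i < N \<Longrightarrow> g' i = g i) \<Longrightarrow> g' \<in> relations N M"
  by (auto simp: relations_def)

lemma char_map_diff: "char_map N M (\<lambda>i. q i - q' i) i = char_map N M q i - char_map N M q' i"
  unfolding char_map_def right_diff_distrib sum_subtractf by simp

lemma char_map_add: "char_map N M (\<lambda>i. q i + q' i) i = char_map N M q i + char_map N M q' i"
  unfolding char_map_def distrib_left sum.distrib by simp

lemma char_map_mult: "char_map N M (\<lambda>i. u * q i) i = u * char_map N M q i"
proof -
  have "(\<Sum>l<N. [:M $$ (i, l):] * (u * q l)) = u * (\<Sum>l<N. [:M $$ (i, l):] * q l)"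
    unfolding sum_distrib_left by (intro sum.cong) (simp_all only: mult.left_commute)
  then show ?thesis unfolding char_map_def right_diff_distrib by (simp only: mult.left_commute)
qed

lemma relations_diff:
  assumes "g \<in> relations N M" "g' \<in> relations N M"
  shows "(\<lambda>i. g i - g' i) \<in> relations N M"
proof -
  obtain q where q: "\<And>i. i < N \<Longrightarrow> g i = char_map N M q i" using assms(1) unfolding relations_def by blast
  obtain q' where q': "\<And>i. i < N \<Longrightarrow> g' i = char_map N M q' i" using assms(2) unfolding relations_def by blast
  show ?thesis by (rule relationsI[where q = "\<lambda>i. q i - q' i"]) (simp add: q q' char_map_diff)
qed

lemma relations_mult:
  assumes "g \<in> relations N M"
  shows "(\<lambda>i. u * g i) \<in> relations N M"
proof -
  obtain q where q: "\<And>i. i < N \<Longrightarrow> g i = char_map N M q i" using assms(1) unfolding relations_def by blast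
  show ?thesis by (rule relationsI[where q = "\<lambda>i. u * q i"]) (simp add: q char_map_mult)
qed

text \<open>
  The linear functional on polynomials that sends \<open>X\<^sup>a\<close> to \<open>\<mu> a\<close>. With the entries of the powers
  of \<open>M\<close> for \<open>\<mu>\<close> it evaluates a polynomial tuple at \<open>M\<close> without any sums of vectors.
\<close>

definition moment :: "(nat \<Rightarrow> rat) \<Rightarrow> rat poly \<Rightarrow> rat" where
  "moment \<mu> q = (\<Sum>a\<le>degree q. coeff q a * \<mu> a)"

lemma moment_eq_sum:
  assumes "\<And>k. n \<le> k \<Longrightarrow> coeff q k = 0"
  shows "moment \<mu> q = (\<Sum>a<n. coeff q a * \<mu> a)"
proof -
  have "moment \<mu> q = (\<Sum>a\<in>{..degree q} \<inter> {..<n}. coeff q a * \<mu> a)"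
    unfolding moment_def
  proof (intro sum.mono_neutral_right ballI)
    fix i assume "i \<in> {..degree q} - {..degree q} \<inter> {..<n}"
    then show "coeff q i * \<mu> i = 0" using assms[of i] by auto
  qed auto
  also have "\<dots> = (\<Sum>a<n. coeff q a * \<mu> a)"
    by (intro sum.mono_neutral_left) (auto intro!: coeff_eq_0)
  finally show ?thesis .
qed

lemma moment_add: "moment \<mu> (p + q) = moment \<mu> p + moment \<mu> q"
proof -
  define n where "n = Suc (max (degree p) (degree q))"
  have "coeff p k = 0" "coeff q k = 0" "coeff (p + q) k = 0" if "n \<le> k" for k
    using that by (auto simp: n_def coeff_eq_0)
  then show ?thesis by (simp add: moment_eq_sum[of n] distrib_right sum.distrib)
qed

lemma moment_cmult: "moment \<mu> ([:c:] * q) = c * moment \<mu> q"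
  by (cases "c = 0") (simp_all add: moment_def sum_distrib_left mult.assoc)

lemma moment_0: "moment \<mu> 0 = 0"
  by (simp add: moment_def)

lemma moment_diff: "moment \<mu> (p - q) = moment \<mu> p - moment \<mu> q"
  using moment_add[of \<mu> "p - q" q] by simp

lemma moment_sum: "moment \<mu> (sum f S) = (\<Sum>x\<in>S. moment \<mu> (f x))"
  by (induction S rule: infinite_finite_induct) (simp_all add: moment_0 moment_add)

lemma moment_pCons: "moment \<mu> (pCons c q) = c * \<mu> 0 + moment (\<lambda>a. \<mu> (Suc a)) q"
proof -
  have "moment \<mu> (pCons c q) = (\<Sum>a<Suc (Suc (degree q)). coeff (pCons c q) a * \<mu> a)"
    by (rule moment_eq_sum) (auto simp: coeff_pCons coeff_eq_0 split: nat.split)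
  also have "\<dots> = c * \<mu> 0 + (\<Sum>a<Suc (degree q). coeff q a * \<mu> (Suc a))"
    by (subst sum.lessThan_Suc_shift) simp
  finally show ?thesis by (simp add: moment_def lessThan_Suc_atMost)
qed

lemma moment_scale: "moment (\<lambda>a. c * \<mu> a) q = c * moment \<mu> q"
  by (simp add: moment_def sum_distrib_left mult.left_commute)

lemma moment_sum_weights: "moment (\<lambda>a. \<Sum>x\<in>S. \<mu> x a) q = (\<Sum>x\<in>S. moment (\<mu> x) q)"
  unfolding moment_def by (simp add: sum_distrib_left) (rule sum.swap)

text \<open>
  The vector \<open>\<Sum>\<^sub>i g\<^sub>i(M) e\<^sub>i\<close>, where \<open>e\<^sub>i\<close> are the unit vectors.
\<close>

definition eval_at :: "nat \<Rightarrow> rat mat \<Rightarrow> (nat \<Rightarrow> rat poly) \<Rightarrow> rat Matrix.vec" where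
  "eval_at N M g = vec N (\<lambda>r. \<Sum>i<N. moment (\<lambda>a. (M ^\<^sub>m a) $$ (r, i)) (g i))"

lemma eval_at_carrier: "eval_at N M g \<in> carrier_vec N"
  by (simp add: eval_at_def)

lemma eval_at_cong: "(\<And>i. i < N \<Longrightarrow> g i = g' i) \<Longrightarrow> eval_at N M g = eval_at N M g'"
  by (simp add: eval_at_def)

lemma eval_at_add: "eval_at N M (\<lambda>i. g i + g' i) = eval_at N M g + eval_at N M g'"
  by (auto simp: eval_at_def moment_add sum.distrib)

lemma eval_at_diff: "eval_at N M (\<lambda>i. g i - g' i) = eval_at N M g - eval_at N M g'"
  by (auto simp: eval_at_def moment_diff sum_subtractf)

lemma eval_at_const:
  assumes M: "M \<in> carrier_mat N N"
  shows "eval_at N M (\<lambda>i. [:c i:]) = vec N c"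
proof (rule eq_vecI)
  fix r assume "r < dim_vec (vec N c)"
  then have r: "r < N" by simp
  have "moment (\<lambda>a. (M ^\<^sub>m a) $$ (r, i)) [:c i:] = (if i = r then c i else 0)" if "i < N" for i
    using M r that by (simp add: moment_pCons moment_0)
  then show "vec_index (eval_at N M (\<lambda>i. [:c i:])) r = vec_index (vec N c) r"
    using r by (simp add: eval_at_def)
qed (simp add: eval_at_def)

lemma eval_at_char_map:
  assumes M: "M \<in> carrier_mat N N"
  shows "eval_at N M (char_map N M q) = 0\<^sub>v N"
proof (rule eq_vecI)
  fix r assume "r < dim_vec (0\<^sub>v N :: rat Matrix.vec)"
  then have r: "r < N" by simp
  define P where "P = (\<lambda>i a. (M ^\<^sub>m a) $$ (r, i))"
  have Suc: "P l (Suc a) = (\<Sum>i<N. M $$ (i, l) * P i a)" if "l < N" for l a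
  proof -
    have "M ^\<^sub>m a \<in> carrier_mat N N" using M by simp
    then have "P l (Suc a) = (\<Sum>i<N. P i a * M $$ (i, l))"
      using M r that by (auto simp: P_def scalar_prod_def atLeast0LessThan intro!: sum.cong)
    then show ?thesis by (simp add: mult.commute)
  qed
  have "(\<Sum>i<N. moment (P i) (char_map N M q i))
      = (\<Sum>i<N. moment (\<lambda>a. P i (Suc a)) (q i)) - (\<Sum>i<N. \<Sum>l<N. M $$ (i, l) * moment (P i) (q l))"
    unfolding char_map_def moment_diff moment_sum moment_cmult sum_subtractf
    by (simp add: moment_pCons)
  also have "(\<Sum>i<N. \<Sum>l<N. M $$ (i, l) * moment (P i) (q l)) = (\<Sum>l<N. \<Sum>i<N. M $$ (i, l) * moment (P i) (q l))"
    by (rule sum.swap)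
  also have "\<dots> = (\<Sum>l<N. moment (\<lambda>a. P l (Suc a)) (q l))"
    by (intro sum.cong) (simp_all add: Suc moment_sum_weights moment_scale)
  finally show "vec_index (eval_at N M (char_map N M q)) r = vec_index (0\<^sub>v N) r"
    using r by (simp add: eval_at_def P_def)
qed (simp add: eval_at_def)

lemma eval_at_relations:
  assumes "M \<in> carrier_mat N N" "g \<in> relations N M"
  shows "eval_at N M g = 0\<^sub>v N"
proof -
  obtain q where q: "\<And>i. i < N \<Longrightarrow> g i = char_map N M q i" using assms(2) unfolding relations_def by blast
  then show ?thesis using eval_at_char_map[OF assms(1), of q] eval_at_cong[of N g "char_map N M q"] by simp
qed

lemma poly_eq_pCons_shift: "(q :: 'a :: comm_semiring_1 poly) = [:coeff q 0:] + [:0, 1:] * poly_shift 1 q"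
proof (rule poly_eqI)
  fix k show "coeff q k = coeff ([:coeff q 0:] + [:0, 1:] * poly_shift 1 q) k"
    by (cases k) (simp_all add: coeff_poly_shift)
qed

lemma sum_const_poly: "(\<Sum>l\<in>S. [:f l :: 'a :: comm_ring_1:]) = [:\<Sum>l\<in>S. f l:]"
  by (induction S rule: infinite_finite_induct) simp_all

text \<open>
  Horner's scheme: division of a polynomial tuple by \<open>X - M\<close> with a constant remainder.
\<close>

lemma char_map_division:
  assumes "\<And>i k. i < N \<Longrightarrow> n \<le> k \<Longrightarrow> coeff (g i) k = 0"
  shows "\<exists>q c. \<forall>i<N. g i = char_map N M q i + [:c i:]"
  using assms
proof (induction n arbitrary: g)
  case 0
  then have "g i = 0" if "i < N" for i using that by (simp add: poly_eq_iff)
  moreover have "char_map N M (\<lambda>_. 0) i = 0" for i by (simp add: char_map_def)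
  ultimately show ?case by (intro exI[of _ "\<lambda>_. 0"]) simp
next
  case (Suc n)
  define g' where "g' = (\<lambda>i. poly_shift 1 (g i))"
  have g: "g i = [:coeff (g i) 0:] + [:0, 1:] * g' i" for i
    unfolding g'_def by (rule poly_eq_pCons_shift)
  have "coeff (g' i) k = 0" if "i < N" "n \<le> k" for i k
    using Suc.prems that by (simp add: g'_def coeff_poly_shift)
  then obtain q c where qc: "\<And>i. i < N \<Longrightarrow> g' i = char_map N M q i + [:c i:]"
    using Suc.IH[of g'] by blast
  define q' where "q' = (\<lambda>i. [:0, 1:] * q i + [:c i:])"
  define c' where "c' = (\<lambda>i. coeff (g i) 0 + (\<Sum>l<N. M $$ (i, l) * c l))"
  have "char_map N M (\<lambda>i. [:c i:]) i = [:0, 1:] * [:c i:] - [:\<Sum>l<N. M $$ (i, l) * c l:]" for i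
    by (simp add: char_map_def sum_const_poly mult.commute)
  then have q': "char_map N M q' i = [:0, 1:] * char_map N M q i + ([:0, 1:] * [:c i:] - [:\<Sum>l<N. M $$ (i, l) * c l:])" for i
    unfolding q'_def by (simp only: char_map_add char_map_mult)
  have "g i = char_map N M q' i + [:c' i:]" if "i < N" for i
  proof -
    have "g i = [:coeff (g i) 0:] + [:0, 1:] * (char_map N M q i + [:c i:])"
      using g[of i] qc[OF that] by simp
    also have "\<dots> = char_map N M q' i + [:c' i:]"
      unfolding q' distrib_left c'_def by simp
    finally show ?thesis .
  qed
  then show ?case by (intro exI[of _ q'] exI[of _ c']) simp
qed

lemma diff_const_eval_in_relations:
  assumes M: "M \<in> carrier_mat N N"
  shows "(\<lambda>i. g i - [:vec_index (eval_at N M g) i:]) \<in> relations N M"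
proof -
  define n where "n = Suc (Max (insert 0 ((\<lambda>i. degree (g i)) ` {..<N})))"
  have "coeff (g i) k = 0" if "i < N" "n \<le> k" for i k
  proof -
    have "degree (g i) < n" using that unfolding n_def by (simp add: less_Suc_eq_le)
    then show ?thesis using that by (intro coeff_eq_0) simp
  qed
  then obtain q c where qc: "\<And>i. i < N \<Longrightarrow> g i = char_map N M q i + [:c i:]"
    using char_map_division[of N n g M] by metis
  have "eval_at N M g = eval_at N M (\<lambda>i. char_map N M q i + [:c i:])"
    by (rule eval_at_cong) (rule qc)
  also have "\<dots> = vec N c"
    unfolding eval_at_add eval_at_const[OF M] eval_at_char_map[OF M] by simp
  finally have "vec_index (eval_at N M g) i = c i" if "i < N" for i using that by simp
  then show ?thesis by (intro relationsI[where q = q]) (simp add: qc)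
qed

text \<open>
  The remainder of \<open>g\<close> in the division by \<open>X - M\<close> is its evaluation, because evaluation
  annihilates the image of \<open>X - M\<close> and fixes constant tuples.
\<close>

lemma eval_at_eq_iff:
  assumes M: "M \<in> carrier_mat N N"
  shows "eval_at N M g = eval_at N M g' \<longleftrightarrow> (\<lambda>i. g i - g' i) \<in> relations N M"
proof
  assume "eval_at N M g = eval_at N M g'"
  then have "(\<lambda>i. g i - [:vec_index (eval_at N M g') i:] - (g' i - [:vec_index (eval_at N M g') i:])) \<in> relations N M"
    using relations_diff[OF diff_const_eval_in_relations[OF M, of g] diff_const_eval_in_relations[OF M, of g']] by simp
  then show "(\<lambda>i. g i - g' i) \<in> relations N M" by simp
next
  assume "(\<lambda>i. g i - g' i) \<in> relations N M"
  then have eq: "eval_at N M g - eval_at N M g' = 0\<^sub>v N"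
    using eval_at_relations[OF M] eval_at_diff by metis
  show "eval_at N M g = eval_at N M g'"
  proof (rule eq_vecI)
    fix r assume r: "r < dim_vec (eval_at N M g')"
    then have rN: "r < N" by (simp add: eval_at_def)
    have "vec_index (eval_at N M g - eval_at N M g') r = 0" using eq rN by simp
    then show "vec_index (eval_at N M g) r = vec_index (eval_at N M g') r" using r by simp
  qed (simp add: eval_at_def)
qed

section \<open>Triangular relations and the characteristic polynomial\<close>

text \<open>
  The columns of \<open>(X - M) adj(X - M) = det(X - M)\<close>.
\<close>

lemma det_in_relations:
  assumes M: "M \<in> carrier_mat N N" and k: "k < N"
  shows "(\<lambda>i. if i = k then char_poly M else 0) \<in> relations N M"
proof -
  define C where "C = char_poly_matrix M"
  have C: "C \<in> carrier_mat N N" using M by (simp add: C_def)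
  have "(if i = k then char_poly M else 0) = char_map N M (\<lambda>l. adj_mat C $$ (l, k)) i" if i: "i < N" for i
  proof -
    have "(if i = k then char_poly M else 0) = (char_poly M \<cdot>\<^sub>m 1\<^sub>m N) $$ (i, k)"
      using i k by simp
    also have "\<dots> = (C * adj_mat C) $$ (i, k)"
      using adj_mat(2)[OF C] by (simp add: C_def char_poly_def)
    also have "\<dots> = (\<Sum>l<N. C $$ (i, l) * adj_mat C $$ (l, k))"
      using C adj_mat(1)[OF C] i k by (simp add: scalar_prod_def atLeast0LessThan)
    also have "\<dots> = (\<Sum>l<N. (if l = i then [:0, 1:] * adj_mat C $$ (l, k) else 0) - [:M $$ (i, l):] * adj_mat C $$ (l, k))"
      using M i by (intro sum.cong) (auto simp: C_def char_poly_matrix_def algebra_simps)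
    also have "\<dots> = char_map N M (\<lambda>l. adj_mat C $$ (l, k)) i"
      unfolding char_map_def sum_subtractf using i by simp
    finally show ?thesis .
  qed
  then show ?thesis by (rule relationsI)
qed

lemma char_poly_nonzero: "M \<in> carrier_mat N N \<Longrightarrow> char_poly (M :: 'a :: comm_ring_1 mat) \<noteq> 0"
  using degree_monic_char_poly[of M N] by auto

text \<open>
  The possible \<open>k\<close>-th entries of relations that vanish beyond \<open>k\<close> form an ideal of \<open>\<rat>[X]\<close>, which is non-zero by
  \<open>det_in_relations\<close>. An element of least degree generates it.
\<close>

lemma triangular_relation_exists:
  assumes M: "M \<in> carrier_mat N N" and k: "k < N"
  obtains h where "h \<in> relations N M" "\<And>i. k < i \<Longrightarrow> h i = 0" "lead_coeff (h k) = 1"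
    "\<And>g. g \<in> relations N M \<Longrightarrow> (\<And>i. k < i \<Longrightarrow> i < N \<Longrightarrow> g i = 0) \<Longrightarrow> h k dvd g k"
proof -
  define S where "S = {g \<in> relations N M. (\<forall>i. k < i \<longrightarrow> g i = 0) \<and> g k \<noteq> 0}"
  have "(\<lambda>i. if i = k then char_poly M else 0) \<in> S"
    using det_in_relations[OF M k] char_poly_nonzero[OF M] by (auto simp: S_def)
  then obtain s where s: "s \<in> S" "\<And>g. g \<in> S \<Longrightarrow> degree (s k) \<le> degree (g k)"
    using ex_has_least_nat[of "\<lambda>g. g \<in> S" _ "\<lambda>g. degree (g k)"] by blast
  define h where "h = (\<lambda>i. [:inverse (lead_coeff (s k)):] * s i)"
  have sk: "s k \<noteq> 0" using s(1) by (simp add: S_def)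
  have h: "h \<in> relations N M"
    unfolding h_def using s(1) by (intro relations_mult) (simp add: S_def)
  have dvd: "h k dvd g k" if g: "g \<in> relations N M" "\<And>i. k < i \<Longrightarrow> i < N \<Longrightarrow> g i = 0" for g
  proof -
    define g' where "g' = (\<lambda>i. if i < N then g i - (g k div s k) * s i else 0)"
    have "g' \<in> relations N M"
      using relations_diff[OF g(1) relations_mult[of s N M "g k div s k"]] s(1)
      by (intro relations_cong[of "\<lambda>i. g i - (g k div s k) * s i" N M g']) (auto simp: g'_def S_def)
    moreover have "g' i = 0" if "k < i" for i
      using g(2) that s(1) by (auto simp: g'_def S_def)
    moreover have g'k: "g' k = g k mod s k"
      using k by (simp add: g'_def minus_div_mult_eq_mod)
    ultimately have "g k mod s k \<noteq> 0 \<Longrightarrow> degree (s k) \<le> degree (g k mod s k)"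
      using s(2)[of g'] by (simp add: S_def)
    then have "g k mod s k = 0" using degree_mod_less[OF sk, of "g k"] by linarith
    then have "s k dvd g k" by auto
    then show ?thesis using sk by (simp add: h_def smult_dvd_iff)
  qed
  show ?thesis
    by (rule that[of h]) (use h dvd s(1) sk in \<open>auto simp: h_def S_def\<close>)
qed

text \<open>
  The vectors \<open>H k\<close> are the columns of an upper triangular matrix in the sense of the Hermite normal form of
  \<open>X - M\<close>; the last condition says that they generate all relations (see \<open>relations_span\<close>).
\<close>

definition hermite_basis :: "nat \<Rightarrow> rat mat \<Rightarrow> (nat \<Rightarrow> nat \<Rightarrow> rat poly) \<Rightarrow> bool" where
  "hermite_basis N M H \<longleftrightarrow> (\<forall>k<N. H k \<in> relations N M \<and> (\<forall>i>k. H k i = 0) \<and> lead_coeff (H k k) = 1 \<and>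
     (\<forall>g \<in> relations N M. (\<forall>i. k < i \<longrightarrow> i < N \<longrightarrow> g i = 0) \<longrightarrow> H k k dvd g k))"

lemma hermite_basisD:
  assumes "hermite_basis N M H" "k < N"
  shows "H k \<in> relations N M" "k < i \<Longrightarrow> H k i = 0" "lead_coeff (H k k) = 1"
    "g \<in> relations N M \<Longrightarrow> (\<And>i. k < i \<Longrightarrow> i < N \<Longrightarrow> g i = 0) \<Longrightarrow> H k k dvd g k"
  using assms by (auto simp: hermite_basis_def)

lemma hermite_basis_exists:
  assumes M: "M \<in> carrier_mat N N"
  obtains H where "hermite_basis N M H"
proof -
  have "\<exists>h. h \<in> relations N M \<and> (\<forall>i>k. h i = 0) \<and> lead_coeff (h k) = 1 \<and>
     (\<forall>g \<in> relations N M. (\<forall>i. k < i \<longrightarrow> i < N \<longrightarrow> g i = 0) \<longrightarrow> h k dvd g k)" if k: "k < N" for k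
    by (rule triangular_relation_exists[OF M k]) metis
  then have "\<exists>H. hermite_basis N M H" unfolding hermite_basis_def by metis
  then show ?thesis using that by blast
qed

lemma relations_span:
  assumes H: "hermite_basis N M H"
    and g: "g \<in> relations N M" "\<And>i. n \<le> i \<Longrightarrow> i < N \<Longrightarrow> g i = 0" and n: "n \<le> N"
  shows "\<exists>u. \<forall>i<N. g i = (\<Sum>k<n. u k * H k i)"
  using g n
proof (induction n arbitrary: g)
  case (Suc n)
  have "H n n dvd g n" using Suc.prems by (intro hermite_basisD(4)[OF H]) auto
  then obtain c where c: "g n = c * H n n" by (auto simp: dvd_def mult.commute)
  define g' where "g' = (\<lambda>i. g i - c * H n i)"
  have g'0: "g' i = 0" if "n \<le> i" "i < N" for i
    using Suc.prems(2)[of i] Suc.prems(3) hermite_basisD(2)[OF H, of n i] c that by (cases "i = n") (auto simp: g'_def)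
  have g'R: "g' \<in> relations N M"
    unfolding g'_def using Suc.prems hermite_basisD(1)[OF H, of n] by (intro relations_diff relations_mult) auto
  have "\<exists>u. \<forall>i<N. g' i = (\<Sum>k<n. u k * H k i)"
    using Suc.prems(3) by (intro Suc.IH g'0 g'R) auto
  then obtain u where u: "\<And>i. i < N \<Longrightarrow> g' i = (\<Sum>k<n. u k * H k i)"
    by metis
  have "(\<Sum>k<n. (u(n := c)) k * H k i) = (\<Sum>k<n. u k * H k i)" for i
    by (intro sum.cong) auto
  then have "\<forall>i<N. g i = (\<Sum>k<Suc n. (u(n := c)) k * H k i)"
    using u by (simp add: g'_def algebra_simps)
  then show ?case by (rule exI[where x = "u(n := c)"])
qed simp

lemma char_map_unit:
  assumes "i < N" "k < N" "M \<in> carrier_mat N N"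
  shows "char_map N M (\<lambda>l. if l = k then 1 else 0) i = char_poly_matrix M $$ (i, k)"
proof -
  have "(\<Sum>l<N. [:M $$ (i, l):] * (if l = k then 1 else 0)) = (\<Sum>l<N. if l = k then [:M $$ (i, l):] else 0)"
    by (intro sum.cong) auto
  then show ?thesis using assms by (auto simp: char_map_def char_poly_matrix_def)
qed

text \<open>
  The columns of \<open>X - M\<close> and the triangular basis \<open>H\<close> generate the same module, so that each matrix is the other one
  times a polynomial matrix. Hence the determinants divide each other, and both are monic.
\<close>

lemma char_poly_eq_prod:
  assumes M: "M \<in> carrier_mat N N"
    and H: "hermite_basis N M H"
  shows "char_poly M = (\<Prod>k<N. H k k)"
proof -
  define A where "A = mat N N (\<lambda>(i, k). H k i)"
  have A: "A \<in> carrier_mat N N" by (simp add: A_def)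
  have C: "char_poly_matrix M \<in> carrier_mat N N" using M by simp
  have "\<forall>k. \<exists>q. k < N \<longrightarrow> (\<forall>i<N. H k i = char_map N M q i)"
    using hermite_basisD(1)[OF H] unfolding relations_def by blast
  then obtain q where q: "\<And>k i. k < N \<Longrightarrow> i < N \<Longrightarrow> H k i = char_map N M (q k) i" by metis
  have cm: "char_map N M p i = (\<Sum>l<N. char_poly_matrix M $$ (i, l) * p l)" if "i < N" for p i
  proof -
    have "(\<Sum>l<N. char_poly_matrix M $$ (i, l) * p l) = (\<Sum>l<N. (if l = i then [:0, 1:] * p l else 0) - [:M $$ (i, l):] * p l)"
      using M that by (intro sum.cong) (auto simp: char_poly_matrix_def algebra_simps)
    then show ?thesis using that unfolding char_map_def sum_subtractf by simp
  qed
  have "A = char_poly_matrix M * mat N N (\<lambda>(l, k). q k l)"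
    using carrier_matD[OF C] by (intro eq_matI) (auto simp: A_def q cm scalar_prod_def atLeast0LessThan intro!: sum.cong)
  then have d1: "char_poly M dvd det A"
    using det_mult[OF C, of "mat N N (\<lambda>(l, k). q k l)"] by (simp add: char_poly_def)
  have "\<exists>u. \<forall>i<N. char_poly_matrix M $$ (i, k) = (\<Sum>l<N. u l * H l i)" if k: "k < N" for k
  proof (rule relations_span[OF H])
    show "(\<lambda>i. char_poly_matrix M $$ (i, k)) \<in> relations N M"
      using char_map_unit[OF _ k M] by (intro relationsI[where q = "\<lambda>l. if l = k then 1 else 0"]) simp
  qed auto
  then have "\<forall>k. \<exists>u. k < N \<longrightarrow> (\<forall>i<N. char_poly_matrix M $$ (i, k) = (\<Sum>l<N. u l * H l i))" by blast
  then obtain u where u: "\<And>k i. k < N \<Longrightarrow> i < N \<Longrightarrow> char_poly_matrix M $$ (i, k) = (\<Sum>l<N. u k l * H l i)"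
    by metis
  have "char_poly_matrix M = A * mat N N (\<lambda>(l, k). u k l)"
    using carrier_matD[OF C] by (intro eq_matI) (auto simp: A_def u scalar_prod_def atLeast0LessThan mult.commute intro!: sum.cong)
  then have d2: "det A dvd char_poly M"
    using det_mult[OF A, of "mat N N (\<lambda>(l, k). u k l)"] by (simp add: char_poly_def)
  have "upper_triangular A" using hermite_basisD(2)[OF H] by (auto simp: A_def)
  then have "det A = prod_list (diag_mat A)" using A by (rule det_upper_triangular)
  also have "diag_mat A = map (\<lambda>k. H k k) [0..<N]" by (auto simp: diag_mat_def A_def)
  also have "prod_list \<dots> = (\<Prod>k<N. H k k)"
    by (simp add: prod.distinct_set_conv_list[symmetric] atLeast0LessThan)
  finally have detA: "det A = (\<Prod>k<N. H k k)" .
  have "lead_coeff (det A) = 1"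
    unfolding detA lead_coeff_prod using hermite_basisD(3)[OF H] by simp
  moreover have "lead_coeff (char_poly M) = 1" using degree_monic_char_poly[OF M] by simp
  ultimately show ?thesis using d1 d2 detA by (metis poly_dvd_antisym)
qed

section \<open>Counting tuples of integer polynomials\<close>

definition lattice_values :: "nat \<Rightarrow> rat mat \<Rightarrow> nat \<Rightarrow> nat \<Rightarrow> rat Matrix.vec set" where
  "lattice_values N M n K =
    (\<lambda>f. eval_at N M (\<lambda>k. of_int_poly (f k))) ` (\<Pi>\<^sub>E k\<in>{..<N}. box n K)"

lemma finite_lattice_values: "finite (lattice_values N M n K)"
  unfolding lattice_values_def by (intro finite_imageI finite_PiE) (auto intro: finite_box)

text \<open>
  Choose for each \<open>k\<close> representatives of the classes modulo \<open>p k\<close>. Tuples of representatives have distinct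
  values: the difference of two tuples with the same value is a relation, so at the largest index where they differ
  the entry would be divisible by \<open>H k k\<close>, against the choice of the representatives.
\<close>

lemma card_lattice_values_ge:
  assumes M: "M \<in> carrier_mat N N" and H: "hermite_basis N M H"
    and p: "\<And>k. k < N \<Longrightarrow> content (p k) = 1"
      "\<And>k. k < N \<Longrightarrow> of_int_poly (p k) = [:c k:] * H k k" "\<And>k. k < N \<Longrightarrow> c k \<noteq> 0"
    and dom: "\<And>k. k < N \<Longrightarrow> dominant (of_int_poly (p k)) (j k) \<rho>" "0 < \<rho>"
    and K: "\<And>k. k < N \<Longrightarrow> \<bar>coeff (p k) (j k)\<bar> \<le> int K"
  shows "(\<Prod>k<N. (real_of_int \<bar>coeff (p k) (j k)\<bar> / 3) ^ (n - degree (p k))) \<le> card (lattice_values N M n K)"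
proof -
  define res where "res = (\<lambda>k g. of_int_poly g mod of_int_poly (p k) :: rat poly)"
  define G where "G = (\<lambda>k. inv_into (box n K) (res k) ` (res k ` box n K))"
  have G: "G k \<subseteq> box n K" for k by (auto simp: G_def inv_into_into)
  have res_inj: "inj_on (res k) (G k)" for k
    unfolding G_def by (intro inj_onI) (auto simp: f_inv_into_f)
  have cardG: "card (G k) = card (res k ` box n K)" for k
    unfolding G_def by (intro card_image inj_on_inv_into) simp
  let ?v = "\<lambda>f. eval_at N M (\<lambda>k. of_int_poly (f k))"
  have inj: "inj_on ?v (PiE {..<N} G)"
  proof (rule inj_onI, rule ccontr)
    fix f f' assume f: "f \<in> PiE {..<N} G" "f' \<in> PiE {..<N} G" and eq: "?v f = ?v f'" and ne: "f \<noteq> f'"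
    define D where "D = {k. k < N \<and> f k \<noteq> f' k}"
    have "D \<noteq> {}" using ne PiE_ext[OF f] by (auto simp: D_def)
    moreover have "finite D" by (simp add: D_def)
    ultimately have k: "Max D \<in> D" and mx: "\<And>i. i \<in> D \<Longrightarrow> i \<le> Max D" by auto
    define k where "k = Max D"
    have kN: "k < N" "f k \<noteq> f' k" using k by (auto simp: k_def D_def)
    have "(\<lambda>i. of_int_poly (f i) - of_int_poly (f' i)) \<in> relations N M"
      by (rule eval_at_eq_iff[OF M, THEN iffD1, OF eq])
    moreover have "of_int_poly (f i) - of_int_poly (f' i) = (0 :: rat poly)" if "k < i" "i < N" for i
    proof -
      have "i \<notin> D" using mx[of i] that(1) unfolding k_def by linarith
      then show ?thesis using that(2) by (simp add: D_def)
    qed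
    ultimately have "H k k dvd of_int_poly (f k) - of_int_poly (f' k)"
      using hermite_basisD(4)[OF H kN(1), of "\<lambda>i. of_int_poly (f i) - of_int_poly (f' i)"] by blast
    then have "(of_int_poly (p k) :: rat poly) dvd of_int_poly (f k) - of_int_poly (f' k)"
      using p(2,3)[OF kN(1)] by (simp add: smult_dvd_iff)
    then have "res k (f k) = res k (f' k)" unfolding res_def by (simp add: mod_eq_dvd_iff)
    moreover have "f k \<in> G k" "f' k \<in> G k" using f kN(1) by auto
    ultimately show False using res_inj kN(2) by (meson inj_onD)
  qed
  have sub: "?v ` PiE {..<N} G \<subseteq> lattice_values N M n K"
    unfolding lattice_values_def using G by (intro image_mono PiE_mono) auto
  have "(\<Prod>k<N. (real_of_int \<bar>coeff (p k) (j k)\<bar> / 3) ^ (n - degree (p k))) \<le> (\<Prod>k<N. real (card (G k)))"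
    unfolding cardG res_def using p(1) dom K by (intro prod_mono conjI card_residues_ge) auto
  also have "\<dots> = real (card (PiE {..<N} G))" by (simp add: card_PiE)
  also have "\<dots> \<le> card (lattice_values N M n K)"
    using card_inj_on_le[OF inj sub finite_lattice_values] by simp
  finally show ?thesis .
qed

lemma box_mult:
  assumes "h \<in> box n B" "degree w \<le> d" "coeff_l1 w \<le> W"
  shows "w * h \<in> box (n + d) (W * B)"
proof (rule boxI)
  fix k
  have "\<bar>coeff (w * h) k\<bar> \<le> int (coeff_l1 w) * int B"
    by (rule coeff_mult_le_coeff_l1) (rule boxD(1)[OF assms(1)])
  also have "\<dots> \<le> int (W * B)" using assms(3) by (simp add: mult_right_mono)
  finally show "\<bar>coeff (w * h) k\<bar> \<le> int (W * B)" .
next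
  fix k assume k: "n + d \<le> k"
  show "coeff (w * h) k = 0"
  proof (cases "h = 0")
    case False
    then have "degree h < n" by (intro degree_lt_length boxD(2)[OF assms(1)])
    then show ?thesis using degree_mult_le[of w h] assms(2) k by (intro coeff_eq_0) linarith
  qed simp
qed

lemma box_diff: "g \<in> box n A \<Longrightarrow> h \<in> box m B \<Longrightarrow> n \<le> m \<Longrightarrow> g - h \<in> box m (A + B)"
proof (rule boxI)
  assume *: "g \<in> box n A" "h \<in> box m B" "n \<le> m"
  fix k show "\<bar>coeff (g - h) k\<bar> \<le> int (A + B)"
    using boxD(1)[OF *(1), of k] boxD(1)[OF *(2), of k] by simp
qed (auto simp: boxD)

text \<open>
  The generators are the multiples \<open>D\<^sup>k e\<^sub>k\<close> of the unit vectors. For a common denominator \<open>D\<close> this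
  turns the rational relations \<open>H k\<close>, scaled by \<open>D\<^sup>k\<close>, into relations between the new generators with integral
  coefficients.
\<close>

definition scaled_values :: "nat \<Rightarrow> rat mat \<Rightarrow> int \<Rightarrow> nat \<Rightarrow> nat \<Rightarrow> nat \<Rightarrow> rat Matrix.vec set" where
  "scaled_values N M D i n A =
    (\<lambda>f. eval_at N M (\<lambda>k. if k < i then [:of_int (D ^ k):] * of_int_poly (f k) else 0)) ` (\<Pi>\<^sub>E k\<in>{..<i}. box n A)"

lemma finite_scaled_values: "finite (scaled_values N M D i n K)"
  unfolding scaled_values_def by (intro finite_imageI finite_PiE) (auto intro: finite_box)

text \<open>
  Reduction of the last entry modulo \<open>p i\<close> leaves few possibilities for it. The multiple \<open>p i * h\<close> that is
  subtracted is pushed into the earlier entries by the relation \<open>H i\<close>, which enlarges their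
  degree by a constant and their height by a multiple of \<open>A \<rho>\<^sup>n\<close>.
\<close>

lemma card_scaled_values_Suc:
  fixes \<rho> :: nat
  assumes M: "M \<in> carrier_mat N N" and H: "hermite_basis N M H"
    and i: "i < N"
    and p: "of_int_poly (p i) = [:c i:] * H i i"
    and w: "\<And>l. l < i \<Longrightarrow> of_int_poly (w l) = [:of_int (D ^ (i - l)):] * [:c i:] * H i l"
      "\<And>l. l < i \<Longrightarrow> degree (w l) \<le> d" "\<And>l. l < i \<Longrightarrow> coeff_l1 (w l) \<le> W"
    and dom: "dominant (of_int_poly (p i)) j (real \<rho>)" "1 \<le> \<rho>" and A: "1 \<le> A"
  shows "card (scaled_values N M D (Suc i) n A) \<le> 
     card (reduced (p i) j n (4 * coeff_l1 (p i) * A * \<rho> ^ n)) * card (scaled_values N M D i (n + d) (A + W * (3 * A * \<rho> ^ n)))"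
proof -
  let ?R = "reduced (p i) j n (4 * coeff_l1 (p i) * A * \<rho> ^ n)"
  let ?S = "scaled_values N M D i (n + d) (A + W * (3 * A * \<rho> ^ n))"
  let ?e = "\<lambda>r. eval_at N M (\<lambda>k. if k = i then [:of_int (D ^ i):] * of_int_poly r else 0)"
  have p0: "p i \<noteq> 0" and jd: "j \<le> degree (p i)"
    using dom(1) by (auto simp: dominant_def intro: le_degree)
  have "scaled_values N M D (Suc i) n A \<subseteq> (\<lambda>(r, y). ?e r + y) ` (?R \<times> ?S)"
  proof
    fix y assume "y \<in> scaled_values N M D (Suc i) n A"
    then obtain f where f: "f \<in> (\<Pi>\<^sub>E k\<in>{..<Suc i}. box n A)"
      and y: "y = eval_at N M (\<lambda>k. if k < Suc i then [:of_int (D ^ k):] * of_int_poly (f k) else 0)"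
      by (auto simp: scaled_values_def)
    have "f i \<in> box n A" using f by auto
    then obtain r h where rh: "f i = r + p i * h" "h \<in> box n (3 * A * \<rho> ^ n)" "r \<in> ?R"
      using box_reduction[OF dom A] by metis
    define f' where "f' = restrict (\<lambda>l. f l - w l * h) {..<i}"
    have f': "f' \<in> (\<Pi>\<^sub>E k\<in>{..<i}. box (n + d) (A + W * (3 * A * \<rho> ^ n)))"
      unfolding f'_def restrict_PiE_iff
    proof
      fix l assume "l \<in> {..<i}"
      then show "f l - w l * h \<in> box (n + d) (A + W * (3 * A * \<rho> ^ n))"
        using f w(2,3) by (intro box_diff[where n = n] box_mult rh(2)) auto
    qed
    let ?g = "\<lambda>k. (if k = i then [:of_int (D ^ i):] * of_int_poly r else 0) +
      (if k < i then [:of_int (D ^ k):] * of_int_poly (f' k) else 0) :: rat poly"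
    let ?u = "[:of_int (D ^ i):] * [:c i:] * of_int_poly h :: rat poly"
    have "(if k < Suc i then [:of_int (D ^ k):] * of_int_poly (f k) else 0) - ?g k = ?u * H i k" for k
    proof -
      consider "k = i" | "k < i" | "i < k" by linarith
      then show ?thesis
      proof cases
        case 1
        then show ?thesis using rh(1) p
          by (simp add: algebra_simps of_int_poly_hom.hom_add of_int_poly_hom.hom_mult)
      next
        case 2
        have "of_int_poly (f k) - of_int_poly (f' k) = (of_int_poly (w k) * of_int_poly h :: rat poly)"
          using 2 by (simp add: f'_def of_int_poly_hom.hom_minus of_int_poly_hom.hom_mult)
        moreover have "of_int (D ^ k) * of_int (D ^ (i - k)) = (of_int (D ^ i) :: rat)"
          using 2 by (simp flip: power_add)
        ultimately show ?thesis using 2 w(1)[OF 2]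
          by (simp add: right_diff_distrib[symmetric] mult_ac flip: smult_diff_right)
      next
        case 3
        then show ?thesis using hermite_basisD(2)[OF H i] by simp
      qed
    qed
    then have "y = eval_at N M ?g"
      unfolding y using relations_mult[OF hermite_basisD(1)[OF H i], of ?u]
      by (simp only: eval_at_eq_iff[OF M])
    also have "\<dots> = ?e r + eval_at N M (\<lambda>k. if k < i then [:of_int (D ^ k):] * of_int_poly (f' k) else 0)"
      by (rule eval_at_add)
    finally show "y \<in> (\<lambda>(r, y). ?e r + y) ` (?R \<times> ?S)"
      using rh(3) f' unfolding scaled_values_def by force
  qed
  moreover have "1 \<le> coeff_l1 (p i) * A * \<rho> ^ n" using coeff_l1_pos[OF p0] A dom(2) by (simp add: Suc_le_eq)
  then have "finite ?R" using jd p0 by (intro card_reduced_le(1)) auto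
  then have "finite (?R \<times> ?S)" using finite_scaled_values by blast
  ultimately have "card (scaled_values N M D (Suc i) n A) \<le> card (?R \<times> ?S)"
    by (rule surj_card_le[rotated])
  then show ?thesis by (simp add: card_cartesian_product)
qed

section \<open>The upper bound for tuples\<close>

text \<open>
  The exponent of \<open>A \<rho>\<^sup>n\<close> in the bound for \<open>i\<close> entries. It doubles in each step because the height \<open>A\<close>
  itself is replaced by a multiple of \<open>A \<rho>\<^sup>n\<close>. All that matters is that it depends only on \<open>N\<close>.
\<close>

fun growth_degree :: "nat \<Rightarrow> nat \<Rightarrow> nat" where
  "growth_degree N 0 = 0"
| "growth_degree N (Suc i) = 2 * growth_degree N i + N"

lemma common_denominator:
  fixes f :: "'a \<Rightarrow> rat poly"
  assumes "finite S"
  shows "\<exists>D::int. 0 < D \<and> (\<forall>x\<in>S. \<exists>w::int poly. of_int_poly w = [:of_int D:] * f x)"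
  using assms
proof induction
  case empty
  show ?case by (rule exI[of _ 1]) simp
next
  case (insert x S)
  then obtain D where D: "0 < D" "\<And>x. x \<in> S \<Longrightarrow> \<exists>w::int poly. of_int_poly w = [:of_int D:] * f x" by blast
  obtain t b where tb: "rat_to_int_poly (f x) = (t, b)" by fastforce
  have t: "t > 0" "f x = Polynomial.smult (inverse (rat_of_int t)) (of_int_poly b)"
    using rat_to_int_poly[OF tb] by auto
  have "\<exists>w::int poly. of_int_poly w = [:of_int (D * t):] * f y" if y: "y \<in> insert x S" for y
  proof (cases "y = x")
    case True
    have eq: "inverse (rat_of_int t) * (rat_of_int D * rat_of_int t) = rat_of_int D" using t(1) by simp
    have "of_int_poly ([:D:] * b) = [:of_int (D * t):] * f y"
      using t True by (simp add: eq of_int_poly_hom.hom_mult of_int_hom.map_poly_hom_smult)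
    then show ?thesis by (rule exI)
  next
    case False
    then obtain w :: "int poly" where "of_int_poly w = [:of_int D:] * f y" using D(2) y by blast
    then have "of_int_poly ([:t:] * w) = [:of_int (D * t):] * f y"
      by (simp add: of_int_poly_hom.hom_mult of_int_hom.map_poly_hom_smult mult.commute)
    then show ?thesis by (rule exI)
  qed
  moreover have "0 < D * t" using D(1) t(1) by simp
  ultimately show ?case by blast
qed

lemma card_scaled_values_le:
  fixes \<rho> :: nat
  assumes M: "M \<in> carrier_mat N N" and H: "hermite_basis N M H"
    and p: "\<And>k. k < N \<Longrightarrow> of_int_poly (p k) = [:c k:] * H k k" "\<And>k. k < N \<Longrightarrow> degree (p k) \<le> N"
    and D: "\<And>k l. k < N \<Longrightarrow> l < k \<Longrightarrow> \<exists>w::int poly. of_int_poly w = [:of_int (D ^ (k - l)):] * [:c k:] * H k l"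
    and dom: "\<And>k. k < N \<Longrightarrow> dominant (of_int_poly (p k)) (j k) (real \<rho>)" "1 \<le> \<rho>"
    and i: "i \<le> N"
  shows "\<exists>C. \<forall>n A. 1 \<le> A \<longrightarrow> card (scaled_values N M D i n A) \<le>
    C * (A * \<rho> ^ n) ^ growth_degree N i * (\<Prod>k<i. 3 * coeff_l1 (p k)) ^ n"
  using i
proof (induction i)
  case 0
  have "card (scaled_values N M D 0 n A) \<le> 1" for n A
    unfolding scaled_values_def by (simp add: PiE_empty_domain)
  then show ?case by (intro exI[of _ 1]) simp
next
  case (Suc i)
  then have i: "i < N" by simp
  define Q where "Q = (\<Prod>k<i. 3 * coeff_l1 (p k))"
  define E where "E = growth_degree N i"
  obtain C where C: "\<And>n A. 1 \<le> A \<Longrightarrow> card (scaled_values N M D i n A) \<le> C * (A * \<rho> ^ n) ^ E * Q ^ n"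
    using Suc.IH Suc.prems unfolding Q_def E_def by auto
  have "\<forall>l. \<exists>w::int poly. l < i \<longrightarrow> of_int_poly w = [:of_int (D ^ (i - l)):] * [:c i:] * H i l"
    using D[OF i] by blast
  then obtain w :: "nat \<Rightarrow> int poly"
    where w: "\<And>l. l < i \<Longrightarrow> of_int_poly (w l) = [:of_int (D ^ (i - l)):] * [:c i:] * H i l"
    by metis
  define d where "d = (\<Sum>l<i. degree (w l))"
  define W where "W = (\<Sum>l<i. coeff_l1 (w l))"
  have d: "degree (w l) \<le> d" and W: "coeff_l1 (w l) \<le> W" if "l < i" for l
    using that unfolding d_def W_def by (auto intro!: member_le_sum)
  define h where "h = coeff_l1 (p i)"
  have p0: "p i \<noteq> 0" and jd: "j i \<le> degree (p i)"
    using dom(1)[OF i] by (auto simp: dominant_def intro: le_degree)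
  have h: "1 \<le> h" using coeff_l1_pos[OF p0] by (simp add: h_def)
  define C' where "C' = (12 * h) ^ N * (C * ((1 + 3 * W) * \<rho> ^ d) ^ E * Q ^ d)"
  have "card (scaled_values N M D (Suc i) n A) \<le> C' * (A * \<rho> ^ n) ^ (2 * E + N) * ((3 * h) * Q) ^ n"
    if A: "1 \<le> A" for n A
  proof -
    \<comment> \<open>everything is estimated by this one quantity, which is at least 1\<close>
    define x where "x = A * \<rho> ^ n"
    have \<rho>n: "1 \<le> \<rho> ^ n" using dom(2) by simp
    have x: "1 \<le> x" "\<rho> ^ n \<le> x" "A \<le> x" using A \<rho>n by (auto simp: x_def)
    have "card (reduced (p i) (j i) n (4 * h * A * \<rho> ^ n)) \<le> (3 * h) ^ n * (3 * (4 * h * A * \<rho> ^ n)) ^ degree (p i)"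
      unfolding h_def using jd p0 x(1) h by (intro card_reduced_le) (simp_all add: x_def h_def Suc_le_eq)
    also have "3 * (4 * h * A * \<rho> ^ n) = 12 * h * x" by (simp add: x_def)
    also have "(3 * h) ^ n * (12 * h * x) ^ degree (p i) \<le> (3 * h) ^ n * (12 * h * x) ^ N"
      using p(2)[OF i] h x(1) by (intro mult_left_mono power_increasing) (auto simp: Suc_le_eq)
    finally have red: "card (reduced (p i) (j i) n (4 * h * A * \<rho> ^ n)) \<le> (3 * h) ^ n * (12 * h * x) ^ N" .
    have "A + W * (3 * A * \<rho> ^ n) = A + 3 * W * x" by (simp add: x_def)
    also have "\<dots> \<le> (1 + 3 * W) * x" using x by (simp add: algebra_simps)
    finally have A': "A + W * (3 * A * \<rho> ^ n) \<le> (1 + 3 * W) * x" .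
    have "card (scaled_values N M D i (n + d) (A + W * (3 * A * \<rho> ^ n))) \<le>
       C * ((A + W * (3 * A * \<rho> ^ n)) * \<rho> ^ (n + d)) ^ E * Q ^ (n + d)"
      using A by (intro C) simp
    also have "\<dots> \<le> C * (((1 + 3 * W) * x) * (x * \<rho> ^ d)) ^ E * Q ^ (n + d)"
      using A' x(2) by (intro mult_le_mono order.refl power_mono) (auto simp: power_add intro!: mult_le_mono)
    also have "\<dots> = (C * ((1 + 3 * W) * \<rho> ^ d) ^ E * Q ^ d) * (x ^ (2 * E) * Q ^ n)"
    proof -
      have "((1 + 3 * W) * x) * (x * \<rho> ^ d) = ((1 + 3 * W) * \<rho> ^ d) * (x ^ 2)"
        by (simp only: power2_eq_square mult_ac)
      then show ?thesis unfolding power_add power_mult by (simp only: power_mult_distrib mult_ac)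
    qed
    finally have sv: "card (scaled_values N M D i (n + d) (A + W * (3 * A * \<rho> ^ n))) \<le>
       (C * ((1 + 3 * W) * \<rho> ^ d) ^ E * Q ^ d) * (x ^ (2 * E) * Q ^ n)" .
    have "card (scaled_values N M D (Suc i) n A) \<le>
       card (reduced (p i) (j i) n (4 * h * A * \<rho> ^ n)) * card (scaled_values N M D i (n + d) (A + W * (3 * A * \<rho> ^ n)))"
      unfolding h_def by (rule card_scaled_values_Suc[where p = p and c = c and w = w and H = H and D = D, OF M H i p(1)[OF i] w d W dom(1)[OF i] dom(2) A])
    also have "\<dots> \<le> ((3 * h) ^ n * (12 * h * x) ^ N) * ((C * ((1 + 3 * W) * \<rho> ^ d) ^ E * Q ^ d) * (x ^ (2 * E) * Q ^ n))"
      by (intro mult_le_mono red sv)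
    also have "\<dots> = C' * x ^ (2 * E + N) * ((3 * h) * Q) ^ n"
      unfolding C'_def power_add power_mult_distrib by (simp only: mult_ac)
    finally show ?thesis by (simp only: x_def)
  qed
  moreover have "(\<Prod>k<Suc i. 3 * coeff_l1 (p k)) = (3 * h) * Q" by (simp add: Q_def h_def)
  ultimately show ?case unfolding E_def growth_degree.simps by metis
qed

lemma eval_at_cmult: "eval_at N M (\<lambda>k. [:c:] * g k) = c \<cdot>\<^sub>v eval_at N M g"
  unfolding eval_at_def moment_cmult by (auto simp: sum_distrib_left)

lemma lattice_values_carrier: "lattice_values N M n K \<subseteq> carrier_vec N"
  unfolding lattice_values_def by (intro image_subsetI eval_at_carrier)

lemma card_lattice_values_le:
  fixes \<rho> :: nat
  assumes M: "M \<in> carrier_mat N N" and H: "hermite_basis N M H"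
    and p: "\<And>k. k < N \<Longrightarrow> of_int_poly (p k) = [:c k:] * H k k" "\<And>k. k < N \<Longrightarrow> degree (p k) \<le> N"
    and dom: "\<And>k. k < N \<Longrightarrow> dominant (of_int_poly (p k)) (j k) (real \<rho>)" "1 \<le> \<rho>"
    and K: "1 \<le> K"
  shows "\<exists>C. \<forall>n. card (lattice_values N M n K) \<le>
    C * (\<rho> ^ growth_degree N N * (\<Prod>k<N. 3 * coeff_l1 (p k))) ^ n"
proof -
  have "\<exists>D::int. 0 < D \<and> (\<forall>x\<in>{..<N} \<times> {..<N}. \<exists>w::int poly. of_int_poly w = [:of_int D:] * ([:c (fst x):] * H (fst x) (snd x)))"
    by (rule common_denominator) simp
  then obtain D :: int where D0: "0 < D"
    "\<forall>x\<in>{..<N} \<times> {..<N}. \<exists>w::int poly. of_int_poly w = [:of_int D:] * ([:c (fst x):] * H (fst x) (snd x))"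
    by auto
  have D: "\<exists>w::int poly. of_int_poly w = [:of_int D:] * ([:c k:] * H k l)" if "k < N" "l < N" for k l
    using bspec[OF D0(2), of "(k, l)"] that by simp_all
  have D': "\<exists>w::int poly. of_int_poly w = [:of_int (D ^ (k - l)):] * [:c k:] * H k l" if kl: "k < N" "l < k" for k l
  proof -
    obtain w :: "int poly" where w: "of_int_poly w = [:of_int D:] * ([:c k:] * H k l)"
      using D[of k l] kl by auto
    have "D ^ (k - l) = D ^ (k - l - 1) * D" using kl(2) by (metis Suc_diff_Suc Suc_eq_plus1 diff_diff_left power_Suc2)
    then have "of_int_poly ([:D ^ (k - l - 1):] * w) = [:of_int (D ^ (k - l)):] * [:c k:] * H k l"
      using w by (simp add: of_int_poly_hom.hom_mult of_int_hom.map_poly_hom_smult mult_ac)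
    then show ?thesis by (rule exI)
  qed
  define Q where "Q = (\<Prod>k<N. 3 * coeff_l1 (p k))"
  define E where "E = growth_degree N N"
  have "\<exists>C. \<forall>n A. 1 \<le> A \<longrightarrow> card (scaled_values N M D N n A) \<le> C * (A * \<rho> ^ n) ^ E * Q ^ n"
    unfolding Q_def E_def
    by (rule card_scaled_values_le[where p = p and c = c and j = j and H = H, OF M H p D' dom order.refl])
  then obtain C where C: "\<forall>n A. 1 \<le> A \<longrightarrow> card (scaled_values N M D N n A) \<le> C * (A * \<rho> ^ n) ^ E * Q ^ n" ..
  define A where "A = nat (D ^ N) * K"
  have A: "1 \<le> A" using D0(1) K by (simp add: A_def Suc_le_eq)
  have "card (lattice_values N M n K) \<le> C * A ^ E * (\<rho> ^ E * Q) ^ n" for n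
  proof -
    let ?s = "\<lambda>v. rat_of_int (D ^ N) \<cdot>\<^sub>v v"
    have sub: "?s ` lattice_values N M n K \<subseteq> scaled_values N M D N n A"
    proof
      fix y assume "y \<in> ?s ` lattice_values N M n K"
      then obtain f where f: "f \<in> (\<Pi>\<^sub>E k\<in>{..<N}. box n K)" "y = ?s (eval_at N M (\<lambda>k. of_int_poly (f k)))"
        by (auto simp: lattice_values_def)
      define f' where "f' = restrict (\<lambda>k. [:D ^ (N - k):] * f k) {..<N}"
      have "f' \<in> (\<Pi>\<^sub>E k\<in>{..<N}. box n A)"
        unfolding f'_def restrict_PiE_iff
      proof
        fix k assume k: "k \<in> {..<N}"
        then have fk: "f k \<in> box n K" using f(1) by auto
        show "[:D ^ (N - k):] * f k \<in> box n A"
        proof (rule boxI)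
          fix l
          have "D ^ (N - k) \<le> D ^ N" using D0(1) by (intro power_increasing) auto
          then have "D ^ (N - k) * \<bar>coeff (f k) l\<bar> \<le> D ^ N * int K"
            using boxD(1)[OF fk] D0(1) by (intro mult_mono) auto
          then show "\<bar>coeff ([:D ^ (N - k):] * f k) l\<bar> \<le> int A"
            using D0(1) by (simp add: A_def abs_mult)
        qed (simp add: boxD(2)[OF fk])
      qed
      moreover have "y = eval_at N M (\<lambda>k. if k < N then [:of_int (D ^ k):] * of_int_poly (f' k) else 0)"
        unfolding f(2) eval_at_cmult[symmetric]
      proof (rule eval_at_cong)
        fix k assume k: "k < N"
        have "rat_of_int (D ^ k) * rat_of_int (D ^ (N - k)) = rat_of_int (D ^ N)"
          using k by (simp flip: power_add)
        then show "[:rat_of_int (D ^ N):] * of_int_poly (f k) = (if k < N then [:rat_of_int (D ^ k):] * of_int_poly (f' k) else 0)"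
          using k by (simp add: f'_def of_int_hom.map_poly_hom_smult mult.commute)
      qed
      ultimately show "y \<in> scaled_values N M D N n A" unfolding scaled_values_def by blast
    qed
    have inj: "inj_on ?s (lattice_values N M n K)"
    proof (rule inj_onI)
      fix x y assume "x \<in> lattice_values N M n K" "y \<in> lattice_values N M n K" and eq: "?s x = ?s y"
      then have dim: "dim_vec x = N" "dim_vec y = N"
        using lattice_values_carrier carrier_vecD by blast+
      show "x = y"
      proof (rule eq_vecI)
        fix r assume r: "r < dim_vec y"
        have "vec_index (?s x) r = vec_index (?s y) r" using eq by simp
        then show "vec_index x r = vec_index y r" using r dim D0(1) by simp
      qed (simp add: dim)
    qed
    have "card (lattice_values N M n K) \<le> card (scaled_values N M D N n A)"
      by (rule card_inj_on_le[OF inj sub finite_scaled_values])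
    also have "\<dots> \<le> C * (A * \<rho> ^ n) ^ E * Q ^ n" using C A by simp
    also have "\<dots> = C * A ^ E * (\<rho> ^ E * Q) ^ n"
    proof -
      have "(\<rho> ^ n) ^ E = (\<rho> ^ E) ^ n" by (metis mult.commute power_mult)
      then show ?thesis unfolding power_mult_distrib by (simp only: mult_ac)
    qed
    finally show ?thesis .
  qed
  then show ?thesis unfolding E_def Q_def by (intro exI allI)
qed

section \<open>Root gaps, dominant coefficients and the Mahler measure\<close>

definition weighted_l1 :: "real \<Rightarrow> complex poly \<Rightarrow> real" where
  "weighted_l1 \<rho> q = (\<Sum>l\<le>degree q. cmod (coeff q l) * \<rho> ^ l)"

lemma weighted_l1_eq_sum:
  assumes "degree q \<le> n"
  shows "weighted_l1 \<rho> q = (\<Sum>l\<le>n. cmod (coeff q l) * \<rho> ^ l)"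
  unfolding weighted_l1_def using assms by (intro sum.mono_neutral_left) (auto intro!: coeff_eq_0)

lemma weighted_l1_add: "0 \<le> \<rho> \<Longrightarrow> weighted_l1 \<rho> (p + q) \<le> weighted_l1 \<rho> p + weighted_l1 \<rho> q"
proof -
  assume \<rho>: "0 \<le> \<rho>"
  define n where "n = max (degree p) (degree q)"
  have "degree p \<le> n" "degree q \<le> n" "degree (p + q) \<le> n"
    by (auto simp: n_def degree_add_le_max)
  moreover have "(\<Sum>l\<le>n. cmod (coeff (p + q) l) * \<rho> ^ l) \<le> (\<Sum>l\<le>n. cmod (coeff p l) * \<rho> ^ l + cmod (coeff q l) * \<rho> ^ l)"
    unfolding distrib_right[symmetric] coeff_add
    using \<rho> by (intro sum_mono mult_right_mono norm_triangle_ineq) auto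
  ultimately show ?thesis by (simp add: weighted_l1_eq_sum[of _ n] sum.distrib)
qed

lemma weighted_l1_cmult: "weighted_l1 \<rho> ([:a:] * q) = cmod a * weighted_l1 \<rho> q"
  by (cases "a = 0") (simp_all add: weighted_l1_def sum_distrib_left norm_mult mult.assoc)

lemma weighted_l1_pCons_0: "weighted_l1 \<rho> (pCons 0 q) = \<rho> * weighted_l1 \<rho> q"
proof -
  have "weighted_l1 \<rho> (pCons 0 q) = (\<Sum>l\<le>Suc (degree q). cmod (coeff (pCons 0 q) l) * \<rho> ^ l)"
    by (rule weighted_l1_eq_sum) (rule degree_pCons_le)
  also have "\<dots> = (\<Sum>l\<le>degree q. cmod (coeff q l) * \<rho> ^ Suc l)"
    by (subst sum.atMost_Suc_shift) simp
  finally show ?thesis by (simp add: weighted_l1_def sum_distrib_left mult_ac)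
qed

lemma weighted_l1_monom: "weighted_l1 \<rho> (monom c j) = cmod c * \<rho> ^ j"
proof (cases "c = 0")
  case False
  then have "weighted_l1 \<rho> (monom c j) = (\<Sum>l\<in>{j}. cmod (coeff (monom c j) l) * \<rho> ^ l)"
    unfolding weighted_l1_def by (intro sum.mono_neutral_right) (auto simp: degree_monom_eq)
  then show ?thesis by simp
qed (simp add: weighted_l1_def)

text \<open>
  A factor \<open>X - a\<close> is nearly \<open>X\<close> if \<open>a\<close> is small and nearly \<open>-a\<close> if \<open>a\<close> is large, both up to a relative error \<open>1 / B\<close> in
  the weighted sum norm. So the product is nearly a monomial whose coefficient is, up to sign, the product of
  the large roots.
\<close>

lemma linear_factors_near_monom:
  fixes as :: "complex list" and \<rho> B :: real
  assumes "0 < \<rho>" "1 < B" "\<And>a. a \<in> set as \<Longrightarrow> cmod a \<le> \<rho> / B \<or> \<rho> * B \<le> cmod a"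
  shows "\<exists>j c E. (\<Prod>a\<leftarrow>as. [:- a, 1:]) = monom c j + E \<and>
    cmod c = prod_list (map cmod (filter (\<lambda>a. \<rho> < cmod a) as)) \<and>
    weighted_l1 \<rho> E \<le> ((1 + 1 / B) ^ length as - 1) * (cmod c * \<rho> ^ j)"
  using assms(3)
proof (induction as)
  case Nil
  show ?case
    by (rule exI[of _ 0], rule exI[of _ 1], rule exI[of _ 0]) (simp add: weighted_l1_def one_poly_eq_simps)
next
  case (Cons a as)
  have "\<exists>j c E. (\<Prod>a\<leftarrow>as. [:- a, 1:]) = monom c j + E \<and>
    cmod c = prod_list (map cmod (filter (\<lambda>a. \<rho> < cmod a) as)) \<and>
    weighted_l1 \<rho> E \<le> ((1 + 1 / B) ^ length as - 1) * (cmod c * \<rho> ^ j)"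
    using Cons.prems by (intro Cons.IH) auto
  then obtain j c E where jc: "(\<Prod>a\<leftarrow>as. [:- a, 1:]) = monom c j + E"
    "cmod c = prod_list (map cmod (filter (\<lambda>a. \<rho> < cmod a) as))"
    "weighted_l1 \<rho> E \<le> ((1 + 1 / B) ^ length as - 1) * (cmod c * \<rho> ^ j)" by auto
  define t where "t = (1 + 1 / B) ^ length as"
  define m where "m = cmod c * \<rho> ^ j"
  have m: "0 \<le> m" using assms(1) by (simp add: m_def)
  have t: "1 \<le> t" using assms(2) by (simp add: t_def)
  have E: "weighted_l1 \<rho> E \<le> (t - 1) * m" using jc(3) by (simp add: t_def m_def)
  have q: "weighted_l1 \<rho> (monom c j + E) \<le> t * m"
    using weighted_l1_add[of \<rho> "monom c j" E] E assms(1) by (simp add: weighted_l1_monom m_def algebra_simps)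
  have P: "(\<Prod>a\<leftarrow>(a # as). [:- a, 1:]) = pCons 0 (monom c j + E) + [:- a:] * (monom c j + E)"
    using jc(1) by (simp add: algebra_simps)
  show ?case
  proof (cases "\<rho> < cmod a")
    case False
    moreover have "\<rho> < \<rho> * B" using assms by simp
    ultimately have "\<not> \<rho> * B \<le> cmod a" by linarith
    then have a: "cmod a \<le> \<rho> / B" using Cons.prems[of a] by auto
    define E' where "E' = pCons 0 E + [:- a:] * (monom c j + E)"
    have "weighted_l1 \<rho> E' \<le> \<rho> * weighted_l1 \<rho> E + cmod a * weighted_l1 \<rho> (monom c j + E)"
      using weighted_l1_add[of \<rho> "pCons 0 E" "[:- a:] * (monom c j + E)"] assms(1)
      unfolding E'_def weighted_l1_pCons_0 weighted_l1_cmult by simp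
    also have "\<dots> \<le> \<rho> * ((t - 1) * m) + \<rho> / B * (t * m)"
      using E q a assms m t by (intro add_mono mult_mono) (auto simp: weighted_l1_def intro!: sum_nonneg)
    also have "\<dots> = (t * (1 + 1 / B) - 1) * (\<rho> * m)" by (simp add: algebra_simps)
    finally have "weighted_l1 \<rho> E' \<le> ((1 + 1 / B) ^ length (a # as) - 1) * (cmod c * \<rho> ^ Suc j)"
      by (simp add: t_def m_def mult_ac)
    moreover have "(\<Prod>a\<leftarrow>(a # as). [:- a, 1:]) = monom c (Suc j) + E'"
      unfolding P E'_def by (simp add: monom_Suc)
    ultimately show ?thesis using False jc(2)
      by (intro exI[of _ "Suc j"] exI[of _ c] exI[of _ E']) simp
  next
    case True
    moreover have "\<rho> / B < \<rho>" using assms by (simp add: divide_less_eq)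
    ultimately have "\<not> cmod a \<le> \<rho> / B" by linarith
    then have a: "\<rho> * B \<le> cmod a" using Cons.prems[of a] by auto
    then have a': "\<rho> \<le> cmod a / B" using assms by (simp add: field_simps)
    define E' where "E' = [:- a:] * E + pCons 0 (monom c j + E)"
    have "weighted_l1 \<rho> E' \<le> cmod a * weighted_l1 \<rho> E + \<rho> * weighted_l1 \<rho> (monom c j + E)"
      using weighted_l1_add[of \<rho> "[:- a:] * E" "pCons 0 (monom c j + E)"] assms(1)
      unfolding E'_def weighted_l1_pCons_0 weighted_l1_cmult by simp
    also have "\<dots> \<le> cmod a * ((t - 1) * m) + cmod a / B * (t * m)"
      using E q a' assms m t by (intro add_mono mult_mono) (auto simp: weighted_l1_def intro!: sum_nonneg)
    also have "\<dots> = (t * (1 + 1 / B) - 1) * (cmod a * m)" by (simp add: algebra_simps)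
    finally have "weighted_l1 \<rho> E' \<le> ((1 + 1 / B) ^ length (a # as) - 1) * (cmod (- a * c) * \<rho> ^ j)"
      by (simp add: t_def m_def mult_ac norm_mult)
    moreover have "(\<Prod>a\<leftarrow>(a # as). [:- a, 1:]) = monom (- a * c) j + E'"
      unfolding P E'_def by (simp add: algebra_simps smult_monom)
    ultimately show ?thesis using True jc(2)
      by (intro exI[of _ j] exI[of _ "- a * c"] exI[of _ E']) (simp add: norm_mult)
  qed
qed

lemma one_plus_inverse_power_le:
  fixes x :: real
  assumes "0 \<le> x" "x * real N \<le> 1 / 8"
  shows "(1 + x) ^ N \<le> 8 / 7"
proof (cases "N = 0")
  case False
  have "x * 1 \<le> x * real N" using assms(1) False by (intro mult_left_mono) auto
  then have x1: "x \<le> 1 / 8" using assms(2) by linarith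
  have "7 / 8 \<le> 1 + real N * (- x)" using assms(2) by (simp add: mult.commute)
  also have "\<dots> \<le> (1 + (- x)) ^ N" using x1 by (intro Bernoulli_inequality) simp
  finally have *: "7 / 8 \<le> (1 - x) ^ N" by simp
  have "(1 + x) ^ N * (7 / 8) \<le> (1 + x) ^ N * (1 - x) ^ N"
    using * assms(1) by (intro mult_left_mono) auto
  also have "\<dots> = (1 - x * x) ^ N" by (simp add: algebra_simps flip: power_mult_distrib)
  also have "\<dots> \<le> 1" using x1 assms(1) by (intro power_le_one) (auto simp: mult_le_one)
  finally show ?thesis by simp
qed simp

text \<open>
  The exponential form, which is the growth rate that counting arguments produce.
\<close>

definition mahler :: "int poly \<Rightarrow> real" where
  "mahler p = exp (log_mahler_measure (of_int_poly p))"

lemma ln_prod_list_cmod: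
  "(\<And>a. a \<in> set as \<Longrightarrow> 0 < cmod a) \<Longrightarrow> exp (\<Sum>a\<in>#mset as. ln (cmod a)) = prod_list (map cmod as)"
  by (induction as) (simp_all add: exp_add)

lemma proots_linear_factors: "proots (\<Prod>a\<leftarrow>as. [:- a, 1:]) = mset as"
proof (induction as)
  case (Cons a as)
  have "(\<Prod>a\<leftarrow>as. [:- a, 1:]) \<noteq> 0" by (auto simp: prod_list_zero_iff)
  moreover have "proots [:- a, 1:] = {#a#}" using proots_linear_factor[of "- a"] by simp
  ultimately show ?case using Cons by (simp only: list.map prod_list.Cons mset.simps) (subst proots_mult, auto)
qed simp

lemma mahler_eq:
  assumes "p \<noteq> 0" "of_int_poly p = Polynomial.smult (of_int (lead_coeff p)) (\<Prod>a\<leftarrow>as. [:- a, 1:])"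
  shows "mahler p = \<bar>real_of_int (lead_coeff p)\<bar> * prod_list (map cmod (filter (\<lambda>a. 1 < cmod a) as))"
proof -
  have "of_int (lead_coeff p) \<noteq> (0::complex)" using assms(1) by simp
  then have pr: "proots (of_int_poly p) = mset as"
    unfolding assms(2) by (subst proots_smult) (simp_all only: proots_linear_factors not_False_eq_True)
  have "exp (\<Sum>a\<in>#mset (filter (\<lambda>a. 1 < cmod a) as). ln (cmod a)) = prod_list (map cmod (filter (\<lambda>a. 1 < cmod a) as))"
    by (rule ln_prod_list_cmod) auto
  moreover have "exp (ln (cmod (lead_coeff (of_int_poly p)))) = \<bar>real_of_int (lead_coeff p)\<bar>"
    using assms(1) by simp
  ultimately show ?thesis
    unfolding mahler_def log_mahler_measure_def exp_add pr by (simp add: mset_filter)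
qed

text \<open>
  Replacing the threshold \<open>1\<close> of the Mahler measure by \<open>\<rho>\<close> costs at most a factor \<open>\<rho>\<close> for each root.
\<close>

lemma prod_filter_le:
  assumes "1 \<le> \<rho>"
  shows "prod_list (map cmod (filter (\<lambda>a. \<rho> < cmod a) as)) \<le> prod_list (map cmod (filter (\<lambda>a. 1 < cmod a) as))"
    "prod_list (map cmod (filter (\<lambda>a. 1 < cmod a) as)) \<le> prod_list (map cmod (filter (\<lambda>a. \<rho> < cmod a) as)) * \<rho> ^ length as"
    "0 < prod_list (map cmod (filter (\<lambda>a. \<rho> < cmod a) as))"
proof (induction as)
  case (Cons a as)
  define u v where "u = prod_list (map cmod (filter (\<lambda>a. \<rho> < cmod a) as))"
    and "v = prod_list (map cmod (filter (\<lambda>a. 1 < cmod a) as))"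
  have uv: "u \<le> v" "v \<le> u * \<rho> ^ length as" "0 < u" using Cons.IH by (auto simp: u_def v_def)
  consider "cmod a \<le> 1" | "1 < cmod a" "cmod a \<le> \<rho>" | "\<rho> < cmod a" by linarith
  then have "(if \<rho> < cmod a then cmod a * u else u) \<le> (if 1 < cmod a then cmod a * v else v) \<and>
    (if 1 < cmod a then cmod a * v else v) \<le> (if \<rho> < cmod a then cmod a * u else u) * (\<rho> * \<rho> ^ length as)"
  proof cases
    case 1
    have "u * \<rho> ^ length as \<le> u * (\<rho> * \<rho> ^ length as)"
      using uv assms by (intro mult_left_mono) auto
    then have "v \<le> u * (\<rho> * \<rho> ^ length as)" using uv by linarith
    then show ?thesis using 1 uv assms by auto
  next
    case 2
    have "u \<le> cmod a * v" using mult_mono[of 1 "cmod a" u v] 2 uv by simp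
    moreover have "cmod a * v \<le> \<rho> * (u * \<rho> ^ length as)"
      using 2 uv assms by (intro mult_mono) auto
    ultimately show ?thesis using 2 by (auto simp: mult_ac)
  next
    case 3
    have "cmod a * v \<le> cmod a * (u * \<rho> ^ length as)" using uv by (intro mult_left_mono) auto
    also have "\<dots> \<le> (cmod a * (u * \<rho> ^ length as)) * \<rho>" using mult_left_mono[OF assms, of "cmod a * (u * \<rho> ^ length as)"] uv assms by simp
    finally show ?thesis using 3 uv assms by (auto simp: mult_ac intro!: mult_left_mono mult_right_mono)
  qed
  moreover have "0 < (if \<rho> < cmod a then cmod a * u else u)"
    using uv assms order.strict_trans1[of 0 \<rho> "cmod a"] by auto
  ultimately show
    "prod_list (map cmod (filter (\<lambda>a. \<rho> < cmod a) (a # as))) \<le> prod_list (map cmod (filter (\<lambda>a. 1 < cmod a) (a # as)))"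
    "prod_list (map cmod (filter (\<lambda>a. 1 < cmod a) (a # as))) \<le> prod_list (map cmod (filter (\<lambda>a. \<rho> < cmod a) (a # as))) * \<rho> ^ length (a # as)"
    "0 < prod_list (map cmod (filter (\<lambda>a. \<rho> < cmod a) (a # as)))"
    by (auto simp: u_def v_def split: if_splits)
qed auto

text \<open>
  With \<open>B = 8 (N + 1)\<close> the accumulated relative error of the at most \<open>N\<close> linear factors stays below \<open>1 / 4\<close>, so
  the coefficient at the monomial of \<open>linear_factors_near_monom\<close> dominates all others.
\<close>

lemma dominant_coefficient_exists:
  fixes p :: "int poly" and \<rho> N :: nat
  assumes p: "p \<noteq> 0" "degree p \<le> N" and \<rho>: "1 \<le> \<rho>"
    and roots: "\<And>a. poly (of_int_poly p) a = 0 \<Longrightarrow> cmod a \<le> \<rho> / (8 * (N + 1)) \<or> real \<rho> * (8 * (N + 1)) \<le> cmod a"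
  obtains j where "dominant (of_int_poly p) j \<rho>"
    "mahler p \<le> 2 * real \<rho> ^ N * real_of_int \<bar>coeff p j\<bar>"
    "real_of_int \<bar>coeff p j\<bar> \<le> 2 * mahler p"
    "real (coeff_l1 p) \<le> 2 * real \<rho> ^ N * real_of_int \<bar>coeff p j\<bar>"
proof -
  obtain as where as: "Polynomial.smult (lead_coeff (of_int_poly p)) (\<Prod>a\<leftarrow>as. [:- a, 1:]) = (of_int_poly p :: complex poly)"
    "length as = degree (of_int_poly p :: complex poly)"
    using fundamental_theorem_algebra_factorized by blast
  define s where "s = \<bar>real_of_int (lead_coeff p)\<bar>"
  have s: "s > 0" using p(1) by (simp add: s_def)
  have len: "length as \<le> N" using as(2) p(2) by simp
  have pas: "of_int_poly p = Polynomial.smult (of_int (lead_coeff p)) (\<Prod>a\<leftarrow>as. [:- a, 1:])"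
    using as(1) by simp
  have set_roots: "poly (of_int_poly p) a = 0" if "a \<in> set as" for a
    unfolding pas using that by (auto simp: poly_prod_list prod_list_zero_iff)
  define B where "B = 8 * real (N + 1)"
  have B: "1 < B" by (simp add: B_def)
  have \<rho>0: "0 < real \<rho>" using \<rho> by simp
  have "\<exists>j c E. (\<Prod>a\<leftarrow>as. [:- a, 1:]) = monom c j + E \<and>
    cmod c = prod_list (map cmod (filter (\<lambda>a. real \<rho> < cmod a) as)) \<and>
    weighted_l1 \<rho> E \<le> ((1 + 1 / B) ^ length as - 1) * (cmod c * real \<rho> ^ j)"
    using roots[OF set_roots] by (intro linear_factors_near_monom \<rho>0 B) (simp add: B_def)
  then obtain j c E where jc: "(\<Prod>a\<leftarrow>as. [:- a, 1:]) = monom c j + E"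
    "cmod c = prod_list (map cmod (filter (\<lambda>a. real \<rho> < cmod a) as))"
    "weighted_l1 \<rho> E \<le> ((1 + 1 / B) ^ length as - 1) * (cmod c * real \<rho> ^ j)" by auto
  define u v where "u = prod_list (map cmod (filter (\<lambda>a. real \<rho> < cmod a) as))"
    and "v = prod_list (map cmod (filter (\<lambda>a. 1 < cmod a) as))"
  have uv: "u \<le> v" "v \<le> u * real \<rho> ^ length as" "0 < u"
    using prod_filter_le[of "real \<rho>" as] \<rho> by (auto simp: u_def v_def)
  have cu: "cmod c = u" using jc(2) by (simp add: u_def)
  have mp: "mahler p = s * v" using mahler_eq[OF p(1) pas] by (simp add: s_def v_def)
  have "(1 + 1 / B) ^ length as \<le> (1 + 1 / B) ^ N" using len B by (intro power_increasing) auto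
  also have "\<dots> \<le> 8 / 7" by (rule one_plus_inverse_power_le) (auto simp: B_def field_simps)
  finally have "((1 + 1 / B) ^ length as - 1) * (u * real \<rho> ^ j) \<le> 1 / 4 * (u * real \<rho> ^ j)"
    using uv(3) \<rho> by (intro mult_right_mono) auto
  then have E: "weighted_l1 \<rho> E \<le> u * real \<rho> ^ j / 4" using jc(3) cu by simp
  have coeff_p: "\<bar>real_of_int (coeff p l)\<bar> = s * cmod (coeff (monom c j + E) l)" for l
  proof -
    have "\<bar>real_of_int (coeff p l)\<bar> = cmod (coeff (of_int_poly p) l)" by simp
    then show ?thesis unfolding pas jc(1) coeff_smult norm_mult by (simp add: s_def)
  qed
  define P where "P = \<bar>real_of_int (coeff p j)\<bar>"
  have E_term: "cmod (coeff E l) * real \<rho> ^ l \<le> weighted_l1 \<rho> E" for l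
  proof (cases "l \<le> degree E")
    case True
    then show ?thesis unfolding weighted_l1_def by (intro member_le_sum) auto
  qed (simp add: weighted_l1_def coeff_eq_0 sum_nonneg)
  have "cmod (coeff E j) * real \<rho> ^ j \<le> (u / 4) * real \<rho> ^ j" using E_term[of j] E by simp
  then have Ej: "cmod (coeff E j) \<le> u / 4" using \<rho>0 by simp
  have "cmod (c + coeff E j) \<le> u + u / 4" "u - u / 4 \<le> cmod (c + coeff E j)"
    using norm_triangle_ineq[of c "coeff E j"] norm_diff_ineq[of c "coeff E j"] Ej cu by linarith+
  then have P: "P \<le> s * (5 / 4 * u)" "s * (3 / 4 * u) \<le> P"
    using s unfolding P_def coeff_p by auto
  have "(\<Sum>l\<in>{..degree p} - {j}. \<bar>real_of_int (coeff p l)\<bar> * real \<rho> ^ l) = s * (\<Sum>l\<in>{..degree p} - {j}. cmod (coeff E l) * real \<rho> ^ l)"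
    unfolding sum_distrib_left coeff_p by (intro sum.cong) auto
  also have "(\<Sum>l\<in>{..degree p} - {j}. cmod (coeff E l) * real \<rho> ^ l) \<le> weighted_l1 \<rho> E"
  proof -
    have "weighted_l1 \<rho> E = (\<Sum>l\<le>max (degree p) (degree E). cmod (coeff E l) * real \<rho> ^ l)"
      by (rule weighted_l1_eq_sum) simp
    then show ?thesis by (auto intro!: sum_mono2)
  qed
  also have "s * weighted_l1 \<rho> E \<le> s * (u * real \<rho> ^ j / 4)" using E s by simp
  also have "\<dots> = (s * (3 / 4 * u)) / 3 * real \<rho> ^ j" by simp
  also have "\<dots> \<le> P / 3 * real \<rho> ^ j" using P(2) by (intro mult_right_mono divide_right_mono) auto
  also have "\<dots> \<le> P * real \<rho> ^ j / 2" by (simp add: P_def)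
  finally have sum_le: "(\<Sum>l\<in>{..degree p} - {j}. \<bar>real_of_int (coeff p l)\<bar> * real \<rho> ^ l) \<le> P * real \<rho> ^ j / 2"
    using s by (simp add: mult_left_mono)
  have "0 < s * (3 / 4 * u)" using s uv(3) by simp
  then have P0: "0 < P" using P(2) by linarith
  have dom: "dominant (of_int_poly p) j \<rho>"
    using sum_le P0 by (auto simp: dominant_def P_def)
  have jN: "j \<le> N" using P0 p(2) le_degree[of p j] by (auto simp: P_def)
  have "mahler p \<le> s * (u * real \<rho> ^ N)"
  proof -
    have "u * real \<rho> ^ length as \<le> u * real \<rho> ^ N" using uv(3) \<rho> len by (intro mult_left_mono power_increasing) auto
    then show ?thesis unfolding mp using uv(2) s by simp
  qed
  also have "\<dots> \<le> 2 * real \<rho> ^ N * P"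
  proof -
    have "s * u \<le> 2 * P" using P(2) P0 by linarith
    then have "s * u * real \<rho> ^ N \<le> 2 * P * real \<rho> ^ N" by (intro mult_right_mono) auto
    then show ?thesis by (simp add: mult_ac)
  qed
  finally have m1: "mahler p \<le> 2 * real \<rho> ^ N * P" .
  have m2: "P \<le> 2 * mahler p"
  proof -
    have "s * u \<le> s * v" using uv(1) s by simp
    moreover have "0 < s * u" using s uv(3) by simp
    ultimately show ?thesis using P(1) unfolding mp by linarith
  qed
  have "real (coeff_l1 p) = (\<Sum>l\<le>degree p. \<bar>real_of_int (coeff p l)\<bar>)"
    by (simp add: coeff_l1_def sum_nonneg)
  also have "\<dots> = P + (\<Sum>l\<in>{..degree p} - {j}. \<bar>real_of_int (coeff p l)\<bar>)"
    using P0 le_degree[of p j] by (subst sum.remove[of _ j]) (auto simp: P_def)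
  also have "(\<Sum>l\<in>{..degree p} - {j}. \<bar>real_of_int (coeff p l)\<bar>) \<le> (\<Sum>l\<in>{..degree p} - {j}. \<bar>real_of_int (coeff p l)\<bar> * real \<rho> ^ l)"
    using \<rho> by (intro sum_mono) (simp add: mult_le_cancel_left1 one_le_power)
  also note sum_le
  also have "P + P * real \<rho> ^ j / 2 \<le> 2 * real \<rho> ^ N * P"
  proof -
    have "1 \<le> real \<rho> ^ N" "real \<rho> ^ j \<le> real \<rho> ^ N" using \<rho> jN by (auto intro: power_increasing)
    then have "P * 1 \<le> P * real \<rho> ^ N" "P * real \<rho> ^ j \<le> P * real \<rho> ^ N" using P0 by (auto intro: mult_left_mono)
    moreover have "0 \<le> P * real \<rho> ^ N" using P0 by simp
    ultimately have "P + P * real \<rho> ^ j / 2 \<le> 2 * (P * real \<rho> ^ N)" by linarith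
    then show ?thesis by (simp add: mult_ac)
  qed
  finally have m3: "real (coeff_l1 p) \<le> 2 * real \<rho> ^ N * P" by simp
  show ?thesis using that[OF dom] m1 m2 m3 by (simp add: P_def)
qed

text \<open>
  Otherwise each of the \<open>N + 1\<close> disjoint annuli would contain a root.
\<close>

lemma root_gap_exists:
  fixes f :: "complex poly" and B :: real
  assumes "f \<noteq> 0" "1 < B" "degree f \<le> N"
  shows "\<exists>t\<le>N. \<forall>a. poly f a = 0 \<longrightarrow> cmod a \<le> B ^ (2 * t) \<or> B ^ (2 * t + 2) \<le> cmod a"
proof (rule ccontr)
  assume no: "\<not> ?thesis"
  have "\<exists>a. poly f a = 0 \<and> B ^ (2 * t) < cmod a \<and> cmod a < B ^ (2 * t + 2)" if "t \<le> N" for t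
    using that no by (meson not_le)
  then obtain r where r: "\<And>t. t \<le> N \<Longrightarrow> poly f (r t) = 0" "\<And>t. t \<le> N \<Longrightarrow> B ^ (2 * t) < cmod (r t)"
    "\<And>t. t \<le> N \<Longrightarrow> cmod (r t) < B ^ (2 * t + 2)"
    by metis
  have less: "cmod (r t) < cmod (r t')" if "t < t'" "t' \<le> N" for t t'
  proof -
    have "B ^ (2 * t + 2) \<le> B ^ (2 * t')" using assms(2) that by (intro power_increasing) auto
    then show ?thesis using r(3)[of t] r(2)[of t'] that by linarith
  qed
  have "inj_on r {..N}"
  proof (rule inj_onI)
    fix x y assume "x \<in> {..N}" "y \<in> {..N}" "r x = r y"
    then show "x = y" using less[of x y] less[of y x] by (cases x y rule: linorder_cases) auto
  qed
  then have "card (r ` {..N}) = Suc N" by (simp add: card_image)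
  moreover have "r ` {..N} \<subseteq> {a. poly f a = 0}" using r(1) by auto
  then have "card (r ` {..N}) \<le> card {a. poly f a = 0}"
    using poly_roots_finite[OF assms(1)] by (rule card_mono[rotated])
  moreover have "card {a. poly f a = 0} \<le> degree f" using assms(1) by (rule card_poly_roots_bound)
  ultimately show False using assms(3) by simp
qed

section \<open>Primitive integer forms and squaring of matrices\<close>

text \<open>
  For monic \<open>f\<close> this determines \<open>P\<close>, and the factor \<open>s\<close> is the minimal one that clears denominators; see
  \<open>primitive_form_scaling\<close>. In contrast to minimality, this description is visibly multiplicative.
\<close>

definition primitive_form :: "int poly \<Rightarrow> rat poly \<Rightarrow> bool" where
  "primitive_form P f \<longleftrightarrow> content P = 1 \<and> (\<exists>s::nat. 0 < s \<and> of_int_poly P = [:of_nat s:] * f)"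

lemma primitive_form_exists:
  assumes "lead_coeff f = 1"
  shows "\<exists>P. primitive_form P f"
proof -
  have f: "f \<noteq> 0" using assms by auto
  obtain d q where dq: "rat_to_normalized_int_poly f = (d, q)" by fastforce
  have d: "0 < d" "f = Polynomial.smult d (of_int_poly q)" "content q = 1"
    using rat_to_normalized_int_poly[OF dq] f by auto
  then have "d * of_int (lead_coeff q) = 1" using assms by simp
  then have l: "rat_of_int (lead_coeff q) = 1 / d" using d(1) by (simp add: field_simps)
  then have "0 < rat_of_int (lead_coeff q)" using d(1) by simp
  then have l0: "0 < lead_coeff q" by simp
  have "of_int_poly q = [:of_nat (nat (lead_coeff q)):] * f"
    using d l l0 by simp
  then show ?thesis using d(3) l0 unfolding primitive_form_def by (intro exI[of _ q] conjI exI[of _ "nat (lead_coeff q)"]) auto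
qed

lemma primitive_form_nonzero: "primitive_form P f \<Longrightarrow> P \<noteq> 0"
  by (auto simp: primitive_form_def)

lemma primitive_form_mult:
  assumes "primitive_form P f" "primitive_form Q g"
  shows "primitive_form (P * Q) (f * g)"
proof -
  obtain s t where st: "(0::nat) < s" "(0::nat) < t" "of_int_poly P = [:of_nat s:] * f" "of_int_poly Q = [:of_nat t:] * g"
    using assms by (auto simp: primitive_form_def)
  then have "of_int_poly (P * Q) = [:of_nat (s * t):] * (f * g)"
    by (simp add: of_int_poly_hom.hom_mult mult.commute)
  moreover have "content (P * Q) = 1" using assms by (simp add: primitive_form_def content_mult)
  ultimately show ?thesis using st(1,2) unfolding primitive_form_def by (metis nat_0_less_mult_iff)
qed

lemma primitive_form_prod:
  "(\<And>k. k < (n::nat) \<Longrightarrow> primitive_form (P k) (f k)) \<Longrightarrow> primitive_form (\<Prod>k<n. P k) (\<Prod>k<n. f k)"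
proof (induction n)
  case 0
  show ?case unfolding primitive_form_def by (auto intro!: exI[of _ 1])
qed (simp add: primitive_form_mult)

text \<open>
  If \<open>t f\<close> is integral, then \<open>t P = s (t f)\<close>, and comparing contents shows that \<open>s\<close> divides \<open>t\<close>.
\<close>

lemma primitive_form_scaling:
  assumes "content P = 1" "0 < s" "of_int_poly P = [:of_nat s:] * f"
  shows "integral_scaling f = s"
  unfolding integral_scaling_def
proof (rule Least_equality)
  have "coeff (Polynomial.smult (of_nat s) f) i = of_int (coeff P i)" for i
    using arg_cong[OF assms(3), of "\<lambda>p. coeff p i"] by simp
  then show "0 < s \<and> (\<forall>i. coeff (Polynomial.smult (of_nat s) f) i \<in> \<int>)"
    using assms(2) by (metis Ints_of_int)
next
  fix t assume t: "0 < t \<and> (\<forall>i. coeff (Polynomial.smult (of_nat t) f) i \<in> \<int>)"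
  define Q where "Q = map_poly floor (Polynomial.smult (of_nat t) f)"
  have Q: "of_int_poly Q = Polynomial.smult (of_nat t) f"
  proof (rule poly_eqI)
    fix i show "coeff (of_int_poly Q) i = coeff (Polynomial.smult (of_nat t) f) i"
      using t by (simp add: Q_def coeff_map_poly del: coeff_smult)
  qed
  have "of_int_poly (Polynomial.smult (int t) P) = (of_int_poly (Polynomial.smult (int s) Q) :: rat poly)"
    using Q assms(3) by (simp add: of_int_hom.map_poly_hom_smult mult.commute)
  then have "Polynomial.smult (int t) P = Polynomial.smult (int s) Q"
    by (simp only: of_int_poly_hom.eq_iff)
  then have "content (Polynomial.smult (int t) P) = content (Polynomial.smult (int s) Q)" by simp
  then have "int t = int s * content Q" using assms(1) by (simp add: content_smult)
  then have "int s dvd int t" by simp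
  then show "s \<le> t" using t by (simp add: dvd_imp_le)
qed

lemma primitive_form_eq:
  assumes "primitive_form P f"
  shows "of_int_poly P = Polynomial.smult (of_nat (integral_scaling f)) f"
proof -
  obtain s where s: "0 < s" "of_int_poly P = [:of_nat s:] * f" "content P = 1"
    using assms by (auto simp: primitive_form_def)
  then have "integral_scaling f = s" by (intro primitive_form_scaling)
  then show ?thesis using s(2) by simp
qed

lemma primitive_form_unique: "primitive_form P f \<Longrightarrow> primitive_form Q f \<Longrightarrow> P = Q"
  using primitive_form_eq by (metis of_int_poly_hom.eq_iff)

lemma mahler_pos: "0 < mahler p"
  by (simp add: mahler_def)

lemma mahler_1: "mahler 1 = 1"
  by (simp add: mahler_def log_mahler_measure_def)

lemma mahler_mult:
  assumes "p \<noteq> 0" "q \<noteq> 0"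
  shows "mahler (p * q) = mahler p * mahler q"
proof -
  have nz: "(of_int_poly p :: complex poly) \<noteq> 0" "(of_int_poly q :: complex poly) \<noteq> 0" using assms by auto
  have "log_mahler_measure (of_int_poly (p * q)) = log_mahler_measure (of_int_poly p) + log_mahler_measure (of_int_poly q)"
    unfolding log_mahler_measure_def of_int_poly_hom.hom_mult lead_coeff_mult proots_mult[OF nz]
    using assms by (simp add: norm_mult ln_mult)
  then show ?thesis by (simp add: mahler_def exp_add)
qed

lemma mahler_prod:
  "(\<And>k. k < (n::nat) \<Longrightarrow> p k \<noteq> 0) \<Longrightarrow> mahler (\<Prod>k<n. p k) = (\<Prod>k<n. mahler (p k))"
  by (induction n) (simp_all add: mahler_1 mahler_mult)

lemma char_poly_matrix_index:
  assumes "M \<in> carrier_mat N N" "i < N" "k < N"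
  shows "char_poly_matrix M $$ (i, k) = (if k = i then [:0, 1:] else 0) - [:M $$ (i, k):]"
  using assms by (auto simp: char_poly_matrix_def)

lemma sum_delta_mult:
  assumes "i < (N::nat)"
  shows "(\<Sum>k<N. (if k = i then x else 0) * y k) = x * (y i :: 'a :: comm_ring_1)"
proof -
  have "(\<Sum>k<N. (if k = i then x else 0) * y k) = (\<Sum>k<N. if k = i then x * y k else 0)"
    by (intro sum.cong) auto
  then show ?thesis using assms by simp
qed

text \<open>
  From \<open>X\<^sup>2 - M\<^sup>2 = (X - M) (X + M)\<close>, where \<open>A\<close> below is \<open>X + M\<close>.
\<close>

lemma char_poly_square:
  fixes M :: "rat mat"
  assumes M: "M \<in> carrier_mat N N"
  shows "pcompose (char_poly (M * M)) [:0, 0, 1:] = (- 1) ^ N * char_poly M * pcompose (char_poly M) [:0, - 1:]"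
proof -
  have hom: "comm_ring_hom (\<lambda>p :: rat poly. pcompose p r)" for r
    by standard (simp_all add: pcompose_add pcompose_mult pcompose_1)
  have minus_one: "[:- 1 :: rat:] = - 1" by (simp only: one_pCons minus_pCons minus_zero)
  have carr: "char_poly_matrix M \<in> carrier_mat N N" "char_poly_matrix (M * M) \<in> carrier_mat N N"
    using M by auto
  define A where "A = mat N N (\<lambda>(i, k). (if k = i then [:0, 1:] else 0) + [:M $$ (i, k):])"
  have A: "A \<in> carrier_mat N N" by (simp add: A_def)
  have "map_mat (\<lambda>p. pcompose p [:0, - 1:]) (char_poly_matrix M) = (- 1) \<cdot>\<^sub>m A"
  proof (rule eq_matI)
    fix i k assume "i < dim_row ((- 1) \<cdot>\<^sub>m A)" "k < dim_col ((- 1) \<cdot>\<^sub>m A)"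
    then have ik: "i < N" "k < N" by (auto simp: A_def)
    then show "map_mat (\<lambda>p. pcompose p [:0, - 1:]) (char_poly_matrix M) $$ (i, k) = ((- 1) \<cdot>\<^sub>m A) $$ (i, k)"
      using carrier_matD[OF carr(1)] by (simp add: A_def char_poly_matrix_index[OF M] pcompose_diff pcompose_pCons minus_one)
  qed (use carrier_matD[OF carr(1)] in \<open>auto simp: A_def\<close>)
  then have "pcompose (char_poly M) [:0, - 1:] = det ((- 1) \<cdot>\<^sub>m A)"
    using comm_ring_hom.hom_det[OF hom, of "[:0, - 1:]" "char_poly_matrix M"] by (simp add: char_poly_def)
  then have neg: "pcompose (char_poly M) [:0, - 1:] = (- 1) ^ N * det A"
    using A by simp
  have "map_mat (\<lambda>p. pcompose p [:0, 0, 1:]) (char_poly_matrix (M * M)) = char_poly_matrix M * A"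
  proof (rule eq_matI)
    fix i k assume "i < dim_row (char_poly_matrix M * A)" "k < dim_col (char_poly_matrix M * A)"
    then have ik: "i < N" "k < N" using carrier_matD[OF carr(1)] by (auto simp: A_def)
    let ?X = "[:0, 1:] :: rat poly"
    have "(char_poly_matrix M * A) $$ (i, k) =
       (\<Sum>l<N. ((if l = i then ?X else 0) - [:M $$ (i, l):]) * ((if l = k then ?X else 0) + [:M $$ (l, k):]))"
      using ik carrier_matD[OF carr(1)]
      by (auto simp: A_def scalar_prod_def atLeast0LessThan char_poly_matrix_index[OF M] intro!: sum.cong)
    also have "\<dots> = (\<Sum>l<N. (if l = i then ?X else 0) * ((if l = k then ?X else 0) + [:M $$ (l, k):]))
        - (\<Sum>l<N. (if l = k then ?X else 0) * [:M $$ (i, l):]) - (\<Sum>l<N. [:M $$ (i, l):] * [:M $$ (l, k):])"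
      by (simp only: left_diff_distrib distrib_left sum_subtractf sum.distrib diff_diff_eq mult.commute[of "[:M $$ (i, _):]" "if _ then _ else _"])
    also have "\<dots> = ?X * ((if i = k then ?X else 0) + [:M $$ (i, k):]) - ?X * [:M $$ (i, k):] - [:\<Sum>l<N. M $$ (i, l) * M $$ (l, k):]"
    proof -
      have "(\<Sum>l<N. [:M $$ (i, l):] * [:M $$ (l, k):]) = [:\<Sum>l<N. M $$ (i, l) * M $$ (l, k):]"
        by (induction N) simp_all
      then show ?thesis using ik by (simp only: sum_delta_mult)
    qed
    also have "\<dots> = (if k = i then [:0, 0, 1:] else 0) - [:(M * M) $$ (i, k):]"
      using M ik by (simp add: scalar_prod_def atLeast0LessThan)
    also have "\<dots> = map_mat (\<lambda>p. pcompose p [:0, 0, 1:]) (char_poly_matrix (M * M)) $$ (i, k)"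
      using ik carrier_matD[OF carr(2)] M by (simp add: char_poly_matrix_index[of "M * M" N] pcompose_diff pcompose_pCons del: index_mult_mat)
    finally show "map_mat (\<lambda>p. pcompose p [:0, 0, 1:]) (char_poly_matrix (M * M)) $$ (i, k) = (char_poly_matrix M * A) $$ (i, k)" ..
  qed (use carrier_matD[OF carr(1)] carrier_matD[OF carr(2)] in \<open>auto simp: A_def\<close>)
  then have "pcompose (char_poly (M * M)) [:0, 0, 1:] = det (char_poly_matrix M * A)"
    using comm_ring_hom.hom_det[OF hom, of "[:0, 0, 1:]" "char_poly_matrix (M * M)"] by (simp add: char_poly_def)
  also have "\<dots> = char_poly M * det A" using det_mult[OF carr(1) A] by (simp add: char_poly_def)
  also have "\<dots> = (- 1) ^ N * char_poly M * pcompose (char_poly M) [:0, - 1:]"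
    unfolding neg by (simp add: algebra_simps flip: power_mult_distrib)
  finally show ?thesis .
qed

lemma coeff_pcompose_square: "coeff (pcompose q [:0, 0, 1:]) (2 * i) = coeff (q :: 'a :: comm_ring_1 poly) i"
proof (induction q arbitrary: i)
  case (pCons a q)
  show ?case using pCons.IH by (cases i) (simp_all add: pcompose_pCons coeff_pCons)
qed simp

lemma content_pcompose_neg:
  assumes "content (P :: int poly) = 1"
  shows "content (pcompose P [:0, - 1:]) = 1"
proof -
  let ?d = "content (pcompose P [:0, - 1:])"
  have inv: "pcompose (pcompose P [:0, - 1:]) [:0, - 1:] = P"
  proof -
    have "pcompose [:0, - 1:] [:0, - 1:] = [:0, 1 :: int:]" by (simp add: pcompose_pCons)
    then show ?thesis unfolding pcompose_assoc[symmetric] by (simp only: pcompose_idR)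
  qed
  have "[:?d:] dvd pcompose P [:0, - 1:]" by (simp add: const_poly_dvd_iff_dvd_content)
  then obtain R where "pcompose P [:0, - 1:] = [:?d:] * R" by (rule dvdE)
  then have "P = [:?d:] * pcompose R [:0, - 1:]"
    using inv by (metis pcompose_const pcompose_mult)
  then have "[:?d:] dvd P" by (metis dvd_triv_left)
  then have "?d dvd 1" using assms by (simp add: const_poly_dvd_iff_dvd_content)
  then show ?thesis by (simp add: is_unit_content_iff)
qed

lemma content_pcompose_square:
  assumes "content (P :: int poly) = 1"
  shows "content (pcompose P [:0, 0, 1:]) = 1"
proof -
  let ?d = "content (pcompose P [:0, 0, 1:])"
  have "?d dvd coeff P i" for i
    using content_dvd_coeff[of "pcompose P [:0, 0, 1:]" "2 * i"] unfolding coeff_pcompose_square .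
  then have "[:?d:] dvd P" by (simp add: const_poly_dvd_iff)
  then have "?d dvd 1" using assms by (simp add: const_poly_dvd_iff_dvd_content)
  then show ?thesis by (simp add: is_unit_content_iff)
qed

lemma pcompose_square_inj:
  assumes "pcompose p [:0, 0, 1:] = pcompose q [:0, 0, 1:]"
  shows "p = (q :: 'a :: comm_ring_1 poly)"
  using assms coeff_pcompose_square by (metis poly_eqI)

lemma pcompose_prod_list:
  "pcompose (prod_list ps) r = (\<Prod>p\<leftarrow>ps. pcompose p (r :: 'a :: comm_ring_1 poly))"
  by (induction ps) (simp_all add: pcompose_mult pcompose_1)

lemma of_int_poly_pcompose:
  "of_int_poly (pcompose P R) = pcompose (of_int_poly P) (of_int_poly R :: 'a :: {comm_ring_1, ring_char_0} poly)"
  by (rule of_int_hom.map_poly_pcompose)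

text \<open>
  Over the integers, \<open>char_poly_square\<close> becomes \<open>Q(X\<^sup>2) = (-1)\<^sup>N P(X) P(-X)\<close>: both sides are primitive by Gauss's lemma,
  which forces the scaling factor of \<open>M\<^sup>2\<close> to be the square of the one of \<open>M\<close>. Over the complex numbers the same
  identity shows that the roots are squared.
\<close>

lemma mahler_square:
  assumes M: "M \<in> carrier_mat N N"
    and P: "primitive_form P (char_poly M)" and Q: "primitive_form Q (char_poly (M * M))"
  shows "mahler Q = mahler P ^ 2"
proof -
  let ?sq = "\<lambda>p. pcompose p [:0, 0, 1:]" and ?neg = "\<lambda>p. pcompose p [:0, - 1:]"
  define f where "f = char_poly M"
  define f2 where "f2 = char_poly (M * M)"
  have monic: "lead_coeff f = 1" "lead_coeff f2 = 1" "degree f = N"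
    using degree_monic_char_poly[OF M] degree_monic_char_poly[of "M * M" N] M by (auto simp: f_def f2_def)
  obtain s where s: "0 < s" "of_int_poly P = [:of_nat s:] * f" "content P = 1"
    using P by (auto simp: primitive_form_def f_def)
  obtain t where t: "0 < t" "of_int_poly Q = [:of_nat t:] * f2" "content Q = 1"
    using Q by (auto simp: primitive_form_def f2_def)
  have lP: "lead_coeff P = int s"
  proof -
    have "rat_of_int (lead_coeff P) = lead_coeff (of_int_poly P)" by simp
    also have "\<dots> = of_int (int s)" unfolding s(2) using monic by simp
    finally show ?thesis by (simp only: of_int_eq_iff)
  qed
  have lQ: "lead_coeff Q = int t"
  proof -
    have "rat_of_int (lead_coeff Q) = lead_coeff (of_int_poly Q)" by simp
    also have "\<dots> = of_int (int t)" unfolding t(2) using monic by simp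
    finally show ?thesis by (simp only: of_int_eq_iff)
  qed
  have dP: "degree P = N"
  proof -
    have "degree P = degree (of_int_poly P :: rat poly)" by simp
    also have "\<dots> = N" unfolding s(2) using s(1) monic by simp
    finally show ?thesis .
  qed
  have sq: "?sq f2 = (- 1) ^ N * f * ?neg f"
    unfolding f_def f2_def by (rule char_poly_square[OF M])
  have "of_int_poly ([:int s ^ 2:] * ?sq Q) = (of_int_poly ([:int t:] * ((- 1) ^ N * (P * ?neg P))) :: rat poly)"
  proof -
    have "of_int_poly (?neg P) = [:of_nat s:] * ?neg f"
      by (simp add: of_int_poly_pcompose s(2) pcompose_smult)
    moreover have "of_int_poly (?sq Q) = [:of_nat t:] * ?sq f2"
      by (simp add: of_int_poly_pcompose t(2) pcompose_smult)
    moreover have "of_int_poly ([:c:] * p) = [:of_int c:] * (of_int_poly p :: rat poly)" for c p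
      by (simp add: of_int_hom.map_poly_hom_smult)
    ultimately show ?thesis
      using sq by (simp add: of_int_poly_hom.hom_mult s(2) of_int_poly_hom.hom_power of_int_poly_hom.hom_uminus power2_eq_square mult_ac)
  qed
  then have eq: "[:int s ^ 2:] * ?sq Q = [:int t:] * ((- 1) ^ N * (P * ?neg P))"
    by (simp only: of_int_poly_hom.eq_iff)
  have cm: "content ((- 1) ^ N * p) = content p" for p :: "int poly"
    using content_smult[of "- 1" p] by (cases "even N") simp_all
  \<comment> \<open>comparing contents in the identity above gives the relation between the scaling factors\<close>
  have c1: "content ([:int s ^ 2:] * ?sq Q) = int s ^ 2"
    using content_pcompose_square[OF t(3)] by (simp add: content_smult)
  have c2: "content ([:int t:] * ((- 1) ^ N * (P * ?neg P))) = int t"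
    using content_pcompose_neg[OF s(3)] s(3) cm[of 1] by (simp add: content_smult content_mult)
  have "int s ^ 2 = int t" using arg_cong[OF eq, of content] unfolding c1 c2 .
  then have "int t = int (s ^ 2)" by simp
  then have st: "t = s ^ 2" by (simp only: of_nat_eq_iff)
  have QP: "?sq Q = (- 1) ^ N * (P * ?neg P)"
  proof -
    have "[:int t:] * ?sq Q = [:int t:] * ((- 1) ^ N * (P * ?neg P))"
      using eq \<open>int s ^ 2 = int t\<close> by simp
    moreover have "[:int t:] \<noteq> 0" using t(1) by simp
    ultimately show ?thesis using mult_cancel_left by blast
  qed
  have P0: "P \<noteq> 0" and Q0: "Q \<noteq> 0" using s(3) t(3) by auto
  obtain as where as: "Polynomial.smult (lead_coeff (of_int_poly P)) (\<Prod>a\<leftarrow>as. [:- a, 1:]) = (of_int_poly P :: complex poly)"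
    "length as = degree (of_int_poly P :: complex poly)"
    using fundamental_theorem_algebra_factorized by blast
  have len: "length as = N" using as(2) dP by simp
  have Pc: "of_int_poly P = Polynomial.smult (of_int (lead_coeff P)) (\<Prod>a\<leftarrow>as. [:- a, 1:])"
    using as(1) by simp
  have prods: "(- 1) ^ length as * (\<Prod>a\<leftarrow>as. [:- a, 1:]) * (\<Prod>a\<leftarrow>as. [:- a, - 1:]) = (\<Prod>a\<leftarrow>as. [:- (a ^ 2), 0, 1:])" for as :: "complex list"
  proof (induction as)
    case (Cons a as)
    have "(- 1) ^ length (a # as) * (\<Prod>a\<leftarrow>(a # as). [:- a, 1:]) * (\<Prod>a\<leftarrow>(a # as). [:- a, - 1:])
      = (- ([:- a, 1:] * [:- a, - 1:])) * ((- 1) ^ length as * (\<Prod>a\<leftarrow>as. [:- a, 1:]) * (\<Prod>a\<leftarrow>as. [:- a, - 1:]))"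
      by (simp only: list.map prod_list.Cons list.size power_Suc add_Suc_right add_0_right mult_minus_left mult_minus_right mult_1 minus_minus mult_ac)
    also have "- ([:- a, 1:] * [:- a, - 1:]) = [:- (a ^ 2), 0, 1:]"
      by (simp add: power2_eq_square)
    finally show ?case unfolding Cons.IH by simp
  qed simp
  have "?sq (of_int_poly Q) = ?sq (Polynomial.smult (of_int (lead_coeff Q)) (\<Prod>a\<leftarrow>map (\<lambda>a. a ^ 2) as. [:- a, 1:]) :: complex poly)"
  proof -
    have e: "of_int_poly [:0, 0, 1:] = [:0, 0, 1 :: complex:]" "of_int_poly [:0, - 1:] = [:0, - 1 :: complex:]" by simp_all
    have "?sq (of_int_poly Q :: complex poly) = of_int_poly (?sq Q)" unfolding of_int_poly_pcompose e by (rule refl)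
    also have "\<dots> = (- 1) ^ N * (of_int_poly P * ?neg (of_int_poly P))"
      unfolding QP of_int_poly_hom.hom_mult of_int_poly_pcompose e
      by (simp add: of_int_poly_hom.hom_power of_int_poly_hom.hom_uminus)
    also have "?neg (of_int_poly P) = Polynomial.smult (of_int (lead_coeff P)) (\<Prod>a\<leftarrow>as. [:- a, - 1:])"
      unfolding Pc pcompose_smult pcompose_prod_list by (simp add: o_def pcompose_pCons)
    also have "(- 1) ^ N * (of_int_poly P * \<dots>) = Polynomial.smult (of_int (lead_coeff P) ^ 2) ((- 1) ^ length as * (\<Prod>a\<leftarrow>as. [:- a, 1:]) * (\<Prod>a\<leftarrow>as. [:- a, - 1:]))"
      unfolding Pc len by (simp add: power2_eq_square mult_ac)
    also have "\<dots> = Polynomial.smult (of_int (lead_coeff Q)) (\<Prod>a\<leftarrow>as. [:- (a ^ 2), 0, 1:])"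
      unfolding prods lP lQ st by simp
    also have "\<dots> = ?sq (Polynomial.smult (of_int (lead_coeff Q)) (\<Prod>a\<leftarrow>map (\<lambda>a. a ^ 2) as. [:- a, 1:]))"
      unfolding pcompose_smult pcompose_prod_list by (simp add: o_def pcompose_pCons)
    finally show ?thesis .
  qed
  then have Qc: "of_int_poly Q = Polynomial.smult (of_int (lead_coeff Q)) (\<Prod>a\<leftarrow>map (\<lambda>a. a ^ 2) as. [:- a, 1:] :: complex poly)"
    by (rule pcompose_square_inj)
  have "prod_list (map cmod (filter (\<lambda>a. 1 < cmod a) (map (\<lambda>a. a ^ 2) as))) = prod_list (map cmod (filter (\<lambda>a. 1 < cmod a) as)) ^ 2" for as
  proof (induction as)
    case (Cons a as)
    have "1 < cmod (a ^ 2) \<longleftrightarrow> 1 < cmod a"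
      using one_less_power[of "cmod a" 2] power_le_one[of "cmod a" 2] by (auto simp: norm_power not_le[symmetric])
    then show ?case using Cons by (simp add: norm_power power_mult_distrib)
  qed simp
  then show ?thesis
    unfolding mahler_eq[OF P0 Pc] mahler_eq[OF Q0 Qc] lP lQ st by (simp add: power_mult_distrib)
qed

section \<open>Exponential growth of trajectories and squaring of endomorphisms\<close>

text \<open>
  Explicit exponential bounds on trajectories, valid for all \<open>n\<close>. They replace upper limits in all
  arguments about iterates.
\<close>

definition grows_at_least :: "('a, 'b) monoid_scheme \<Rightarrow> ('a \<Rightarrow> 'a) \<Rightarrow> real \<Rightarrow> bool" where
  "grows_at_least G \<phi> c \<longleftrightarrow> (\<exists>F \<delta>. finite F \<and> F \<subseteq> carrier G \<and> \<one>\<^bsub>G\<^esub> \<in> F \<and> 0 < \<delta> \<and>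
     (\<forall>n. \<delta> * c ^ n \<le> card (trajectory G \<phi> F n)))"

definition grows_at_most :: "('a, 'b) monoid_scheme \<Rightarrow> ('a \<Rightarrow> 'a) \<Rightarrow> real \<Rightarrow> bool" where
  "grows_at_most G \<phi> c \<longleftrightarrow> (\<forall>F. finite F \<longrightarrow> F \<subseteq> carrier G \<longrightarrow> \<one>\<^bsub>G\<^esub> \<in> F \<longrightarrow>
     (\<exists>C. \<forall>n. real (card (trajectory G \<phi> F n)) \<le> C * c ^ n))"

lemma funpow_hom: "group G \<Longrightarrow> \<phi> \<in> hom G G \<Longrightarrow> (\<phi> ^^ n) \<in> hom G G"
proof (induction n)
  case 0
  then show ?case by (auto simp: hom_def id_def)
next
  case (Suc n)
  then show ?case by (auto simp: hom_def Pi_iff)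
qed

lemma hom_image_closed: "\<phi> \<in> hom G G \<Longrightarrow> F \<subseteq> carrier G \<Longrightarrow> \<phi> ` F \<subseteq> carrier G"
  by (auto simp: hom_def)

lemma hom_image_set_mult:
  assumes "\<phi> \<in> hom G G" "A \<subseteq> carrier G" "B \<subseteq> carrier G"
  shows "\<phi> ` (A <#>\<^bsub>G\<^esub> B) = \<phi> ` A <#>\<^bsub>G\<^esub> \<phi> ` B"
proof -
  have "\<phi> (a \<otimes>\<^bsub>G\<^esub> b) = \<phi> a \<otimes>\<^bsub>G\<^esub> \<phi> b" if "a \<in> A" "b \<in> B" for a b
    using assms that by (intro hom_mult) auto
  then show ?thesis unfolding set_mult_def by (auto simp: image_iff) metis+
qed

lemma trajectory_subset:
  assumes "group G" "\<phi> \<in> hom G G" "F \<subseteq> carrier G"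
  shows "trajectory G \<phi> F n \<subseteq> carrier G"
proof (induction n)
  case 0
  then show ?case using assms(1) by (simp add: group.is_monoid monoid.one_closed)
next
  case (Suc n)
  have "(\<phi> ^^ n) ` F \<subseteq> carrier G"
    using hom_image_closed[OF funpow_hom[OF assms(1,2)] assms(3)] .
  then show ?case using Suc assms(1) by (simp add: group.is_group monoid.set_mult_closed group.is_monoid)
qed

lemma finite_trajectory: "finite F \<Longrightarrow> finite (trajectory G \<phi> F n)"
  by (induction n) (auto simp: set_mult_def)

lemma one_in_trajectory:
  assumes "group G" "\<phi> \<in> hom G G" "\<one>\<^bsub>G\<^esub> \<in> F"
  shows "\<one>\<^bsub>G\<^esub> \<in> trajectory G \<phi> F n" "trajectory G \<phi> F n \<subseteq> carrier G \<Longrightarrow> trajectory G \<phi> F n \<subseteq> trajectory G \<phi> F (Suc n)"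
proof -
  interpret group G by fact
  have one: "\<one>\<^bsub>G\<^esub> \<in> (\<phi> ^^ n) ` F" for n
    using hom_one[OF funpow_hom[OF assms(1,2)] assms(1,1), of n] assms(3) by force
  show "\<one>\<^bsub>G\<^esub> \<in> trajectory G \<phi> F n"
  proof (induction n)
    case (Suc n)
    have "\<one>\<^bsub>G\<^esub> = \<one>\<^bsub>G\<^esub> \<otimes>\<^bsub>G\<^esub> \<one>\<^bsub>G\<^esub>" by simp
    then show ?case using Suc one[of n] unfolding trajectory.simps set_mult_def by blast
  qed simp
  assume carr: "trajectory G \<phi> F n \<subseteq> carrier G"
  show "trajectory G \<phi> F n \<subseteq> trajectory G \<phi> F (Suc n)"
  proof
    fix x assume x: "x \<in> trajectory G \<phi> F n"
    then have "x = x \<otimes>\<^bsub>G\<^esub> \<one>\<^bsub>G\<^esub>" using carr by auto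
    then show "x \<in> trajectory G \<phi> F (Suc n)" using x one[of n] unfolding trajectory.simps set_mult_def by blast
  qed
qed

lemma trajectory_mono:
  assumes "group G" "\<phi> \<in> hom G G" "F \<subseteq> carrier G" "\<one>\<^bsub>G\<^esub> \<in> F" "m \<le> n"
  shows "trajectory G \<phi> F m \<subseteq> trajectory G \<phi> F n"
  using assms(5)
proof (induction n rule: dec_induct)
  case (step n)
  then show ?case
    using one_in_trajectory(2)[OF assms(1,2,4) trajectory_subset[OF assms(1-3)], of n] by blast
qed simp

lemma card_trajectory_mono:
  assumes "group G" "\<phi> \<in> hom G G" "finite F" "F \<subseteq> carrier G" "\<one>\<^bsub>G\<^esub> \<in> F" "m \<le> n"
  shows "card (trajectory G \<phi> F m) \<le> card (trajectory G \<phi> F n)"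
  using trajectory_mono[OF assms(1,2,4,5,6)] finite_trajectory[OF assms(3)] by (intro card_mono)

lemma funpow_comp_self: "(\<phi> \<circ> \<phi>) ^^ n = \<phi> ^^ (2 * n)"
  by (induction n) (simp_all add: comp_assoc)

text \<open>
  Even and odd powers of \<open>\<phi>\<close> are collected in pairs. Together with \<open>trajectory_square_subset\<close> this says that the entropy
  of \<open>\<phi> \<circ> \<phi>\<close> is twice the one of \<open>\<phi>\<close>.
\<close>

lemma trajectory_double:
  assumes "group G" "\<phi> \<in> hom G G" "F \<subseteq> carrier G"
  shows "trajectory G \<phi> F (2 * n) = trajectory G (\<phi> \<circ> \<phi>) (F <#>\<^bsub>G\<^esub> \<phi> ` F) n"
proof (induction n)
  case (Suc n)
  let ?T = "trajectory G \<phi> F (2 * n)" and ?A = "(\<phi> ^^ (2 * n)) ` F" and ?B = "(\<phi> ^^ Suc (2 * n)) ` F"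
  interpret group G by fact
  have h: "(\<phi> ^^ k) \<in> hom G G" for k by (rule funpow_hom[OF assms(1,2)])
  have "trajectory G \<phi> F (2 * Suc n) = (?T <#>\<^bsub>G\<^esub> ?A) <#>\<^bsub>G\<^esub> ?B" by simp
  also have "\<dots> = ?T <#>\<^bsub>G\<^esub> (?A <#>\<^bsub>G\<^esub> ?B)"
    by (intro set_mult_assoc trajectory_subset assms hom_image_closed[OF h])
  also have "?B = (\<phi> ^^ (2 * n)) ` (\<phi> ` F)"
    by (simp only: image_comp funpow_Suc_right)
  also have "?A <#>\<^bsub>G\<^esub> (\<phi> ^^ (2 * n)) ` (\<phi> ` F) = (\<phi> ^^ (2 * n)) ` (F <#>\<^bsub>G\<^esub> \<phi> ` F)"
    by (rule hom_image_set_mult[symmetric]) (intro h assms hom_image_closed)+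
  finally show ?case by (simp only: Suc.IH trajectory.simps funpow_comp_self)
qed simp

lemma trajectory_square_subset:
  assumes "group G" "\<phi> \<in> hom G G" "F \<subseteq> carrier G" "\<one>\<^bsub>G\<^esub> \<in> F"
  shows "trajectory G (\<phi> \<circ> \<phi>) F n \<subseteq> trajectory G \<phi> F (2 * n)"
proof (induction n)
  case (Suc n)
  have "trajectory G (\<phi> \<circ> \<phi>) F (Suc n) \<subseteq> trajectory G \<phi> F (2 * n) <#>\<^bsub>G\<^esub> (\<phi> ^^ (2 * n)) ` F"
    using Suc unfolding trajectory.simps funpow_comp_self set_mult_def by blast
  also have "\<dots> = trajectory G \<phi> F (Suc (2 * n))" by simp
  also have "\<dots> \<subseteq> trajectory G \<phi> F (2 * Suc n)"
    by (rule trajectory_mono[OF assms]) simp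
  finally show ?case .
qed simp

text \<open>
  The price of rounding \<open>n\<close> to an even number: a constant factor.
\<close>

lemma sqrt_power_div2:
  assumes "0 < c"
  shows "sqrt c ^ n \<le> max 1 (sqrt c) * c ^ (n div 2)" "c ^ Suc (n div 2) \<le> max 1 (sqrt c) ^ 2 * sqrt c ^ n"
proof -
  define k where "k = n mod 2"
  have n: "n = 2 * (n div 2) + k" by (simp add: k_def)
  have k: "k = 0 \<or> k = 1" by (auto simp: k_def)
  have sq: "sqrt c ^ n = c ^ (n div 2) * sqrt c ^ k"
    using assms by (subst n) (simp add: power_add power_mult)
  have p: "0 < c ^ (n div 2)" using assms by simp
  have "sqrt c ^ k \<le> max 1 (sqrt c)" using k by auto
  then show "sqrt c ^ n \<le> max 1 (sqrt c) * c ^ (n div 2)"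
    unfolding sq using p by (simp add: mult.commute)
  have "c \<le> max 1 (sqrt c) ^ 2 * sqrt c ^ k"
    using k
  proof
    assume "k = 0"
    have "c = sqrt c ^ 2" using assms by simp
    also have "\<dots> \<le> max 1 (sqrt c) ^ 2" using assms by (intro power_mono) auto
    finally show ?thesis using \<open>k = 0\<close> by simp
  next
    assume "k = 1"
    have "c = sqrt c * sqrt c" using assms by simp
    also have "\<dots> \<le> max 1 (sqrt c) ^ 2 * sqrt c"
    proof (rule mult_right_mono)
      have "sqrt c \<le> max 1 (sqrt c)" by simp
      also have "\<dots> = max 1 (sqrt c) * 1" by simp
      also have "\<dots> \<le> max 1 (sqrt c) * max 1 (sqrt c)" by (rule mult_left_mono) auto
      finally show "sqrt c \<le> max 1 (sqrt c) ^ 2" by (simp add: power2_eq_square)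
    qed (use assms in simp)
    finally show ?thesis using \<open>k = 1\<close> by simp
  qed
  then have "c * c ^ (n div 2) \<le> max 1 (sqrt c) ^ 2 * sqrt c ^ k * c ^ (n div 2)"
    using p by (intro mult_right_mono) auto
  then show "c ^ Suc (n div 2) \<le> max 1 (sqrt c) ^ 2 * sqrt c ^ n"
    unfolding sq by (simp add: mult_ac)
qed

lemma grows_at_least_sqrt:
  assumes "group G" "\<phi> \<in> hom G G" "0 < c" "grows_at_least G (\<phi> \<circ> \<phi>) c"
  shows "grows_at_least G \<phi> (sqrt c)"
proof -
  obtain F \<delta> where F: "finite F" "F \<subseteq> carrier G" "\<one>\<^bsub>G\<^esub> \<in> F" "0 < \<delta>"
    "\<And>n. \<delta> * c ^ n \<le> card (trajectory G (\<phi> \<circ> \<phi>) F n)"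
    using assms(4) by (auto simp: grows_at_least_def)
  define K where "K = max 1 (sqrt c)"
  have K: "0 < K" by (simp add: K_def)
  have "\<delta> / K * sqrt c ^ n \<le> card (trajectory G \<phi> F n)" for n
  proof -
    have "\<delta> / K * sqrt c ^ n \<le> \<delta> / K * (K * c ^ (n div 2))"
      using sqrt_power_div2(1)[OF assms(3), of n] F(4) K by (intro mult_left_mono) (auto simp: K_def)
    also have "\<dots> = \<delta> * c ^ (n div 2)" using K by simp
    also have "\<dots> \<le> card (trajectory G (\<phi> \<circ> \<phi>) F (n div 2))" by (rule F(5))
    also have "card (trajectory G (\<phi> \<circ> \<phi>) F (n div 2)) \<le> card (trajectory G \<phi> F (2 * (n div 2)))"
      by (intro card_mono finite_trajectory trajectory_square_subset assms F)
    also have "\<dots> \<le> card (trajectory G \<phi> F n)"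
      by (intro card_trajectory_mono assms F) simp
    finally show ?thesis by simp
  qed
  moreover have "0 < \<delta> / K" using F(4) K by simp
  ultimately show ?thesis unfolding grows_at_least_def using F(1-3) by blast
qed

lemma grows_at_most_sqrt:
  assumes "group G" "\<phi> \<in> hom G G" "0 < c" "grows_at_most G (\<phi> \<circ> \<phi>) c"
  shows "grows_at_most G \<phi> (sqrt c)"
  unfolding grows_at_most_def
proof (intro allI impI)
  fix F assume F: "finite F" "F \<subseteq> carrier G" "\<one>\<^bsub>G\<^esub> \<in> F"
  interpret group G by fact
  let ?F' = "F <#>\<^bsub>G\<^esub> \<phi> ` F"
  have "\<one>\<^bsub>G\<^esub> \<in> \<phi> ` F" using hom_one[OF assms(2,1,1)] F(3) by force
  then have "\<one>\<^bsub>G\<^esub> \<otimes>\<^bsub>G\<^esub> \<one>\<^bsub>G\<^esub> \<in> ?F'" using F(3) unfolding set_mult_def by blast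
  then have one: "\<one>\<^bsub>G\<^esub> \<in> ?F'" by simp
  have carr: "?F' \<subseteq> carrier G" using F(2) assms(2) by (intro set_mult_closed hom_image_closed)
  have "finite ?F'" using F(1) by (auto simp: set_mult_def)
  then obtain C where C: "\<And>n. real (card (trajectory G (\<phi> \<circ> \<phi>) ?F' n)) \<le> C * c ^ n"
    using assms(4) one carr unfolding grows_at_most_def by blast
  define K where "K = max 1 (sqrt c)"
  have "real (card (trajectory G \<phi> F n)) \<le> \<bar>C\<bar> * K ^ 2 * sqrt c ^ n" for n
  proof -
    have "card (trajectory G \<phi> F n) \<le> card (trajectory G \<phi> F (2 * Suc (n div 2)))"
      by (intro card_trajectory_mono assms F) simp
    also have "\<dots> = card (trajectory G (\<phi> \<circ> \<phi>) ?F' (Suc (n div 2)))"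
      by (simp only: trajectory_double[OF assms(1,2) F(2)])
    finally have "real (card (trajectory G \<phi> F n)) \<le> C * c ^ Suc (n div 2)"
      using C[of "Suc (n div 2)"] by linarith
    also have "\<dots> \<le> \<bar>C\<bar> * c ^ Suc (n div 2)" using assms(3) by (intro mult_right_mono) auto
    also have "\<dots> \<le> \<bar>C\<bar> * (K ^ 2 * sqrt c ^ n)"
      unfolding K_def using sqrt_power_div2(2)[OF assms(3), of n] by (intro mult_left_mono) auto
    finally show ?thesis by (simp only: mult.assoc)
  qed
  then show "\<exists>C. \<forall>n. real (card (trajectory G \<phi> F n)) \<le> C * sqrt c ^ n" by (intro exI allI)
qed

lemma card_trajectory_pos:
  assumes "group G" "\<phi> \<in> hom G G" "finite F" "\<one>\<^bsub>G\<^esub> \<in> F"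
  shows "0 < card (trajectory G \<phi> F n)"
  using one_in_trajectory(1)[OF assms(1,2,4)] finite_trajectory[OF assms(3)] by (metis card_gt_0_iff empty_iff)

lemma discrete_alg_entropy_eq:
  assumes "group G" "\<phi> \<in> hom G G"
  shows "discrete_alg_entropy G \<phi> = (SUP F\<in>{F. finite F \<and> F \<subseteq> carrier G \<and> \<one>\<^bsub>G\<^esub> \<in> F}.
    limsup (\<lambda>n. ereal (ln (real (card (trajectory G \<phi> F n))) / real n)))"
proof -
  interpret group G by fact
  have "measure (count_space (carrier G)) (trajectory G \<phi> F n) = real (card (trajectory G \<phi> F n))"
    if "F \<subseteq> carrier G" for F n
    using trajectory_subset[OF assms that, of n] by (simp add: measure_count_space)
  then show ?thesis
    unfolding discrete_alg_entropy_def alg_entropy_def compact_nbhds_one_discrete[OF one_closed] alg_entropy_wrt_def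
    by (intro SUP_cong) simp_all
qed

lemma ln_growth_tendsto: "(\<lambda>n. ereal (a / real n + b)) \<longlonglongrightarrow> ereal b"
proof -
  have "(\<lambda>n. a / real n + b) \<longlonglongrightarrow> 0 + b"
    by (intro tendsto_add tendsto_const lim_const_over_n)
  then show ?thesis by simp
qed

lemma entropy_ge:
  assumes "group G" "\<phi> \<in> hom G G" "0 < c" "grows_at_least G \<phi> c"
  shows "ereal (ln c) \<le> discrete_alg_entropy G \<phi>"
proof -
  obtain F \<delta> where F: "finite F" "F \<subseteq> carrier G" "\<one>\<^bsub>G\<^esub> \<in> F" "0 < \<delta>"
    "\<And>n. \<delta> * c ^ n \<le> card (trajectory G \<phi> F n)"
    using assms(4) by (auto simp: grows_at_least_def)
  have le: "ln \<delta> / real n + ln c \<le> ln (real (card (trajectory G \<phi> F n))) / real n" if "0 < n" for n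
  proof -
    have "ln (\<delta> * c ^ n) \<le> ln (real (card (trajectory G \<phi> F n)))"
      using F(5)[of n] F(4) assms(3) by (intro ln_mono) auto
    then have "(ln \<delta> + real n * ln c) / real n \<le> ln (real (card (trajectory G \<phi> F n))) / real n"
      using F(4) assms(3) by (intro divide_right_mono) (auto simp: ln_mult ln_realpow)
    then show ?thesis using that by (simp add: add_divide_distrib)
  qed
  have "ereal (ln c) = limsup (\<lambda>n. ereal (ln \<delta> / real n + ln c))"
    by (rule lim_imp_Limsup[symmetric, OF _ ln_growth_tendsto]) simp
  also have "\<dots> \<le> limsup (\<lambda>n. ereal (ln (real (card (trajectory G \<phi> F n))) / real n))"
    using le by (intro Limsup_mono) (auto intro!: eventually_sequentiallyI[of 1])
  also have "\<dots> \<le> discrete_alg_entropy G \<phi>"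
    unfolding discrete_alg_entropy_eq[OF assms(1,2)] using F by (intro SUP_upper) auto
  finally show ?thesis .
qed

lemma entropy_le:
  assumes "group G" "\<phi> \<in> hom G G" "0 < c" "grows_at_most G \<phi> c"
  shows "discrete_alg_entropy G \<phi> \<le> ereal (ln c)"
  unfolding discrete_alg_entropy_eq[OF assms(1,2)]
proof (rule SUP_least)
  fix F assume "F \<in> {F. finite F \<and> F \<subseteq> carrier G \<and> \<one>\<^bsub>G\<^esub> \<in> F}"
  then have F: "finite F" "F \<subseteq> carrier G" "\<one>\<^bsub>G\<^esub> \<in> F" by auto
  then obtain C where C: "\<And>n. real (card (trajectory G \<phi> F n)) \<le> C * c ^ n"
    using assms(4) unfolding grows_at_most_def by blast
  have "0 < C" using C[of 0] by simp
  have le: "ln (real (card (trajectory G \<phi> F n))) / real n \<le> ln C / real n + ln c" if "0 < n" for n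
  proof -
    have "ln (real (card (trajectory G \<phi> F n))) \<le> ln (C * c ^ n)"
      using C[of n] card_trajectory_pos[OF assms(1,2) F(1,3), of n] by (intro ln_mono) auto
    then have "ln (real (card (trajectory G \<phi> F n))) / real n \<le> (ln C + real n * ln c) / real n"
      using \<open>0 < C\<close> assms(3) by (intro divide_right_mono) (auto simp: ln_mult ln_realpow)
    then show ?thesis using that by (simp add: add_divide_distrib)
  qed
  have "limsup (\<lambda>n. ereal (ln (real (card (trajectory G \<phi> F n))) / real n)) \<le> limsup (\<lambda>n. ereal (ln C / real n + ln c))"
    using le by (intro Limsup_mono) (auto intro!: eventually_sequentiallyI[of 1])
  also have "\<dots> = ereal (ln c)"
    by (rule lim_imp_Limsup[OF _ ln_growth_tendsto]) simp
  finally show "limsup (\<lambda>n. ereal (ln (real (card (trajectory G \<phi> F n))) / real n)) \<le> ereal (ln c)" .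
qed

section \<open>Trajectories in rational vector spaces\<close>

lemma additive_rat_linear:
  fixes g :: "rat \<Rightarrow> rat"
  assumes add: "\<And>x y. g (x + y) = g x + g y"
  shows "g q = q * g 1"
proof -
  have g0: "g 0 = 0" using add[of 0 0] by simp
  have gm: "g (- x) = - g x" for x using add[of x "- x"] g0 by (simp add: eq_neg_iff_add_eq_0 add.commute)
  have gn: "g (of_nat n * x) = of_nat n * g x" for n x
    by (induction n) (simp_all add: g0 add distrib_right)
  have gi: "g (of_int z * x) = of_int z * g x" for z x
  proof (cases z rule: int_cases2)
    case (nonneg n)
    then show ?thesis using gn[of n x] by simp
  next
    case (nonpos n)
    then show ?thesis using gn[of n x] gm[of "of_nat n * x"] by simp
  qed
  obtain a b where ab: "q = of_int a / of_int b" "b > 0"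
    by (metis quotient_of_denom_pos quotient_of_div surj_pair)
  have "of_int b * g q = g (of_int b * q)" by (rule gi[symmetric])
  also have "of_int b * q = of_int a * 1" using ab by simp
  also have "g (of_int a * 1) = of_int a * g 1" by (rule gi)
  also have "\<dots> = of_int b * (q * g 1)" using ab by simp
  finally show ?thesis using ab(2) by simp
qed

lemma group_rat_vec: "group (monoid_vec TYPE(rat) N)"
  using comm_group_vec[where ?'a = rat, of N] by (simp add: comm_group_def)

text \<open>
  An additive map between rational vector spaces is linear; it is enough to see this on the multiples of one
  vector, componentwise (\<open>additive_rat_linear\<close>).
\<close>

lemma hom_eq_mult_mat_vec:
  assumes \<phi>: "\<phi> \<in> hom (monoid_vec TYPE(rat) N) (monoid_vec TYPE(rat) N)" and v: "v \<in> carrier_vec N"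
  shows "\<phi> v = endo_mat N \<phi> *\<^sub>v v"
proof -
  have add: "\<phi> (x + y) = \<phi> x + \<phi> y" if "x \<in> carrier_vec N" "y \<in> carrier_vec N" for x y
    using hom_mult[OF \<phi>, of x y] that by (simp add: monoid_vec_simps)
  have closed: "\<phi> x \<in> carrier_vec N" if "x \<in> carrier_vec N" for x
    using hom_in_carrier[OF \<phi>, of x] that by (simp add: monoid_vec_simps)
  have add_ix: "vec_index (\<phi> (x + y)) r = vec_index (\<phi> x) r + vec_index (\<phi> y) r"
    if "x \<in> carrier_vec N" "y \<in> carrier_vec N" "r < N" for x y r
    using add[OF that(1,2)] closed[OF that(1)] closed[OF that(2)] that(3) by simp
  have scale: "vec_index (\<phi> (q \<cdot>\<^sub>v x)) r = q * vec_index (\<phi> x) r" if x: "x \<in> carrier_vec N" and r: "r < N" for q x r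
  proof -
    have "vec_index (\<phi> ((p + q) \<cdot>\<^sub>v x)) r = vec_index (\<phi> (p \<cdot>\<^sub>v x)) r + vec_index (\<phi> (q \<cdot>\<^sub>v x)) r" for p q
      using add_ix[of "p \<cdot>\<^sub>v x" "q \<cdot>\<^sub>v x" r] x r by (simp add: add_smult_distrib_vec)
    then show ?thesis using additive_rat_linear[of "\<lambda>q. vec_index (\<phi> (q \<cdot>\<^sub>v x)) r" q] by simp
  qed
  define w where "w = (\<lambda>k. vec N (\<lambda>i. if i < k then vec_index v i else 0))"
  have w: "w k \<in> carrier_vec N" for k by (simp add: w_def)
  have part: "vec_index (\<phi> (w k)) r = (\<Sum>j<k. vec_index v j * vec_index (\<phi> (unit_vec N j)) r)" if "k \<le> N" "r < N" for k r
    using that(1)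
  proof (induction k)
    case 0
    have "w 0 = 0 \<cdot>\<^sub>v unit_vec N 0" by (auto simp: w_def)
    then show ?case using scale[of "unit_vec N 0" r 0] that(2) by simp
  next
    case (Suc k)
    have "w (Suc k) = w k + vec_index v k \<cdot>\<^sub>v unit_vec N k"
      using Suc.prems by (auto simp: w_def less_Suc_eq)
    then have "vec_index (\<phi> (w (Suc k))) r = vec_index (\<phi> (w k)) r + vec_index v k * vec_index (\<phi> (unit_vec N k)) r"
      using add_ix[OF w, of "vec_index v k \<cdot>\<^sub>v unit_vec N k" r k] scale[of "unit_vec N k" r] that(2) by simp
    then show ?case using Suc by simp
  qed
  have "w N = v" using v by (auto simp: w_def)
  show ?thesis
  proof (rule eq_vecI)
    fix r assume "r < dim_vec (endo_mat N \<phi> *\<^sub>v v)"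
    then have r: "r < N" by (simp add: endo_mat_def)
    have "vec_index (endo_mat N \<phi> *\<^sub>v v) r = (\<Sum>j<N. vec_index (\<phi> (unit_vec N j)) r * vec_index v j)"
      using r v by (auto simp: endo_mat_def scalar_prod_def atLeast0LessThan intro!: sum.cong)
    then show "vec_index (\<phi> v) r = vec_index (endo_mat N \<phi> *\<^sub>v v) r"
      using part[OF order.refl r] \<open>w N = v\<close> by (simp add: mult.commute)
  qed (use closed[OF v] in \<open>simp add: endo_mat_def\<close>)
qed

lemma endo_mat_carrier: "endo_mat N \<phi> \<in> carrier_mat N N"
  by (simp add: endo_mat_def)

lemma endo_mat_comp_self:
  assumes \<phi>: "\<phi> \<in> hom (monoid_vec TYPE(rat) N) (monoid_vec TYPE(rat) N)"
  shows "endo_mat N (\<phi> \<circ> \<phi>) = endo_mat N \<phi> * endo_mat N \<phi>"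
proof (rule eq_matI)
  let ?M = "endo_mat N \<phi>"
  have M: "?M \<in> carrier_mat N N" by (rule endo_mat_carrier)
  fix i j assume "i < dim_row (?M * ?M)" "j < dim_col (?M * ?M)"
  then have ij: "i < N" "j < N" by (auto simp: endo_mat_def)
  have u: "unit_vec N j \<in> carrier_vec N" by simp
  have col: "\<phi> (unit_vec N j) = col ?M j"
    unfolding hom_eq_mult_mat_vec[OF \<phi> u] using M ij(2) by (intro eq_vecI) auto
  have "\<phi> (\<phi> (unit_vec N j)) = ?M *\<^sub>v col ?M j"
    unfolding col using hom_eq_mult_mat_vec[OF \<phi>, of "col ?M j"] M by (simp add: carrier_vecI)
  then show "endo_mat N (\<phi> \<circ> \<phi>) $$ (i, j) = (?M * ?M) $$ (i, j)"
    using ij M by (subst endo_mat_def) simp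
qed (auto simp: endo_mat_def)

lemma hom_funpow_eq:
  assumes \<phi>: "\<phi> \<in> hom (monoid_vec TYPE(rat) N) (monoid_vec TYPE(rat) N)" and v: "v \<in> carrier_vec N"
  shows "(\<phi> ^^ n) v = (endo_mat N \<phi> ^\<^sub>m n) *\<^sub>v v"
  using v
proof (induction n arbitrary: v)
  case 0
  then show ?case by (simp add: endo_mat_def)
next
  case (Suc n)
  let ?M = "endo_mat N \<phi>"
  have M: "?M \<in> carrier_mat N N" by (rule endo_mat_carrier)
  have "(\<phi> ^^ Suc n) v = (\<phi> ^^ n) (?M *\<^sub>v v)"
    unfolding funpow_Suc_right o_apply hom_eq_mult_mat_vec[OF \<phi> Suc.prems] ..
  also have "\<dots> = (?M ^\<^sub>m n) *\<^sub>v (?M *\<^sub>v v)"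
    by (rule Suc.IH[OF mult_mat_vec_carrier[OF M Suc.prems]])
  also have "\<dots> = (?M ^\<^sub>m Suc n) *\<^sub>v v"
    using assoc_mult_mat_vec[OF pow_carrier_mat[OF M] M Suc.prems, of n] by simp
  finally show ?case .
qed

lemma moment_monom: "moment \<mu> (monom c n) = c * \<mu> n"
proof -
  have "moment \<mu> (monom c n) = (\<Sum>a<Suc n. coeff (monom c n) a * \<mu> a)"
    by (rule moment_eq_sum) auto
  also have "\<dots> = (\<Sum>a\<in>{n}. coeff (monom c n) a * \<mu> a)"
    by (intro sum.mono_neutral_right) auto
  finally show ?thesis by simp
qed

lemma eval_at_monom:
  assumes "M \<in> carrier_mat N N"
  shows "eval_at N M (\<lambda>k. monom (c k) n) = (M ^\<^sub>m n) *\<^sub>v vec N c"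
proof (rule eq_vecI)
  have A: "M ^\<^sub>m n \<in> carrier_mat N N" using assms by simp
  fix r assume "r < dim_vec ((M ^\<^sub>m n) *\<^sub>v vec N c)"
  then have r: "r < N" using assms by simp
  then show "vec_index (eval_at N M (\<lambda>k. monom (c k) n)) r = vec_index ((M ^\<^sub>m n) *\<^sub>v vec N c) r"
    using carrier_matD[OF A] carrier_matD[OF assms] by (simp add: eval_at_def moment_monom scalar_prod_def atLeast0LessThan mult.commute)
qed (use assms in \<open>simp add: eval_at_def\<close>)

lemma box_split:
  assumes "g \<in> box (Suc n) K"
  obtains g' where "g' \<in> box n K" "g = g' + monom (coeff g n) n"
proof -
  define g' where "g' = g - monom (coeff g n) n"
  have "coeff g' k = (if k = n then 0 else coeff g k)" for k by (simp add: g'_def)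
  then have "g' \<in> box n K"
    using boxD[OF assms] by (intro boxI) (auto simp: Suc_le_eq)
  then show ?thesis using that by (simp add: g'_def)
qed

lemma box_join:
  assumes "g \<in> box n K" "\<bar>c\<bar> \<le> int K"
  shows "g + monom c n \<in> box (Suc n) K"
proof (rule boxI)
  fix k show "\<bar>coeff (g + monom c n) k\<bar> \<le> int K"
    using boxD[OF assms(1), of k] assms(2) by (cases "k = n") auto
next
  fix k assume "Suc n \<le> k"
  then show "coeff (g + monom c n) k = 0" using boxD(2)[OF assms(1), of k] by simp
qed

definition integer_cube :: "nat \<Rightarrow> nat \<Rightarrow> rat Matrix.vec set" where
  "integer_cube N K = (\<lambda>c. vec N (\<lambda>k. of_int (c k))) ` (\<Pi>\<^sub>E k\<in>{..<N}. {- int K..int K})"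

lemma finite_integer_cube: "finite (integer_cube N K)"
  unfolding integer_cube_def by (intro finite_imageI finite_PiE) auto

lemma zero_in_integer_cube: "0\<^sub>v N \<in> integer_cube N K"
  unfolding integer_cube_def by (rule image_eqI[of _ _ "restrict (\<lambda>_. 0) {..<N}"]) auto

text \<open>
  A polynomial of degree at most \<open>n\<close> is one of degree less than \<open>n\<close> plus a monomial, and the evaluation of the
  monomial parts is the image of an integer vector under the \<open>n\<close>-th iterate.
\<close>

lemma lattice_values_subset_trajectory:
  assumes \<phi>: "\<phi> \<in> hom (monoid_vec TYPE(rat) N) (monoid_vec TYPE(rat) N)"
  shows "lattice_values N (endo_mat N \<phi>) n K \<subseteq> trajectory (monoid_vec TYPE(rat) N) \<phi> (integer_cube N K) n"
proof (induction n)
  case 0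
  have "eval_at N (endo_mat N \<phi>) (\<lambda>k. of_int_poly (f k)) = 0\<^sub>v N" if "f \<in> (\<Pi>\<^sub>E k\<in>{..<N}. box 0 K)" for f
  proof -
    have "f k = 0" if "k < N" for k
      using \<open>f \<in> _\<close> that boxD(2)[of "f k" 0 K] by (intro poly_eqI) auto
    then show ?thesis by (auto simp: eval_at_def moment_0)
  qed
  then show ?case unfolding lattice_values_def by (auto simp: monoid_vec_simps)
next
  case (Suc n)
  let ?M = "endo_mat N \<phi>"
  have M: "?M \<in> carrier_mat N N" by (rule endo_mat_carrier)
  show ?case
  proof
    fix y assume "y \<in> lattice_values N ?M (Suc n) K"
    then obtain f where f: "f \<in> (\<Pi>\<^sub>E k\<in>{..<N}. box (Suc n) K)" and y: "y = eval_at N ?M (\<lambda>k. of_int_poly (f k))"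
      by (auto simp: lattice_values_def)
    have "\<exists>g. k < N \<longrightarrow> g \<in> box n K \<and> f k = g + monom (coeff (f k) n) n" for k
    proof (cases "k < N")
      case True
      then have "f k \<in> box (Suc n) K" using f by auto
      then show ?thesis by (rule box_split) blast
    qed simp
    then obtain g where g: "\<And>k. k < N \<Longrightarrow> g k \<in> box n K \<and> f k = g k + monom (coeff (f k) n) n" by metis
    define c where "c = restrict (\<lambda>k. coeff (f k) n) {..<N}"
    have fk: "of_int_poly (f k) = (of_int_poly (restrict g {..<N} k) + monom (of_int (c k)) n :: rat poly)" if "k < N" for k
    proof -
      have "of_int_poly (f k) = (of_int_poly (g k + monom (coeff (f k) n) n) :: rat poly)" using g that by metis
      then show ?thesis using that by (simp add: c_def of_int_poly_hom.hom_add)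
    qed
    have "y = eval_at N ?M (\<lambda>k. of_int_poly (restrict g {..<N} k) + monom (of_int (c k)) n)"
      unfolding y by (rule eval_at_cong) (rule fk)
    then have y': "y = eval_at N ?M (\<lambda>k. of_int_poly (restrict g {..<N} k)) + (?M ^\<^sub>m n) *\<^sub>v vec N (\<lambda>k. of_int (c k))"
      unfolding eval_at_add eval_at_monom[OF M] .
    have "restrict g {..<N} \<in> (\<Pi>\<^sub>E k\<in>{..<N}. box n K)" using g by auto
    then have 1: "eval_at N ?M (\<lambda>k. of_int_poly (restrict g {..<N} k)) \<in> trajectory (monoid_vec TYPE(rat) N) \<phi> (integer_cube N K) n"
      using Suc unfolding lattice_values_def by blast
    have "- int K \<le> coeff (f k) n \<and> coeff (f k) n \<le> int K" if "k < N" for k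
    proof -
      have "f k \<in> box (Suc n) K" using f that by auto
      then show ?thesis using boxD(1)[of "f k" "Suc n" K n] by linarith
    qed
    then have "c \<in> (\<Pi>\<^sub>E k\<in>{..<N}. {- int K..int K})" by (auto simp: c_def)
    then have "vec N (\<lambda>k. of_int (c k)) \<in> integer_cube N K" unfolding integer_cube_def by blast
    moreover have "(?M ^\<^sub>m n) *\<^sub>v vec N (\<lambda>k. of_int (c k)) = (\<phi> ^^ n) (vec N (\<lambda>k. of_int (c k)))"
      by (rule hom_funpow_eq[OF \<phi>, symmetric]) simp
    ultimately have 2: "(?M ^\<^sub>m n) *\<^sub>v vec N (\<lambda>k. of_int (c k)) \<in> (\<phi> ^^ n) ` integer_cube N K" by simp
    show "y \<in> trajectory (monoid_vec TYPE(rat) N) \<phi> (integer_cube N K) (Suc n)"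
      unfolding trajectory.simps set_mult_def y' monoid_vec_simps using 1 2 by blast
  qed
qed

lemma trajectory_subset_lattice_values:
  assumes \<phi>: "\<phi> \<in> hom (monoid_vec TYPE(rat) N) (monoid_vec TYPE(rat) N)"
    and F: "F \<subseteq> carrier_vec N" "(\<lambda>v. q \<cdot>\<^sub>v v) ` F \<subseteq> integer_cube N K"
  shows "(\<lambda>v. q \<cdot>\<^sub>v v) ` trajectory (monoid_vec TYPE(rat) N) \<phi> F n \<subseteq> lattice_values N (endo_mat N \<phi>) n K"
proof (induction n)
  case 0
  have "restrict (\<lambda>_. 0) {..<N} \<in> (\<Pi>\<^sub>E k\<in>{..<N}. box 0 K)" by (auto intro!: boxI)
  moreover have "q \<cdot>\<^sub>v 0\<^sub>v N = eval_at N (endo_mat N \<phi>) (\<lambda>k. of_int_poly (restrict (\<lambda>_. 0) {..<N} k))"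
    by (auto simp: eval_at_def moment_0)
  ultimately have "q \<cdot>\<^sub>v 0\<^sub>v N \<in> lattice_values N (endo_mat N \<phi>) 0 K"
    unfolding lattice_values_def by (intro image_eqI)
  then show ?case by (simp add: monoid_vec_simps)
next
  case (Suc n)
  let ?M = "endo_mat N \<phi>" and ?T = "trajectory (monoid_vec TYPE(rat) N) \<phi> F n"
  have M: "?M \<in> carrier_mat N N" by (rule endo_mat_carrier)
  have T: "?T \<subseteq> carrier_vec N"
    using trajectory_subset[OF group_rat_vec \<phi>, of F n] F(1) by (simp add: monoid_vec_simps)
  show ?case
  proof
    fix y assume "y \<in> (\<lambda>v. q \<cdot>\<^sub>v v) ` trajectory (monoid_vec TYPE(rat) N) \<phi> F (Suc n)"
    then obtain x v where x: "x \<in> ?T" and v: "v \<in> F" and y: "y = q \<cdot>\<^sub>v (x + (\<phi> ^^ n) v)"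
      by (auto simp: set_mult_def monoid_vec_simps)
    have xc: "x \<in> carrier_vec N" and vc: "v \<in> carrier_vec N" using x v T F(1) by auto
    have "q \<cdot>\<^sub>v x \<in> lattice_values N ?M n K" using Suc x by auto
    then obtain f where f: "f \<in> (\<Pi>\<^sub>E k\<in>{..<N}. box n K)" "q \<cdot>\<^sub>v x = eval_at N ?M (\<lambda>k. of_int_poly (f k))"
      by (auto simp: lattice_values_def)
    obtain c where c: "c \<in> (\<Pi>\<^sub>E k\<in>{..<N}. {- int K..int K})" "q \<cdot>\<^sub>v v = vec N (\<lambda>k. of_int (c k))"
      using F(2) v by (auto simp: integer_cube_def)
    have "y = q \<cdot>\<^sub>v x + q \<cdot>\<^sub>v ((?M ^\<^sub>m n) *\<^sub>v v)"
      unfolding y hom_funpow_eq[OF \<phi> vc] 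
      by (rule smult_add_distrib_vec[OF xc mult_mat_vec_carrier[OF pow_carrier_mat[OF M] vc]])
    also have "q \<cdot>\<^sub>v ((?M ^\<^sub>m n) *\<^sub>v v) = (?M ^\<^sub>m n) *\<^sub>v (q \<cdot>\<^sub>v v)"
      using mult_mat_vec[of "?M ^\<^sub>m n" N N v q] M vc by simp
    also have "q \<cdot>\<^sub>v x + \<dots> = eval_at N ?M (\<lambda>k. of_int_poly (f k) + monom (of_int (c k)) n)"
      unfolding f(2) c(2) eval_at_add eval_at_monom[OF M] ..
    also have "\<dots> = eval_at N ?M (\<lambda>k. of_int_poly (restrict (\<lambda>k. f k + monom (c k) n) {..<N} k))"
      by (rule eval_at_cong) (simp add: of_int_poly_hom.hom_add)
    finally have "y = eval_at N ?M (\<lambda>k. of_int_poly (restrict (\<lambda>k. f k + monom (c k) n) {..<N} k))" .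
    moreover have "restrict (\<lambda>k. f k + monom (c k) n) {..<N} \<in> (\<Pi>\<^sub>E k\<in>{..<N}. box (Suc n) K)"
      unfolding restrict_PiE_iff
    proof
      fix k assume k: "k \<in> {..<N}"
      have ck: "c k \<in> {- int K..int K}" by (rule PiE_mem[OF c(1) k])
      have fk: "f k \<in> box n K" by (rule PiE_mem[OF f(1) k])
      have "\<bar>c k\<bar> \<le> int K" using ck unfolding atLeastAtMost_iff by linarith
      with fk show "f k + monom (c k) n \<in> box (Suc n) K" by (rule box_join)
    qed
    ultimately show "y \<in> lattice_values N ?M (Suc n) K" unfolding lattice_values_def by (rule image_eqI)
  qed
qed

lemma scaled_into_integer_cube:
  assumes F: "finite F" "F \<subseteq> carrier_vec N"
  shows "\<exists>(q::rat) K. q \<noteq> 0 \<and> 1 \<le> K \<and> (\<lambda>v. q \<cdot>\<^sub>v v) ` F \<subseteq> integer_cube N K"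
proof -
  define S where "S = (\<lambda>(v, i). vec_index v i) ` (F \<times> {..<N})"
  have S: "finite S" using F(1) by (simp add: S_def)
  have "\<exists>D::int. 0 < D \<and> (\<forall>x\<in>S. \<exists>w::int poly. of_int_poly w = [:of_int D:] * [:x:])"
    by (rule common_denominator[OF S])
  then obtain D :: int where D: "0 < D" "\<And>x. x \<in> S \<Longrightarrow> \<exists>w::int poly. of_int_poly w = [:of_int D:] * [:x:]"
    by blast
  have int: "of_int \<lfloor>of_int D * x\<rfloor> = of_int D * x" if xS: "x \<in> S" for x
  proof -
    obtain w :: "int poly" where w: "of_int_poly w = [:of_int D:] * [:x:]" using D(2)[OF xS] by blast
    have "of_int (coeff w 0) = of_int D * x" using arg_cong[OF w, of "\<lambda>p. coeff p 0"] by simp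
    then show ?thesis by (metis floor_of_int)
  qed
  define K where "K = 1 + (\<Sum>x\<in>S. nat \<bar>\<lfloor>of_int D * x\<rfloor>\<bar>)"
  have Kx: "\<lfloor>of_int D * x\<rfloor> \<in> {- int K..int K}" if "x \<in> S" for x
  proof -
    have "nat \<bar>\<lfloor>of_int D * x\<rfloor>\<bar> \<le> (\<Sum>x\<in>S. nat \<bar>\<lfloor>of_int D * x\<rfloor>\<bar>)"
      using S that by (intro member_le_sum) auto
    then have "nat \<bar>\<lfloor>of_int D * x\<rfloor>\<bar> \<le> K" by (simp add: K_def)
    then show ?thesis unfolding atLeastAtMost_iff by linarith
  qed
  have "of_int D \<cdot>\<^sub>v v \<in> integer_cube N K" if v: "v \<in> F" for v
  proof -
    have vi: "vec_index v i \<in> S" if "i < N" for i using v that by (force simp: S_def)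
    have dim: "dim_vec v = N" using v F(2) by auto
    define c where "c = restrict (\<lambda>i. \<lfloor>of_int D * vec_index v i\<rfloor>) {..<N}"
    have "c \<in> (\<Pi>\<^sub>E k\<in>{..<N}. {- int K..int K})"
      unfolding c_def restrict_PiE_iff using Kx vi by blast
    moreover have "of_int D \<cdot>\<^sub>v v = vec N (\<lambda>k. of_int (c k))"
    proof (rule eq_vecI)
      fix i assume "i < dim_vec (vec N (\<lambda>k. rat_of_int (c k)))"
      then have i: "i < N" by simp
      then show "vec_index (of_int D \<cdot>\<^sub>v v) i = vec_index (vec N (\<lambda>k. rat_of_int (c k))) i"
        using dim int[OF vi[OF i]] by (simp only: c_def index_smult_vec index_vec restrict_apply' lessThan_iff)
    qed (simp add: dim)
    ultimately show ?thesis unfolding integer_cube_def by blast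
  qed
  moreover have "rat_of_int D \<noteq> 0" "1 \<le> K" using D(1) by (auto simp: K_def)
  ultimately show ?thesis by (intro exI[of _ "rat_of_int D"] exI[of _ K] conjI image_subsetI)
qed

section \<open>The entropy formula\<close>

lemma grows_at_least_mono:
  assumes "grows_at_least G \<phi> c" "0 \<le> c'" "c' \<le> c"
  shows "grows_at_least G \<phi> c'"
proof -
  obtain F \<delta> where F: "finite F" "F \<subseteq> carrier G" "\<one>\<^bsub>G\<^esub> \<in> F" "0 < \<delta>"
    "\<And>n. \<delta> * c ^ n \<le> card (trajectory G \<phi> F n)"
    using assms(1) by (auto simp: grows_at_least_def)
  have "\<delta> * c' ^ n \<le> card (trajectory G \<phi> F n)" for n
  proof -
    have "\<delta> * c' ^ n \<le> \<delta> * c ^ n" using assms F(4) by (intro mult_left_mono power_mono) auto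
    then show ?thesis using F(5)[of n] by linarith
  qed
  then show ?thesis using F unfolding grows_at_least_def by blast
qed

lemma grows_at_most_mono:
  assumes "grows_at_most G \<phi> c" "0 \<le> c" "c \<le> c'"
  shows "grows_at_most G \<phi> c'"
  unfolding grows_at_most_def
proof (intro allI impI)
  fix F assume "finite F" "F \<subseteq> carrier G" "\<one>\<^bsub>G\<^esub> \<in> F"
  then obtain C where C: "\<And>n. real (card (trajectory G \<phi> F n)) \<le> C * c ^ n"
    using assms(1) unfolding grows_at_most_def by blast
  have "real (card (trajectory G \<phi> F n)) \<le> \<bar>C\<bar> * c' ^ n" for n
  proof -
    have "C * c ^ n \<le> \<bar>C\<bar> * c' ^ n" using assms(2,3) by (intro mult_mono power_mono) auto
    then show ?thesis using C[of n] by linarith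
  qed
  then show "\<exists>C. \<forall>n. real (card (trajectory G \<phi> F n)) \<le> C * c' ^ n" by (intro exI allI)
qed

lemma power_diff_ge:
  fixes x :: real
  assumes "0 < x"
  shows "inverse (max 1 x ^ d) * x ^ n \<le> x ^ (n - d)"
proof -
  have "x ^ n \<le> max 1 x ^ d * x ^ (n - d)"
  proof (cases "d \<le> n")
    case True
    then have "x ^ n = x ^ d * x ^ (n - d)" by (simp flip: power_add)
    also have "\<dots> \<le> max 1 x ^ d * x ^ (n - d)" using assms by (intro mult_right_mono power_mono) auto
    finally show ?thesis .
  next
    case False
    have "x ^ n \<le> max 1 x ^ n" using assms by (intro power_mono) auto
    also have "\<dots> \<le> max 1 x ^ d" using False by (intro power_increasing) auto
    finally show ?thesis using False by simp
  qed
  moreover have "0 < max 1 x ^ d" by (intro zero_less_power) simp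
  ultimately show ?thesis by (simp add: field_simps)
qed

text \<open>
  The bounds of \<open>card_lattice_values_ge\<close> and \<open>card_lattice_values_le\<close>, transferred to trajectories: cubes of
  integer vectors for the lower bound, and for the upper bound any finite set, which a scalar moves into such a cube.
\<close>

lemma growth_bounds_of_dominant:
  fixes \<rho> :: nat
  assumes \<phi>: "\<phi> \<in> hom (monoid_vec TYPE(rat) N) (monoid_vec TYPE(rat) N)"
    and H: "hermite_basis N (endo_mat N \<phi>) H"
    and p: "\<And>k. k < N \<Longrightarrow> primitive_form (p k) (H k k)" "\<And>k. k < N \<Longrightarrow> degree (p k) \<le> N"
    and dom: "\<And>k. k < N \<Longrightarrow> dominant (of_int_poly (p k)) (j k) (real \<rho>)" "1 \<le> \<rho>"
  shows "grows_at_least (monoid_vec TYPE(rat) N) \<phi> (\<Prod>k<N. real_of_int \<bar>coeff (p k) (j k)\<bar> / 3)"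
    "grows_at_most (monoid_vec TYPE(rat) N) \<phi> (real \<rho> ^ growth_degree N N * (\<Prod>k<N. 3 * real (coeff_l1 (p k))))"
proof -
  let ?G = "monoid_vec TYPE(rat) N" and ?M = "endo_mat N \<phi>"
  have M: "?M \<in> carrier_mat N N" by (rule endo_mat_carrier)
  have "\<forall>k. \<exists>c::rat. k < N \<longrightarrow> c \<noteq> 0 \<and> of_int_poly (p k) = [:c:] * H k k"
  proof
    fix k show "\<exists>c::rat. k < N \<longrightarrow> c \<noteq> 0 \<and> of_int_poly (p k) = [:c:] * H k k"
    proof (cases "k < N")
      case True
      then obtain s :: nat where "0 < s" "of_int_poly (p k) = [:of_nat s:] * H k k"
        using p(1) unfolding primitive_form_def by blast
      then show ?thesis by (intro exI[of _ "of_nat s"]) simp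
    qed simp
  qed
  then obtain c :: "nat \<Rightarrow> rat" where c: "\<And>k. k < N \<Longrightarrow> c k \<noteq> 0"
    "\<And>k. k < N \<Longrightarrow> of_int_poly (p k) = [:c k:] * H k k" by metis
  have content: "content (p k) = 1" if "k < N" for k using p(1) that by (simp add: primitive_form_def)
  define x where "x = (\<lambda>k. real_of_int \<bar>coeff (p k) (j k)\<bar> / 3)"
  have x: "0 < x k" if "k < N" for k using dom(1)[OF that] by (simp add: x_def dominant_def)
  define K where "K = (\<Sum>k<N. nat \<bar>coeff (p k) (j k)\<bar>)"
  have K: "\<bar>coeff (p k) (j k)\<bar> \<le> int K" if "k < N" for k
  proof -
    have "nat \<bar>coeff (p k) (j k)\<bar> \<le> K" unfolding K_def using that by (intro member_le_sum) auto
    then show ?thesis by linarith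
  qed
  define \<delta> where "\<delta> = (\<Prod>k<N. inverse (max 1 (x k) ^ degree (p k)))"
  have \<delta>: "0 < \<delta>" unfolding \<delta>_def by (intro prod_pos) simp
  have "\<delta> * (\<Prod>k<N. x k) ^ n \<le> card (trajectory ?G \<phi> (integer_cube N K) n)" for n
  proof -
    have "\<delta> * (\<Prod>k<N. x k) ^ n = (\<Prod>k<N. inverse (max 1 (x k) ^ degree (p k)) * x k ^ n)"
      by (simp add: \<delta>_def prod.distrib prod_power_distrib)
    also have "\<dots> \<le> (\<Prod>k<N. x k ^ (n - degree (p k)))"
      using x power_diff_ge by (intro prod_mono) (auto intro!: mult_nonneg_nonneg simp: less_imp_le)
    also have "\<dots> \<le> card (lattice_values N ?M n K)"
      unfolding x_def using dom(2)
      by (intro card_lattice_values_ge[where c = c and H = H and p = p and j = j and \<rho> = "real \<rho>", OF M H content c(2,1) dom(1) _ K]) auto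
    also have "\<dots> \<le> card (trajectory ?G \<phi> (integer_cube N K) n)"
      using card_mono[OF finite_trajectory[OF finite_integer_cube] lattice_values_subset_trajectory[OF \<phi>]]
      by (simp only: of_nat_le_iff)
    finally show ?thesis .
  qed
  moreover have "integer_cube N K \<subseteq> carrier ?G"
    unfolding integer_cube_def monoid_vec_simps by (intro image_subsetI vec_carrier)
  moreover have "\<one>\<^bsub>?G\<^esub> \<in> integer_cube N K" using zero_in_integer_cube by (simp add: monoid_vec_simps)
  ultimately have "grows_at_least ?G \<phi> (\<Prod>k<N. x k)"
    unfolding grows_at_least_def using finite_integer_cube \<delta>
    by (intro exI[of _ "integer_cube N K"] exI[of _ \<delta>] conjI allI)
  then show "grows_at_least ?G \<phi> (\<Prod>k<N. real_of_int \<bar>coeff (p k) (j k)\<bar> / 3)" by (simp only: x_def)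
  define Q where "Q = \<rho> ^ growth_degree N N * (\<Prod>k<N. 3 * coeff_l1 (p k))"
  have "grows_at_most ?G \<phi> (real Q)"
    unfolding grows_at_most_def
  proof (intro allI impI)
    fix F assume F: "finite F" "F \<subseteq> carrier ?G"
    then have Fc: "F \<subseteq> carrier_vec N" by (simp add: monoid_vec_simps)
    obtain q :: rat and L where q: "q \<noteq> 0" "1 \<le> L" "(\<lambda>v. q \<cdot>\<^sub>v v) ` F \<subseteq> integer_cube N L"
      using scaled_into_integer_cube[OF F(1) Fc] by blast
    have "\<exists>C. \<forall>n. card (lattice_values N ?M n L) \<le> C * Q ^ n"
      unfolding Q_def
      by (rule card_lattice_values_le[where c = c and H = H and p = p and j = j, OF M H c(2) p(2) dom q(2)])
    then obtain C where C: "\<forall>n. card (lattice_values N ?M n L) \<le> C * Q ^ n" ..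
    have "real (card (trajectory ?G \<phi> F n)) \<le> real C * real Q ^ n" for n
    proof -
      have "inj_on (\<lambda>v. q \<cdot>\<^sub>v v) (trajectory ?G \<phi> F n)"
        by (rule inj_on_inverseI[where g = "\<lambda>v. inverse q \<cdot>\<^sub>v v"]) (use q(1) in \<open>simp add: smult_smult_assoc\<close>)
      then have "card (trajectory ?G \<phi> F n) \<le> card (lattice_values N ?M n L)"
        using trajectory_subset_lattice_values[OF \<phi> Fc q(3)] finite_lattice_values by (rule card_inj_on_le)
      also have "\<dots> \<le> C * Q ^ n" using C by simp
      finally have "real (card (trajectory ?G \<phi> F n)) \<le> real (C * Q ^ n)" by (simp only: of_nat_le_iff)
      then show ?thesis by simp
    qed
    then show "\<exists>C. \<forall>n. real (card (trajectory ?G \<phi> F n)) \<le> C * real Q ^ n" by (intro exI allI)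
  qed
  then show "grows_at_most ?G \<phi> (real \<rho> ^ growth_degree N N * (\<Prod>k<N. 3 * real (coeff_l1 (p k))))"
    by (simp add: Q_def)
qed

text \<open>
  A factor that depends only on the dimension. It combines the largest possible radius
  \<open>\<rho> = (8 (N + 1))\<^bsup>2 N + 1\<^esup>\<close> of the root gap with the losses of the two counting arguments.
\<close>

definition defect :: "nat \<Rightarrow> real" where
  "defect N = (8 * real (N + 1)) ^ ((2 * N + 1) * (growth_degree N N + N * N)) * 12 ^ N"

lemma defect_ge_1: "1 \<le> defect N"
proof -
  have "1 * 1 \<le> (8 * real (N + 1)) ^ ((2 * N + 1) * (growth_degree N N + N * N)) * 12 ^ N"
    by (intro mult_mono one_le_power) auto
  then show ?thesis by (simp add: defect_def)
qed

text \<open>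
  The radius \<open>\<rho>\<close> of the gap is chosen once, for all roots of \<open>P\<close>; it then serves every factor \<open>p k\<close>, because \<open>P\<close> is
  the product of the \<open>p k\<close>.
\<close>

lemma growth_bounds:
  assumes \<phi>: "\<phi> \<in> hom (monoid_vec TYPE(rat) N) (monoid_vec TYPE(rat) N)"
    and P: "primitive_form P (char_poly (endo_mat N \<phi>))"
  shows "grows_at_least (monoid_vec TYPE(rat) N) \<phi> (mahler P / defect N)"
    "grows_at_most (monoid_vec TYPE(rat) N) \<phi> (mahler P * defect N)"
proof -
  let ?M = "endo_mat N \<phi>"
  have M: "?M \<in> carrier_mat N N" by (rule endo_mat_carrier)
  obtain H where H: "hermite_basis N ?M H" by (rule hermite_basis_exists[OF M])
  have "\<forall>k. \<exists>p. k < N \<longrightarrow> primitive_form p (H k k)"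
    using primitive_form_exists hermite_basisD(3)[OF H] by blast
  then obtain p where p: "\<And>k. k < N \<Longrightarrow> primitive_form (p k) (H k k)" by metis
  have p0: "p k \<noteq> 0" if "k < N" for k using p[OF that] by (rule primitive_form_nonzero)
  have "primitive_form (\<Prod>k<N. p k) (char_poly ?M)"
    unfolding char_poly_eq_prod[OF M H] by (rule primitive_form_prod) (rule p)
  then have P_eq: "P = (\<Prod>k<N. p k)" using P primitive_form_unique by blast
  have P0: "P \<noteq> 0" using P by (rule primitive_form_nonzero)
  have degP: "degree P = N"
  proof -
    obtain s where s: "0 < (s::nat)" "of_int_poly P = [:of_nat s:] * char_poly ?M"
      using P unfolding primitive_form_def by blast
    have "degree P = degree (of_int_poly P :: rat poly)" by simp
    also have "\<dots> = degree (char_poly ?M)" unfolding s(2) using s(1) by simp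
    finally show ?thesis using degree_monic_char_poly[OF M] by simp
  qed
  have p_dvd: "p k dvd P" if "k < N" for k unfolding P_eq using that by (intro dvd_prodI) auto
  have deg: "degree (p k) \<le> N" if "k < N" for k
    using dvd_imp_degree_le[OF p_dvd[OF that] P0] degP by simp
  define B :: nat where "B = 8 * (N + 1)"
  have B: "1 < real B" by (simp add: B_def)
  have B_eq: "real B = 8 * real (N + 1)" by (simp add: B_def)
  have "(of_int_poly P :: complex poly) \<noteq> 0" "degree (of_int_poly P :: complex poly) \<le> N"
    using P0 degP by simp_all
  then obtain t where t: "t \<le> N" "\<And>a. poly (of_int_poly P) a = 0 \<Longrightarrow> cmod a \<le> real B ^ (2 * t) \<or> real B ^ (2 * t + 2) \<le> cmod a"
    using root_gap_exists[OF _ B] by blast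
  define \<rho> where "\<rho> = B ^ (2 * t + 1)"
  have \<rho>1: "1 \<le> \<rho>" by (simp add: \<rho>_def B_def)
  have \<rho>B: "real \<rho> / (8 * (N + 1)) = real B ^ (2 * t)" "real \<rho> * (8 * (N + 1)) = real B ^ (2 * t + 2)"
    by (simp_all add: \<rho>_def B_def)
  have gap: "cmod a \<le> \<rho> / (8 * (N + 1)) \<or> real \<rho> * (8 * (N + 1)) \<le> cmod a"
    if k: "k < N" and a: "poly (of_int_poly (p k)) a = 0" for k a
  proof -
    obtain r where "P = p k * r" using p_dvd[OF k] by (rule dvdE)
    then have "poly (of_int_poly P) a = 0" using a by (simp add: of_int_poly_hom.hom_mult)
    then show ?thesis using t(2) \<rho>B by metis
  qed
  have "\<exists>j. k < N \<longrightarrow> dominant (of_int_poly (p k)) j \<rho> \<and>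
    mahler (p k) \<le> 2 * real \<rho> ^ N * real_of_int \<bar>coeff (p k) j\<bar> \<and>
    real_of_int \<bar>coeff (p k) j\<bar> \<le> 2 * mahler (p k) \<and>
    real (coeff_l1 (p k)) \<le> 2 * real \<rho> ^ N * real_of_int \<bar>coeff (p k) j\<bar>" for k
  proof (cases "k < N")
    case True
    show ?thesis
      by (rule dominant_coefficient_exists[OF p0[OF True] deg[OF True] \<rho>1 gap[OF True]]) auto
  qed simp
  then obtain j where j: "\<And>k. k < N \<Longrightarrow> dominant (of_int_poly (p k)) (j k) \<rho>"
    "\<And>k. k < N \<Longrightarrow> mahler (p k) \<le> 2 * real \<rho> ^ N * real_of_int \<bar>coeff (p k) (j k)\<bar>"
    "\<And>k. k < N \<Longrightarrow> real_of_int \<bar>coeff (p k) (j k)\<bar> \<le> 2 * mahler (p k)"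
    "\<And>k. k < N \<Longrightarrow> real (coeff_l1 (p k)) \<le> 2 * real \<rho> ^ N * real_of_int \<bar>coeff (p k) (j k)\<bar>"
    by metis
  note gb = growth_bounds_of_dominant[where H = H and p = p and j = j, OF \<phi> H p deg j(1) \<rho>1]
  have mP: "mahler P = (\<Prod>k<N. mahler (p k))" unfolding P_eq using p0 by (rule mahler_prod)
  have r1: "1 \<le> real \<rho>" using \<rho>1 by simp
  have "real \<rho> \<le> real B ^ (2 * N + 1)"
    using t(1) B unfolding \<rho>_def semiring_1_class.of_nat_power by (intro power_increasing) auto
  then have "real \<rho> ^ (growth_degree N N + N * N) \<le> (real B ^ (2 * N + 1)) ^ (growth_degree N N + N * N)"
    using r1 by (intro power_mono) auto
  then have def_ge: "real \<rho> ^ (growth_degree N N + N * N) * 12 ^ N \<le> defect N"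
    unfolding defect_def power_mult B_eq by (intro mult_right_mono) auto
  have "real \<rho> ^ (N * N) * 6 ^ N \<le> real \<rho> ^ (growth_degree N N + N * N) * 12 ^ N"
    using r1 by (intro mult_mono power_increasing power_mono) auto
  then have low: "real \<rho> ^ (N * N) * 6 ^ N \<le> defect N" using def_ge by linarith
  have "mahler (p k) \<le> (6 * real \<rho> ^ N) * (real_of_int \<bar>coeff (p k) (j k)\<bar> / 3)" if "k < N" for k
    using j(2)[OF that] by simp
  then have "mahler P \<le> (\<Prod>k<N. (6 * real \<rho> ^ N) * (real_of_int \<bar>coeff (p k) (j k)\<bar> / 3))"
    unfolding mP using mahler_pos by (intro prod_mono) (auto intro: less_imp_le)
  also have "\<dots> = (real \<rho> ^ (N * N) * 6 ^ N) * (\<Prod>k<N. real_of_int \<bar>coeff (p k) (j k)\<bar> / 3)"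
    by (simp only: prod.distrib prod_constant card_lessThan power_mult_distrib power_mult mult.commute)
  also have "\<dots> \<le> defect N * (\<Prod>k<N. real_of_int \<bar>coeff (p k) (j k)\<bar> / 3)"
    using low by (intro mult_right_mono prod_nonneg) auto
  finally have "mahler P / defect N \<le> (\<Prod>k<N. real_of_int \<bar>coeff (p k) (j k)\<bar> / 3)"
    using defect_ge_1[of N] by (simp add: field_simps)
  then show "grows_at_least (monoid_vec TYPE(rat) N) \<phi> (mahler P / defect N)"
    using mahler_pos[of P] defect_ge_1[of N] by (intro grows_at_least_mono[OF gb(1)]) auto
  have "3 * real (coeff_l1 (p k)) \<le> (12 * real \<rho> ^ N) * mahler (p k)" if "k < N" for k
  proof -
    have "2 * real \<rho> ^ N * real_of_int \<bar>coeff (p k) (j k)\<bar> \<le> 2 * real \<rho> ^ N * (2 * mahler (p k))"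
      using j(3)[OF that] by (intro mult_left_mono) auto
    then show ?thesis using j(4)[OF that] by simp
  qed
  then have "(\<Prod>k<N. 3 * real (coeff_l1 (p k))) \<le> (\<Prod>k<N. (12 * real \<rho> ^ N) * mahler (p k))"
    by (intro prod_mono) auto
  also have "\<dots> = (real \<rho> ^ (N * N) * 12 ^ N) * mahler P"
    unfolding mP by (simp only: prod.distrib prod_constant card_lessThan power_mult_distrib power_mult mult.commute)
  finally have "real \<rho> ^ growth_degree N N * (\<Prod>k<N. 3 * real (coeff_l1 (p k)))
      \<le> real \<rho> ^ growth_degree N N * ((real \<rho> ^ (N * N) * 12 ^ N) * mahler P)"
    by (intro mult_left_mono) auto
  also have "\<dots> = (real \<rho> ^ (growth_degree N N + N * N) * 12 ^ N) * mahler P"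
    by (simp add: power_add mult_ac)
  also have "\<dots> \<le> defect N * mahler P"
    using def_ge mahler_pos[of P] by (intro mult_right_mono) auto
  finally show "grows_at_most (monoid_vec TYPE(rat) N) \<phi> (mahler P * defect N)"
    using grows_at_most_mono[OF gb(2)] by (simp add: mult.commute prod_nonneg)
qed

lemma hom_comp_self: "\<phi> \<in> hom G G \<Longrightarrow> \<phi> \<circ> \<phi> \<in> hom G G"
  by (auto simp: hom_def Pi_iff)

lemma sqrt_exp_half: "sqrt (exp x) = exp (x / 2)"
  by (rule real_sqrt_unique) (simp_all add: power2_eq_square flip: exp_add)

text \<open>
  Induction on \<open>t\<close> with the claim for \<open>\<phi> \<circ> \<phi>\<close> as hypothesis: there the growth rate and the Mahler
  measure are squared while the error factor is the same, and taking square roots halves its logarithm.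
\<close>

lemma growth_bounds_improved:
  assumes "\<phi> \<in> hom (monoid_vec TYPE(rat) N) (monoid_vec TYPE(rat) N)"
    and "primitive_form P (char_poly (endo_mat N \<phi>))"
  shows "grows_at_least (monoid_vec TYPE(rat) N) \<phi> (exp (ln (mahler P) - ln (defect N) / 2 ^ t)) \<and>
    grows_at_most (monoid_vec TYPE(rat) N) \<phi> (exp (ln (mahler P) + ln (defect N) / 2 ^ t))"
  using assms
proof (induction t arbitrary: \<phi> P)
  case 0
  then show ?case using growth_bounds[OF 0] mahler_pos[of P] defect_ge_1[of N]
    by (simp add: exp_add exp_diff)
next
  case (Suc t)
  let ?G = "monoid_vec TYPE(rat) N"
  have M: "endo_mat N \<phi> \<in> carrier_mat N N" by (rule endo_mat_carrier)
  have h: "\<phi> \<circ> \<phi> \<in> hom ?G ?G" by (rule hom_comp_self[OF Suc.prems(1)])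
  have sq: "endo_mat N (\<phi> \<circ> \<phi>) = endo_mat N \<phi> * endo_mat N \<phi>" by (rule endo_mat_comp_self[OF Suc.prems(1)])
  have "lead_coeff (char_poly (endo_mat N \<phi> * endo_mat N \<phi>)) = 1"
    using degree_monic_char_poly[of "endo_mat N \<phi> * endo_mat N \<phi>" N] M by auto
  then obtain Q where Q: "primitive_form Q (char_poly (endo_mat N \<phi> * endo_mat N \<phi>))"
    using primitive_form_exists by blast
  have "mahler Q = mahler P ^ 2" by (rule mahler_square[OF M Suc.prems(2) Q])
  then have lnQ: "ln (mahler Q) = 2 * ln (mahler P)" using mahler_pos[of P] by (simp add: ln_realpow)
  have IH: "grows_at_least ?G (\<phi> \<circ> \<phi>) (exp (ln (mahler Q) - ln (defect N) / 2 ^ t))"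
    "grows_at_most ?G (\<phi> \<circ> \<phi>) (exp (ln (mahler Q) + ln (defect N) / 2 ^ t))"
    using Suc.IH[OF h] Q unfolding sq by blast+
  have e: "(ln (mahler Q) - ln (defect N) / 2 ^ t) / 2 = ln (mahler P) - ln (defect N) / 2 ^ Suc t"
    "(ln (mahler Q) + ln (defect N) / 2 ^ t) / 2 = ln (mahler P) + ln (defect N) / 2 ^ Suc t"
    unfolding lnQ by (simp_all add: field_simps)
  show ?case
    using grows_at_least_sqrt[OF group_rat_vec Suc.prems(1) _ IH(1)] grows_at_most_sqrt[OF group_rat_vec Suc.prems(1) _ IH(2)]
    unfolding sqrt_exp_half e by simp
qed

theorem mainTheorem1:
  fixes N :: nat and \<phi> :: "rat Matrix.vec \<Rightarrow> rat Matrix.vec"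
  assumes "0 < N"
    and "\<phi> \<in> hom (monoid_vec TYPE(rat) N) (monoid_vec TYPE(rat) N)"
  shows "discrete_alg_entropy (monoid_vec TYPE(rat) N) \<phi> =
    ereal (log_mahler_measure (map_poly of_rat (char_poly_over_int N \<phi>)))"
proof -
  let ?G = "monoid_vec TYPE(rat) N"
  have M: "endo_mat N \<phi> \<in> carrier_mat N N" by (rule endo_mat_carrier)
  have "lead_coeff (char_poly (endo_mat N \<phi>)) = 1"
    using degree_monic_char_poly[OF M] by simp
  then obtain P where P: "primitive_form P (char_poly (endo_mat N \<phi>))"
    using primitive_form_exists by blast
  define m where "m = ln (mahler P)"
  define L where "L = ln (defect N)"
  have "char_poly_over_int N \<phi> = of_int_poly P"
    unfolding char_poly_over_int_def Let_def primitive_form_eq[OF P] ..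
  then have "map_poly of_rat (char_poly_over_int N \<phi>) = (of_int_poly P :: complex poly)"
    by (simp add: poly_eq_iff coeff_map_poly)
  then have m: "log_mahler_measure (map_poly of_rat (char_poly_over_int N \<phi>)) = m"
    by (simp add: m_def mahler_def)
  have lim: "(\<lambda>t. c / 2 ^ t :: real) \<longlonglongrightarrow> 0" for c
    using tendsto_mult_right[OF LIMSEQ_inverse_realpow_zero[of 2], of c] by (simp add: divide_inverse mult.commute)
  have lower: "ereal (m - L / 2 ^ t) \<le> discrete_alg_entropy ?G \<phi>" for t
    using entropy_ge[OF group_rat_vec assms(2) exp_gt_zero conjunct1[OF growth_bounds_improved[OF assms(2) P]], of t]
    by (simp add: m_def L_def)
  have upper: "discrete_alg_entropy ?G \<phi> \<le> ereal (m + L / 2 ^ t)" for t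
    using entropy_le[OF group_rat_vec assms(2) exp_gt_zero conjunct2[OF growth_bounds_improved[OF assms(2) P]], of t]
    by (simp add: m_def L_def)
  have "(\<lambda>t. m - L / 2 ^ t) \<longlonglongrightarrow> m - 0" "(\<lambda>t. m + L / 2 ^ t) \<longlonglongrightarrow> m + 0"
    by (intro tendsto_intros lim)+
  then have "(\<lambda>t. ereal (m - L / 2 ^ t)) \<longlonglongrightarrow> ereal m" "(\<lambda>t. ereal (m + L / 2 ^ t)) \<longlonglongrightarrow> ereal m"
    by simp_all
  then have "ereal m \<le> discrete_alg_entropy ?G \<phi>" "discrete_alg_entropy ?G \<phi> \<le> ereal m"
    using LIMSEQ_le_const2[where X = "\<lambda>t. ereal (m - L / 2 ^ t)"] LIMSEQ_le_const[where X = "\<lambda>t. ereal (m + L / 2 ^ t)"]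
      lower upper by blast+
  then show ?thesis unfolding m by (rule antisym[rotated])
qed

end
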